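(* There is a polynomial-time algorithm for $Q|G=\mathrm{bipartite},\,p_j=1|C_{\max}$ with the following property. Let $p:\mathbb{N}\to[0,1]$ be monotonic, and for each $n$ let a set of at least two uniform machines with speeds $s_1\ge\dots\ge s_m\ge1$ be given. If the incompatibility graph on the $2n$ unit-time jobs is drawn from $\mathcal{G}_{n,n,p(n)}$, then asymptotically almost surely the algorithm returns a feasible schedule $S$ with $C_{\max}(S)\le 2C^*_{\max}$.
   Context: Problem $Q|G=\mathrm{bipartite},\,p_j=1|C_{\max}$: there are $m$ uniform machines $M_1,\dots,M_m$ with speeds $s_1\ge\dots\ge s_m\ge 1$, jobs each with processing requirement $1$, and a bipartite incompatibility graph $G$ on the jobs. A feasible schedule assigns each job to exactly one machine so that the jobs on each machine form an independent set in $G$; a job on $M_i$ takes time $1/s_i$, and the makespan $C_{\max}$ is the maximum over machines of the total processing time of jobs assigned to it. $C^*_{\max}$ is the minimum makespan over feasible schedules. The random bipartite graph $\mathcal{G}_{n,n,p}$ has vertex set $V_1\cup V_2$ with $|V_1|=|V_2|=n$, and each of the $n^2$ pairs between $V_1$ and $V_2$ is an edge independently with probability $p$. "Asymptotically almost surely" means with probability tending to $1$ as $n\to\infty$. *)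

theory Defs
  imports
    "HOL-Probability.Probability"
    "HOL-Probability.Product_PMF"
    "HOL-Computational_Algebra.Polynomial"
    "HOL-Library.Discrete_Functions"
begin

section \<open>Random access programs with logarithmic cost\<close>

text \<open>
  The machine model is the random access machine with the logarithmic cost criterion, in a
  structured form: while programs over finitely many named arrays of natural numbers. Each
  operation is charged the bit lengths of the numbers it handles, addresses included, so that
  polynomial time here is polynomial time on a Turing machine.
\<close>

type_synonym state = "string \<Rightarrow> nat \<Rightarrow> nat"

datatype aexp =
    Const nat
  | Get string aexp
  | Plus aexp aexp
  | Minus aexp aexp
  | Times aexp aexp
  | Div aexp aexp

datatype bexp =
    Less aexp aexp
  | Eq aexp aexp
  | Neg bexp
  | Conj bexp bexp

datatype com =
    Skip
  | Put string aexp aexp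
  | Seq com com
  | Cond bexp com com
  | While bexp com

definition bits :: "nat \<Rightarrow> nat" where
  "bits n = Suc (floor_log n)"

fun aval :: "aexp \<Rightarrow> state \<Rightarrow> nat" where
  "aval (Const n) s = n"
| "aval (Get x a) s = s x (aval a s)"
| "aval (Plus a b) s = aval a s + aval b s"
| "aval (Minus a b) s = aval a s - aval b s"
| "aval (Times a b) s = aval a s * aval b s"
| "aval (Div a b) s = aval a s div aval b s"

fun acost :: "aexp \<Rightarrow> state \<Rightarrow> nat" where
  "acost (Const n) s = bits n"
| "acost (Get x a) s = acost a s + bits (aval a s) + bits (s x (aval a s))"
| "acost (Plus a b) s = acost a s + acost b s + bits (aval a s) + bits (aval b s)"
| "acost (Minus a b) s = acost a s + acost b s + bits (aval a s) + bits (aval b s)"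
| "acost (Times a b) s = acost a s + acost b s + bits (aval a s) + bits (aval b s)"
| "acost (Div a b) s = acost a s + acost b s + bits (aval a s) + bits (aval b s)"

fun bval :: "bexp \<Rightarrow> state \<Rightarrow> bool" where
  "bval (Less a b) s \<longleftrightarrow> aval a s < aval b s"
| "bval (Eq a b) s \<longleftrightarrow> aval a s = aval b s"
| "bval (Neg b) s \<longleftrightarrow> \<not> bval b s"
| "bval (Conj b c) s \<longleftrightarrow> bval b s \<and> bval c s"

fun bcost :: "bexp \<Rightarrow> state \<Rightarrow> nat" where
  "bcost (Less a b) s = acost a s + acost b s + bits (aval a s) + bits (aval b s)"
| "bcost (Eq a b) s = acost a s + acost b s + bits (aval a s) + bits (aval b s)"
| "bcost (Neg b) s = Suc (bcost b s)"
| "bcost (Conj b c) s = Suc (bcost b s + bcost c s)"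

text \<open>\<open>exec c s t s'\<close>: started in \<open>s\<close>, the program \<open>c\<close> halts in \<open>s'\<close> after time \<open>t\<close>.\<close>

inductive exec :: "com \<Rightarrow> state \<Rightarrow> nat \<Rightarrow> state \<Rightarrow> bool" where
  Skip: "exec Skip s 1 s"
| Put: "exec (Put x a b) s
          (Suc (acost a s + acost b s + bits (aval a s) + bits (aval b s)))
          (s(x := (s x)(aval a s := aval b s)))"
| Seq: "exec c s t s' \<Longrightarrow> exec d s' u s'' \<Longrightarrow> exec (Seq c d) s (t + u) s''"
| CondTrue: "bval b s \<Longrightarrow> exec c s t s' \<Longrightarrow> exec (Cond b c d) s (Suc (bcost b s + t)) s'"
| CondFalse: "\<not> bval b s \<Longrightarrow> exec d s t s' \<Longrightarrow> exec (Cond b c d) s (Suc (bcost b s + t)) s'"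
| WhileFalse: "\<not> bval b s \<Longrightarrow> exec (While b c) s (Suc (bcost b s)) s"
| WhileTrue: "bval b s \<Longrightarrow> exec c s t s' \<Longrightarrow> exec (While b c) s' u s'' \<Longrightarrow>
     exec (While b c) s (Suc (bcost b s + t + u)) s''"

inductive_cases exec_SkipE: "exec Skip s t s'"
inductive_cases exec_PutE: "exec (Put x a b) s t s'"
inductive_cases exec_SeqE: "exec (Seq c d) s t s'"
inductive_cases exec_CondE: "exec (Cond b c d) s t s'"
inductive_cases exec_WhileE: "exec (While b c) s t s'"

lemma exec_deterministic:
  assumes "exec c s t s'" and "exec c s u s''"
  shows "t = u \<and> s' = s''"
  using assms
proof (induction arbitrary: u s'' rule: exec.induct)
  case (Skip s)
  then show ?case by (elim exec_SkipE) simp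
next
  case (Put x a b s)
  then show ?case by (elim exec_PutE) simp
next
  case (Seq c s t s' d u' s3)
  from Seq.prems show ?case
    by (rule exec_SeqE) (metis Seq.IH)
next
  case (CondTrue b s c t s' d)
  from CondTrue.prems show ?case
    by (rule exec_CondE) (metis CondTrue.IH, metis CondTrue.hyps(1))
next
  case (CondFalse b s d t s' c)
  from CondFalse.prems show ?case
    by (rule exec_CondE) (metis CondFalse.hyps(1), metis CondFalse.IH)
next
  case (WhileFalse b s c)
  from WhileFalse.prems show ?case
    by (rule exec_WhileE) (simp, metis WhileFalse.hyps)
next
  case (WhileTrue b s c t s' u' s3)
  from WhileTrue.prems show ?case
    by (rule exec_WhileE) (metis WhileTrue.hyps(1), metis WhileTrue.IH)
qed

definition input_state :: "nat list \<Rightarrow> state" where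
  "input_state xs = (\<lambda>x i. if x = ''in'' \<and> i < length xs then xs ! i else 0)"


section \<open>Unit jobs on uniform machines with a bipartite incompatibility graph\<close>

text \<open>
  The jobs are \<open>0, \<dots>, jobs I - 1\<close> and the machines are \<open>0, \<dots>, length (speeds I) - 1\<close>. An
  edge is the set of its two endpoints. Speeds are part of the input of an algorithm, hence rational.
\<close>

record inst =
  jobs :: nat
  edges :: "nat set set"
  speeds :: "rat list"

definition bipartite :: "'a set \<Rightarrow> 'a set set \<Rightarrow> bool" where
  "bipartite V E \<longleftrightarrow>
     (\<exists>X Y. X \<union> Y = V \<and> X \<inter> Y = {} \<and> (\<forall>e\<in>E. \<exists>u\<in>X. \<exists>v\<in>Y. e = {u, v}))"

definition independent_set :: "'a set set \<Rightarrow> 'a set \<Rightarrow> bool" where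
  "independent_set E W \<longleftrightarrow> (\<forall>u\<in>W. \<forall>v\<in>W. {u, v} \<notin> E)"

definition valid_speeds :: "rat list \<Rightarrow> bool" where
  "valid_speeds ss \<longleftrightarrow> ss \<noteq> [] \<and> sorted_wrt (\<ge>) ss \<and> (\<forall>s\<in>set ss. 1 \<le> s)"

definition valid_inst :: "inst \<Rightarrow> bool" where
  "valid_inst I \<longleftrightarrow> bipartite {..<jobs I} (edges I) \<and> valid_speeds (speeds I)"

text \<open>A schedule is the list that gives for each job its machine.\<close>

definition jobs_on :: "nat list \<Rightarrow> nat \<Rightarrow> nat set" where
  "jobs_on S i = {j. j < length S \<and> S ! j = i}"

definition feasible :: "inst \<Rightarrow> nat list \<Rightarrow> bool" where
  "feasible I S \<longleftrightarrow> length S = jobs I \<and> (\<forall>j<jobs I. S ! j < length (speeds I)) \<and>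
     (\<forall>i<length (speeds I). independent_set (edges I) (jobs_on S i))"

definition makespan :: "inst \<Rightarrow> nat list \<Rightarrow> rat" where
  "makespan I S = Max ((\<lambda>i. \<Sum>j\<in>jobs_on S i. 1 / speeds I ! i) ` {..<length (speeds I)})"

definition opt_makespan :: "inst \<Rightarrow> rat" where
  "opt_makespan I = Min (makespan I ` {S. feasible I S})"


section \<open>Polynomial-time algorithms for the scheduling problem\<close>

text \<open>
  The input consists of the number of jobs, the number of machines, the adjacency matrix row by
  row, and the numerator and denominator of each speed in lowest terms.
\<close>

definition encode :: "inst \<Rightarrow> nat list" where
  "encode I = [jobs I, length (speeds I)]
     @ concat (map (\<lambda>u. map (\<lambda>v. if {u, v} \<in> edges I then 1 else 0) [0..<jobs I]) [0..<jobs I])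
     @ concat (map (\<lambda>s. [nat (fst (quotient_of s)), nat (snd (quotient_of s))]) (speeds I))"

definition input_size :: "inst \<Rightarrow> nat" where
  "input_size I = sum_list (map bits (encode I))"

definition returns :: "com \<Rightarrow> inst \<Rightarrow> nat list \<Rightarrow> bool" where
  "returns A I S \<longleftrightarrow>
     (\<exists>t s. exec A (input_state (encode I)) t s \<and> S = map (s ''out'') [0..<jobs I])"

definition polynomial_time :: "com \<Rightarrow> bool" where
  "polynomial_time A \<longleftrightarrow>
     (\<exists>P :: nat poly. \<forall>I. valid_inst I \<longrightarrow>
        (\<exists>t s. exec A (input_state (encode I)) t s \<and> t \<le> poly P (input_size I)))"

text \<open>
  As an algorithm for the optimization problem, the program has to return a feasible schedule
  whenever there is one; there is none only for a single machine and a graph with an edge.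
\<close>

definition polynomial_time_algorithm :: "com \<Rightarrow> bool" where
  "polynomial_time_algorithm A \<longleftrightarrow> polynomial_time A \<and>
     (\<forall>I. valid_inst I \<and> (\<exists>S. feasible I S) \<longrightarrow> (\<exists>S. returns A I S \<and> feasible I S))"


section \<open>Random bipartite graphs\<close>

text \<open>The edge set of a random graph between \<open>V\<^sub>1\<close> and \<open>V\<^sub>2\<close>, which are meant to be finite
  and disjoint.\<close>

definition random_bipartite :: "'a set \<Rightarrow> 'a set \<Rightarrow> real \<Rightarrow> 'a set set pmf" where
  "random_bipartite V\<^sub>1 V\<^sub>2 p =
     map_pmf (\<lambda>f. {{u, v} |u v. u \<in> V\<^sub>1 \<and> v \<in> V\<^sub>2 \<and> f (u, v)})
       (Pi_pmf (V\<^sub>1 \<times> V\<^sub>2) False (\<lambda>_. bernoulli_pmf p))"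

end

theory Submission
  imports Defs
begin

text \<open>
  The algorithm two-colours the graph, gives all isolated jobs to the first class and swaps the
  colours so that the second class has at most half of the \<open>X\<close> non-isolated jobs. For a trial
  makespan it fills the machines in the order of their speeds with the first class and, from the
  next machine on, with the second class; it keeps the best of the trial makespans \<open>q / s\<^sub>i\<close>, with
  \<open>q\<close> at most twice the number of jobs, for which all jobs fit. Twice the optimum is such a trial
  makespan. It offers at least twice the capacity used by an optimal schedule on each machine, so
  all jobs fit unless the fastest machine alone holds the first class; in that case they fit as
  soon as the other machines have to process at least \<open>X / 4\<close> jobs in every schedule. They have to
  process at least a vertex cover, so it suffices that \<open>X \<le> 4\<tau>\<close> for the vertex cover number \<open>\<tau>\<close>.

  In \<open>G(n, n, p)\<close> this holds asymptotically almost surely, uniformly in \<open>p\<close>. If \<open>n\<^sup>2 p\<close> is at most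
  \<open>n\<close> to the power \<open>1/4\<close>, the edges form a matching. If \<open>n p \<ge> 6\<close>, a union bound shows \<open>\<tau> \<ge> n / 2\<close>.
  In between, the edge weights \<open>1 / (deg u + deg v - 1)\<close> form a fractional matching, hence bound
  \<open>\<tau>\<close> from below; their expected sum exceeds a quarter of the expectation of \<open>X\<close> by a constant
  multiple of \<open>n\<^sup>2 p\<close>, and \<open>4\<tau> - X\<close> has variance at most \<open>16 n\<^sup>2 p\<close> by the Efron--Stein inequality.
\<close>

section \<open>Programs with bounded loops\<close>

text \<open>Cost and correctness are kept apart. The algorithm is written in a language whose loop
  bounds depend on the input only; there execution is a total function \<open>run\<close>, and one
  generic theorem bounds the cost of every compiled program, so each piece of the algorithm needs
  just an invariant for \<open>run\<close>.

  The obstacle in the scheduling part is that colours are swapped globally, not per component. For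
  two equal stars with oppositely coloured centres, the second class has X/2 jobs although two
  vertices cover all edges. Hence X \<le> 4\<tau> has to come from randomness. The 4 is 2 times 2:
  the second class has at most X/2 jobs, and the slower machines offer twice the load that an
  optimal schedule gives them.

  The edge weights are chosen for their exactly computable mean: by symmetry, the 2n - 1 pairs
  meeting a given pair share equally the probability that one of them is an edge. Since 4n^2/(2n -
  1) \<ge> 2n, this compares directly with the mean of X. Chebyshev then leaves an error of order
  1/(n^2 p), which says nothing when the expected number of edges stays bounded; this forces the
  separate treatment of very sparse graphs.\<close>

datatype fcom =
    FSkip
  | FPut string aexp aexp
  | FSeq fcom fcom
  | FCond bexp fcom fcom
  | FFor string aexp fcom

text \<open>A constant of its own, so that nested updates are resolved by array name and index
  through the two rules below, without unfolding function updates.\<close>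

definition upd :: "state \<Rightarrow> string \<Rightarrow> nat \<Rightarrow> nat \<Rightarrow> state" where
  "upd s x i v = s(x := (s x)(i := v))"

lemma upd_same [simp]: "upd s x i v x j = (if j = i then v else s x j)"
  by (simp add: upd_def)

lemma upd_other [simp]: "y \<noteq> x \<Longrightarrow> upd s x i v y = s y"
  by (simp add: upd_def)

fun run :: "fcom \<Rightarrow> state \<Rightarrow> state" where
  "run FSkip s = s"
| "run (FPut x a b) s = upd s x (aval a s) (aval b s)"
| "run (FSeq c d) s = run d (run c s)"
| "run (FCond b c d) s = (if bval b s then run c s else run d s)"
| "run (FFor x e c) s =
     ((\<lambda>r. upd (run c r) x 0 (Suc (r x 0))) ^^ aval e s) (upd s x 0 0)"

text \<open>The compiled loop evaluates its bound again before every pass, whereas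
  \<open>run\<close> evaluates it once. The two agree for tame programs: their bounds read only
  \<open>''in''\<close>, which is never written, and loop bodies leave the counter alone.\<close>

fun compile :: "fcom \<Rightarrow> com" where
  "compile FSkip = Skip"
| "compile (FPut x a b) = Put x a b"
| "compile (FSeq c d) = Seq (compile c) (compile d)"
| "compile (FCond b c d) = Cond b (compile c) (compile d)"
| "compile (FFor x e c) = Seq (Put x (Const 0) (Const 0))
     (While (Less (Get x (Const 0)) e)
        (Seq (compile c) (Put x (Const 0) (Plus (Get x (Const 0)) (Const 1)))))"

fun reads :: "aexp \<Rightarrow> string set" where
  "reads (Const n) = {}"
| "reads (Get x a) = insert x (reads a)"
| "reads (Plus a b) = reads a \<union> reads b"
| "reads (Minus a b) = reads a \<union> reads b"
| "reads (Times a b) = reads a \<union> reads b"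
| "reads (Div a b) = reads a \<union> reads b"

fun writes :: "fcom \<Rightarrow> string set" where
  "writes FSkip = {}"
| "writes (FPut x a b) = {x}"
| "writes (FSeq c d) = writes c \<union> writes d"
| "writes (FCond b c d) = writes c \<union> writes d"
| "writes (FFor x e c) = insert x (writes c)"

text \<open>Products and quotients may occur in addresses, tests and loop bounds, but not as stored
  values: repeated squaring would make bit lengths exponential in the number of steps.\<close>

fun growth_le1 :: "aexp \<Rightarrow> bool" where
  "growth_le1 (Const n) \<longleftrightarrow> n \<le> 1"
| "growth_le1 (Get x a) \<longleftrightarrow> True"
| "growth_le1 (Plus (Get x a) (Const n)) \<longleftrightarrow> n \<le> 1"
| "growth_le1 (Minus a b) \<longleftrightarrow> growth_le1 a"
| "growth_le1 _ \<longleftrightarrow> False"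

text \<open>Stored values grow by at most one per assignment, so that their bit lengths stay small;
  loop bounds depend on the input only.\<close>

fun tame :: "fcom \<Rightarrow> bool" where
  "tame FSkip \<longleftrightarrow> True"
| "tame (FPut x a b) \<longleftrightarrow> x \<noteq> ''in'' \<and> growth_le1 b"
| "tame (FSeq c d) \<longleftrightarrow> tame c \<and> tame d"
| "tame (FCond b c d) \<longleftrightarrow> tame c \<and> tame d"
| "tame (FFor x e c) \<longleftrightarrow> x \<noteq> ''in'' \<and> reads e \<subseteq> {''in''} \<and> x \<notin> writes c \<and> tame c"

fun loop_bounds :: "fcom \<Rightarrow> aexp set" where
  "loop_bounds FSkip = {}"
| "loop_bounds (FPut x a b) = {}"
| "loop_bounds (FSeq c d) = loop_bounds c \<union> loop_bounds d"
| "loop_bounds (FCond b c d) = loop_bounds c \<union> loop_bounds d"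
| "loop_bounds (FFor x e c) = insert e (loop_bounds c)"

text \<open>Bounds both the number of elementary steps and the growth of stored values, as a step
  raises the maximum by at most one. Each pass of a loop pays two extra steps for test and
  increment; the other two are the initialisation and the last test.\<close>

fun steps :: "fcom \<Rightarrow> nat \<Rightarrow> nat" where
  "steps FSkip L = 1"
| "steps (FPut x a b) L = 1"
| "steps (FSeq c d) L = steps c L + steps d L"
| "steps (FCond b c d) L = 1 + steps c L + steps d L"
| "steps (FFor x e c) L = 2 + L * (steps c L + 2)"

text \<open>The value of \<open>a\<close> has at most \<open>alen a * B\<close> bits and its evaluation costs at most
  \<open>acoef a * B\<close> if all stored values have at most \<open>B\<close> bits.\<close>

fun alen :: "aexp \<Rightarrow> nat" where
  "alen (Const n) = bits n"
| "alen (Get x a) = 1"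
| "alen (Plus a b) = alen a + alen b"
| "alen (Minus a b) = alen a + alen b"
| "alen (Times a b) = alen a + alen b"
| "alen (Div a b) = alen a + alen b"

fun acoef :: "aexp \<Rightarrow> nat" where
  "acoef (Const n) = bits n"
| "acoef (Get x a) = acoef a + alen a + 1"
| "acoef (Plus a b) = acoef a + acoef b + alen a + alen b"
| "acoef (Minus a b) = acoef a + acoef b + alen a + alen b"
| "acoef (Times a b) = acoef a + acoef b + alen a + alen b"
| "acoef (Div a b) = acoef a + acoef b + alen a + alen b"

fun bcoef :: "bexp \<Rightarrow> nat" where
  "bcoef (Less a b) = acoef a + acoef b + alen a + alen b"
| "bcoef (Eq a b) = acoef a + acoef b + alen a + alen b"
| "bcoef (Neg b) = Suc (bcoef b)"
| "bcoef (Conj b c) = Suc (bcoef b + bcoef c)"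

text \<open>Cost of one elementary step per bit of word length. The 20 in the loop case leaves room
  for resetting the counter, at cost 5, and for incrementing it, which has coefficient 11.\<close>

fun coef :: "fcom \<Rightarrow> nat" where
  "coef FSkip = 1"
| "coef (FPut x a b) = Suc (acoef a + acoef b + alen a + alen b)"
| "coef (FSeq c d) = coef c + coef d"
| "coef (FCond b c d) = Suc (bcoef b) + coef c + coef d"
| "coef (FFor x e c) = 20 + Suc (bcoef (Less (Get x (Const 0)) e)) + coef c"

section \<open>Bit lengths and the cost of expressions\<close>

lemma bits_leI: "n < 2 ^ B \<Longrightarrow> 0 < B \<Longrightarrow> bits n \<le> B"
  using floor_log_le_iff[of n] unfolding bits_def
  by (metis Suc_leI floor_log_zero floor_log_exp2_le gr0I le_less_trans nat_power_less_imp_less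
      pos2)

lemma less_two_power_bits: "n < 2 ^ bits n"
  unfolding bits_def using floor_log_exp2_gt[of n] by simp

lemma bits_pos: "0 < bits n"
  by (simp add: bits_def)

lemma bits_mono: "m \<le> n \<Longrightarrow> bits m \<le> bits n"
  by (simp add: bits_def floor_log_le_iff)

lemma bits_add: "bits (m + n) \<le> bits m + bits n"
proof (rule bits_leI)
  have "m + n < 2 ^ bits m + 2 ^ bits n"
    by (intro add_strict_mono less_two_power_bits)
  also have "\<dots> \<le> 2 ^ bits m * (2 ^ bits n :: nat)"
  proof -
    have "2 \<le> (2 ^ bits m :: nat)" "2 \<le> (2 ^ bits n :: nat)"
      using bits_pos[of m] bits_pos[of n] power_increasing[of 1 _ "2 :: nat"] by auto
    then have "2 * 2 ^ bits n \<le> 2 ^ bits m * (2 ^ bits n :: nat)" "2 ^ bits m * 2 \<le> 2 ^ bits m * (2 ^ bits n :: nat)"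
      by (intro mult_right_mono mult_left_mono; simp)+
    then show ?thesis by linarith
  qed
  finally show "m + n < 2 ^ (bits m + bits n)"
    by (simp add: power_add)
qed (simp add: bits_pos)

lemma bits_mult: "bits (m * n) \<le> bits m + bits n"
proof (rule bits_leI)
  show "m * n < 2 ^ (bits m + bits n)"
    unfolding power_add by (intro mult_strict_mono less_two_power_bits) auto
qed (simp add: bits_pos)

lemma bits_aval_le:
  assumes "\<forall>x i. bits (s x i) \<le> B" "0 < B"
  shows "bits (aval a s) \<le> alen a * B"
proof (induction a)
  case (Const n)
  then show ?case using assms(2) by simp
next
  case (Get x a)
  then show ?case using assms(1) by simp
next
  case (Plus a b)
  then show ?case using bits_add[of "aval a s" "aval b s"] by (simp add: distrib_right)
next
  case (Minus a b)
  then show ?case using bits_mono[of "aval a s - aval b s" "aval a s"] by (simp add: distrib_right)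
next
  case (Times a b)
  then show ?case using bits_mult[of "aval a s" "aval b s"] by (simp add: distrib_right)
next
  case (Div a b)
  then show ?case using bits_mono[of "aval a s div aval b s" "aval a s"]
    by (simp add: distrib_right)
qed

lemma acost_le:
  assumes "\<forall>x i. bits (s x i) \<le> B" "0 < B"
  shows "acost a s \<le> acoef a * B"
proof (induction a)
  case (Const n)
  then show ?case using assms(2) by simp
next
  case (Get x a)
  then show ?case using bits_aval_le[OF assms, of a] assms(1)[rule_format, of x "aval a s"]
    by (simp add: distrib_right)
qed (use bits_aval_le[OF assms] in \<open>simp_all add: distrib_right add_mono\<close>)

lemma bcost_le:
  assumes "\<forall>x i. bits (s x i) \<le> B" "0 < B"
  shows "bcost b s \<le> bcoef b * B"
  by (induction b)
    (use bits_aval_le[OF assms] acost_le[OF assms] assms(2) in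
      \<open>simp_all add: distrib_right add_mono\<close>)

lemma aval_cong: "(\<And>x. x \<in> reads a \<Longrightarrow> s x = r x) \<Longrightarrow> aval a s = aval a r"
  by (induction a) auto

lemma run_frame: "x \<notin> writes c \<Longrightarrow> run c s x = s x"
proof (induction c arbitrary: s)
  case (FFor y e c)
  have "((\<lambda>r. upd (run c r) y 0 (Suc (r y 0))) ^^ n) t x = t x" for n t
    using FFor by (induction n) auto
  then show ?case using FFor.prems by simp
qed auto

lemma tame_writes: "tame c \<Longrightarrow> ''in'' \<notin> writes c"
  by (induction c) auto

lemma aval_le_Suc:
  assumes "growth_le1 a" "\<And>x i. s x i \<le> M"
  shows "aval a s \<le> Suc M"
  using assms(1)
proof (induction a rule: growth_le1.induct)
  case (2 x a)
  then show ?case using assms(2)[of x "aval a s"] by simp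
next
  case (3 x a n)
  then show ?case using assms(2)[of x "aval a s"] by simp
qed auto

text \<open>Time and value bounds must be proved together: the cost of a step depends on the bit
  lengths, and these on how far values have grown. \<open>K\<close> and \<open>B\<close> are fixed
  for the whole program, so that all subprograms share the price \<open>K * B\<close> of a
  step.\<close>

lemma exec_compile:
  assumes "tame c" "\<And>x i. s x i \<le> M" "\<And>e. e \<in> loop_bounds c \<Longrightarrow> aval e s \<le> L"
    and "coef c \<le> K" "bits (M + steps c L) \<le> B"
  shows "\<exists>t. exec (compile c) s t (run c s) \<and> t \<le> steps c L * (K * B)
     \<and> (\<forall>x i. run c s x i \<le> M + steps c L)"
  using assms
proof (induction c arbitrary: s M)
  case FSkip
  have "0 < K * B"
    using FSkip.prems(4,5) bits_pos[of "M + steps FSkip L"] by (simp add: order_less_le_trans)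
  moreover have "run FSkip s x i \<le> M + steps FSkip L" for x i
    using FSkip.prems(2)[of x i] by simp
  ultimately show ?case using exec.Skip[of s] by force
next
  case (FPut x a b)
  have B: "0 < B" "\<forall>y i. bits (s y i) \<le> B"
    using FPut.prems(5) bits_pos[of "M + steps (FPut x a b) L"]
      bits_mono[OF trans_le_add1[OF FPut.prems(2)], of _ _ "steps (FPut x a b) L"]
    by (auto intro: order_trans)
  have "Suc (acost a s + acost b s + bits (aval a s) + bits (aval b s))
      \<le> coef (FPut x a b) * B"
    using acost_le[OF B(2,1), of a] acost_le[OF B(2,1), of b] bits_aval_le[OF B(2,1), of a]
      bits_aval_le[OF B(2,1), of b] B(1) by (simp add: distrib_right)
  also have "\<dots> \<le> K * B"
    using FPut.prems(4) by (rule mult_right_mono) simp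
  finally have "Suc (acost a s + acost b s + bits (aval a s) + bits (aval b s)) \<le> K * B" .
  moreover have "run (FPut x a b) s y i \<le> M + steps (FPut x a b) L" for y i
    using aval_le_Suc[of b s M] FPut.prems(1,2) le_SucI[OF FPut.prems(2)]
    by (cases "y = x") auto
  ultimately show ?case using exec.Put[of x a b s] by (auto simp: upd_def simp del: fun_upd_apply)
next
  case (FSeq c d)
  let ?M = "M + steps c L"
  have "bits ?M \<le> B"
    using FSeq.prems(5) bits_mono[of ?M "M + steps (FSeq c d) L"] by simp
  then obtain t where t: "exec (compile c) s t (run c s)" "t \<le> steps c L * (K * B)"
    "\<And>x i. run c s x i \<le> ?M"
    using FSeq.IH(1)[of s M] FSeq.prems by auto
  have lb: "aval e (run c s) \<le> L" if "e \<in> loop_bounds d" for e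
  proof -
    have "reads e \<subseteq> {''in''}"
      using that FSeq.prems(1) by (induction d) auto
    then have "aval e (run c s) = aval e s"
      using run_frame[of "''in''" c] tame_writes[of c] FSeq.prems(1) by (intro aval_cong) auto
    then show ?thesis using FSeq.prems(3) that by auto
  qed
  obtain u where u: "exec (compile d) (run c s) u (run d (run c s))" "u \<le> steps d L * (K * B)"
    "\<And>x i. run d (run c s) x i \<le> ?M + steps d L"
    using FSeq.IH(2)[of "run c s" ?M] FSeq.prems t(3) lb by (auto simp: add.assoc)
  show ?case
    using exec.Seq[OF t(1) u(1)] t(2) u(2,3)
    by (intro exI[of _ "t + u"]) (auto simp: distrib_right add.assoc)
next
  case (FCond b c d)
  have B: "0 < B" "\<forall>y i. bits (s y i) \<le> B"
    using FCond.prems(5) bits_pos[of "M + steps (FCond b c d) L"]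
      bits_mono[OF trans_le_add1[OF FCond.prems(2)], of _ _ "steps (FCond b c d) L"]
    by (auto intro: order_trans)
  have "Suc (bcost b s) \<le> Suc (bcoef b) * B"
    using bcost_le[OF B(2,1), of b] B(1) by simp
  also have "\<dots> \<le> K * B"
    using FCond.prems(4) by (intro mult_right_mono) auto
  finally have *: "Suc (bcost b s) \<le> K * B" .
  have c: "bits (M + steps c L) \<le> B" "bits (M + steps d L) \<le> B"
    using FCond.prems(5) bits_mono[of "M + steps c L" "M + steps (FCond b c d) L"]
      bits_mono[of "M + steps d L" "M + steps (FCond b c d) L"] by simp_all
  obtain t where t: "exec (compile c) s t (run c s)" "t \<le> steps c L * (K * B)"
    "\<And>x i. run c s x i \<le> M + steps c L"
    using FCond.IH(1)[of s M] FCond.prems c by auto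
  obtain u where u: "exec (compile d) s u (run d s)" "u \<le> steps d L * (K * B)"
    "\<And>x i. run d s x i \<le> M + steps d L"
    using FCond.IH(2)[of s M] FCond.prems c by auto
  show ?case
  proof (cases "bval b s")
    case True
    then show ?thesis
      using exec.CondTrue[OF True t(1), of "compile d"] t(2) *
        trans_le_add1[OF t(3), of _ _ "Suc (steps d L)"]
      by (intro exI[of _ "Suc (bcost b s + t)"]) (auto simp: distrib_right add_ac)
  next
    case False
    then show ?thesis
      using exec.CondFalse[OF False u(1), of "compile c"] u(2) *
        trans_le_add1[OF u(3), of _ _ "Suc (steps c L)"]
      by (intro exI[of _ "Suc (bcost b s + u)"]) (auto simp: distrib_right add_ac)
  qed
next
  case (FFor x e c)
  define n where "n = aval e s"
  have nL: "n \<le> L" unfolding n_def using FFor.prems(3) by simp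
  let ?g = "\<lambda>r. upd (run c r) x 0 (Suc (r x 0))"
  let ?b = "Less (Get x (Const 0)) e"
  let ?W = "While ?b (Seq (compile c) (Put x (Const 0) (Plus (Get x (Const 0)) (Const 1))))"
  let ?T = "M + steps (FFor x e c) L"
  have B: "0 < B" using FFor.prems(5) bits_pos[of ?T] by simp
  have b1: "bits 0 = 1" "bits 1 = 1" by (simp_all add: bits_def)
  have tc: "tame c" "x \<notin> writes c" "x \<noteq> ''in''" "reads e \<subseteq> {''in''}"
    using FFor.prems(1) by auto
  \<comment> \<open>\<open>k\<close> is the number of passes still to come, because
    \<open>WhileTrue\<close> peels off the earliest pass; the value bound \<open>M'\<close> rises by
    \<open>steps c L + 2\<close> per pass. The final \<open>+ 1\<close> in the time pays for the
    failing test.\<close>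
  have loop: "\<exists>t. exec ?W r t ((?g ^^ k) r) \<and> t \<le> (k * (steps c L + 2) + 1) * (K * B) \<and>
       (\<forall>x i. (?g ^^ k) r x i \<le> M' + k * (steps c L + 2))"
    if "r x 0 + k = n" "r ''in'' = s ''in''" "\<And>x i. r x i \<le> M'"
      "M' + k * (steps c L + 2) + 1 \<le> ?T" for k r M'
    using that
  proof (induction k arbitrary: r M')
    case (0 r M')
    have e: "aval e r = n"
      unfolding n_def by (rule aval_cong) (use tc 0 in auto)
    have Bv: "\<forall>y i. bits (r y i) \<le> B"
    proof (intro allI)
      fix y i show "bits (r y i) \<le> B"
      using bits_mono[of "r y i" ?T] FFor.prems(5) 0(3)[of y i] 0(4) by simp
    qed
    have "Suc (bcost ?b r) \<le> Suc (bcoef ?b) * B"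
      using bcost_le[OF Bv B, of ?b] B by simp
    also have "\<dots> \<le> K * B"
      using FFor.prems(4) by (intro mult_right_mono) auto
    finally have "Suc (bcost ?b r) \<le> K * B" .
    moreover have "\<not> bval ?b r"
      using 0(1) e by simp
    ultimately show ?case
      using exec.WhileFalse[of ?b r] 0(3) by force
  next
    case (Suc k r M')
    have e: "aval e r = n"
      unfolding n_def by (rule aval_cong) (use tc Suc in auto)
    have M': "M' + steps c L + 2 \<le> ?T" using Suc.prems(4) by simp
    have Bv: "\<forall>y i. bits (r y i) \<le> B"
    proof (intro allI)
      fix y i show "bits (r y i) \<le> B"
      using bits_mono[of "r y i" ?T] FFor.prems(5) Suc.prems(3)[of y i] Suc.prems(4) by simp
    qed
    have "Suc (bcost ?b r) \<le> Suc (bcoef ?b) * B"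
      using bcost_le[OF Bv B, of ?b] B by simp
    also have "\<dots> \<le> K * B"
      using FFor.prems(4) by (intro mult_right_mono) auto
    finally have cb: "Suc (bcost ?b r) \<le> K * B" .
    have bv: "bval ?b r"
      using Suc.prems(1) e by simp
    have lb: "aval e' r \<le> L" if "e' \<in> loop_bounds c" for e'
    proof -
      have "reads e' \<subseteq> {''in''}"
        using that tc(1) by (induction c) auto
      then have "aval e' r = aval e' s"
        using Suc.prems(2) by (intro aval_cong) auto
      then show ?thesis using FFor.prems(3) that by auto
    qed
    have "bits (M' + steps c L) \<le> B"
      using bits_mono[of "M' + steps c L" ?T] FFor.prems(5) M' by simp
    then obtain t where t: "exec (compile c) r t (run c r)" "t \<le> steps c L * (K * B)"
      "\<And>x i. run c r x i \<le> M' + steps c L"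
      using FFor.IH[of r M'] FFor.prems(4) tc Suc.prems(3) lb by auto
    have xr: "run c r x = r x" using run_frame tc by simp
    let ?P = "Put x (Const 0) (Plus (Get x (Const 0)) (Const 1))"
    have Bv': "\<forall>y i. bits (run c r y i) \<le> B"
    proof (intro allI)
      fix y i show "bits (run c r y i) \<le> B"
      using bits_mono[of "run c r y i" ?T] FFor.prems(5) t(3)[of y i] M' by simp
    qed
    obtain p where p: "exec ?P (run c r) p (?g r)" "p \<le> K * B"
    proof
      let ?p = "Suc (acost (Const 0) (run c r) + acost (Plus (Get x (Const 0)) (Const 1)) (run c r)
         + bits (aval (Const 0) (run c r)) + bits (aval (Plus (Get x (Const 0)) (Const 1)) (run c r)))"
      show "exec ?P (run c r) ?p (?g r)"
        using exec.Put[of x "Const 0" "Plus (Get x (Const 0)) (Const 1)" "run c r"] xr by (simp add: upd_def)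
      have "?p \<le> coef (FPut x (Const 0) (Plus (Get x (Const 0)) (Const 1))) * B"
        using acost_le[OF Bv' B, of "Plus (Get x (Const 0)) (Const 1)"]
          bits_aval_le[OF Bv' B, of "Plus (Get x (Const 0)) (Const 1)"] b1
        by (simp; use B in linarith)
      also have "\<dots> \<le> K * B"
        using FFor.prems(4) b1 by (intro mult_right_mono) auto
      finally show "?p \<le> K * B" .
    qed
    have gle: "?g r y i \<le> M' + (steps c L + 2)" for y i
      using t(3)[of y i] Suc.prems(3)[of x 0] by (cases "y = x") (auto simp: xr intro: trans_le_add1)
    obtain u where u: "exec ?W (?g r) u ((?g ^^ k) (?g r))"
      "u \<le> (k * (steps c L + 2) + 1) * (K * B)"
      "\<And>x i. (?g ^^ k) (?g r) x i \<le> M' + (steps c L + 2) + k * (steps c L + 2)"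
      using Suc.IH[of "?g r" "M' + (steps c L + 2)"] Suc.prems gle
        run_frame[of "''in''" c] tame_writes[OF tc(1)] tc(3) by (auto simp: add_ac)
    have "exec ?W r (Suc (bcost ?b r + (t + p) + u)) ((?g ^^ k) (?g r))"
      by (rule exec.WhileTrue[OF bv exec.Seq[OF t(1) p(1)] u(1)])
    moreover have "Suc (bcost ?b r + (t + p) + u)
        \<le> K * B + (steps c L * (K * B) + K * B) + (k * (steps c L + 2) + 1) * (K * B)"
      using cb t(2) p(2) u(2) by linarith
    then have "Suc (bcost ?b r + (t + p) + u) \<le> (Suc k * (steps c L + 2) + 1) * (K * B)"
      by (simp add: distrib_right)
    moreover have "(?g ^^ Suc k) r = (?g ^^ k) (?g r)"
      using funpow_swap1[of ?g k r] by simp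
    ultimately show ?case using u(3) by (auto simp: add_ac)
  qed
  let ?s = "upd s x 0 0"
  have kl: "n * (steps c L + 2) \<le> L * (steps c L + 2)" using nL by (rule mult_right_mono) simp
  have sM: "?s y i \<le> M" for y i using FFor.prems(2) by (cases "y = x") auto
  obtain t where t: "exec ?W ?s t ((?g ^^ n) ?s)" "t \<le> (n * (steps c L + 2) + 1) * (K * B)"
    "\<And>x i. (?g ^^ n) ?s x i \<le> M + n * (steps c L + 2)"
    using loop[of ?s n M] sM kl tc(3) by auto
  have "exec (Put x (Const 0) (Const 0)) s 5 ?s"
    using exec.Put[of x "Const 0" "Const 0" s] b1 by (simp add: numeral_eq_Suc upd_def)
  from exec.Seq[OF this t(1)]
  have "exec (compile (FFor x e c)) s (5 + t) (run (FFor x e c) s)"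
    by (simp add: n_def)
  moreover have "5 \<le> K * B"
    using FFor.prems(4) B mult_mono[of 5 K 1 B] by simp
  then have "5 + t \<le> K * B + (L * (steps c L + 2) + 1) * (K * B)"
    using t(2) mult_right_mono[OF kl, of "K * B"] by (simp add: distrib_right)
  then have "5 + t \<le> steps (FFor x e c) L * (K * B)"
    by (simp add: distrib_right)
  moreover have "run (FFor x e c) s y i \<le> ?T" for y i
    using t(3)[of y i] kl by (simp add: n_def)
  ultimately show ?case by blast
qed

text \<open>With at most \<open>n\<close> jobs and machines, \<open>2 * n + 1\<close> dominates all
  loop bounds of the scheduling program; the largest is the range of \<open>q\<close>. Each nesting
  level multiplies by the linear polynomial \<open>[:1, 2:]\<close>.\<close>

lemma steps_poly: "\<exists>P :: nat poly. \<forall>n. steps c (2 * n + 1) = poly P n"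
proof (induction c)
  case FSkip
  show ?case by (rule exI[of _ 1]) simp
next
  case (FPut x a b)
  show ?case by (rule exI[of _ 1]) simp
next
  case (FSeq c d)
  then obtain P Q :: "nat poly" where "\<forall>n. steps c (2 * n + 1) = poly P n" "\<forall>n. steps d (2 * n + 1) = poly Q n"
    by blast
  then show ?case by (intro exI[of _ "P + Q"]) simp
next
  case (FCond b c d)
  then obtain P Q :: "nat poly" where "\<forall>n. steps c (2 * n + 1) = poly P n" "\<forall>n. steps d (2 * n + 1) = poly Q n"
    by blast
  then show ?case by (intro exI[of _ "1 + P + Q"]) simp
next
  case (FFor x e c)
  then obtain P :: "nat poly" where "\<forall>n. steps c (2 * n + 1) = poly P n" by blast
  then show ?case
    by (intro exI[of _ "[:2:] + [:1, 2:] * (P + [:2:])"]) (simp add: algebra_simps)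
qed

text \<open>The step case supplies the value of the counter and the unchanged contents of all arrays
  that the loop does not write, so that invariants need not carry them.\<close>

lemma run_FFor_invariant:
  assumes "tame (FFor x e c)" "aval e s = n"
    and "I 0 (upd s x 0 0)"
    and "\<And>k r. k < n \<Longrightarrow> I k r \<Longrightarrow> r x 0 = k \<Longrightarrow>
          (\<And>y. y \<notin> writes (FFor x e c) \<Longrightarrow> r y = s y) \<Longrightarrow> I (Suc k) (upd (run c r) x 0 (Suc k))"
  shows "I n (run (FFor x e c) s)"
proof -
  let ?g = "\<lambda>r. upd (run c r) x 0 (Suc (r x 0))"
  have "I k ((?g ^^ k) (upd s x 0 0)) \<and> (?g ^^ k) (upd s x 0 0) x 0 = k
      \<and> (\<forall>y. y \<notin> writes (FFor x e c) \<longrightarrow> (?g ^^ k) (upd s x 0 0) y = s y)" if "k \<le> n" for k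
    using that
  proof (induction k)
    case 0
    then show ?case using assms(3) by simp
  next
    case (Suc k)
    then show ?case using assms(4)[of k "(?g ^^ k) (upd s x 0 0)"] run_frame[of _ c]
      by simp
  qed
  then show ?thesis using assms(2) by simp
qed

section \<open>The scheduling program\<close>

abbreviation "V x \<equiv> Get x (Const 0)"
abbreviation "eN \<equiv> Get ''in'' (Const 0)"
abbreviation "eM \<equiv> Get ''in'' (Const 1)"
text \<open>The addresses follow the layout of \<open>encode\<close>: two header cells, the square
  adjacency matrix, then alternating numerators and denominators.\<close>

abbreviation "eAdj u v \<equiv> Get ''in'' (Plus (Const 2) (Plus (Times u eN) v))"
abbreviation "eNum k \<equiv> Get ''in'' (Plus (Const 2) (Plus (Times eN eN) (Times (Const 2) k)))"
abbreviation "eDen k \<equiv> Get ''in'' (Plus (Const 3) (Plus (Times eN eN) (Times (Const 2) k)))"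

text \<open>
  Arrays, with scalars stored at index \<open>0\<close>: \<open>c\<close> component label, \<open>d\<close> colour and \<open>nz\<close>
  non-isolation flag of a job; \<open>x\<close>, \<open>y\<close>, \<open>z\<close> label to be replaced, its replacement, and whether
  colours are flipped; \<open>p\<close> number of non-isolated jobs of a colour; \<open>f\<close> class of a job, \<open>a\<close> size
  of a class; \<open>t\<close> trial schedule (the number of machines marks an unscheduled job), \<open>r\<close> number of
  unscheduled jobs of a class, \<open>l\<close> load and \<open>h\<close> class of the current machine; \<open>b\<close> whether a trial
  has succeeded, \<open>j\<close> and \<open>e\<close> the \<open>i\<close> and \<open>q\<close> of the best one.
\<close>

definition merge_prog :: fcom where
  "merge_prog = FFor ''w'' eN
     (FCond (Eq (Get ''c'' (V ''w'')) (V ''x''))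
        (FSeq (FPut ''c'' (V ''w'') (V ''y''))
              (FCond (Eq (V ''z'') (Const 1))
                 (FPut ''d'' (V ''w'') (Minus (Const 1) (Get ''d'' (V ''w''))))
                 FSkip))
        FSkip)"

text \<open>Union by relabelling, as in quick-find: the component of \<open>v\<close> takes the
  label of \<open>u\<close> and is recoloured exactly if the endpoints have the same colour. An edge
  inside a component needs no action, as the graph is bipartite.\<close>

definition edge_prog :: fcom where
  "edge_prog = FCond (Eq (eAdj (V ''u'') (V ''v'')) (Const 1))
     (FSeq (FPut ''nz'' (V ''u'') (Const 1))
       (FCond (Eq (Get ''c'' (V ''u'')) (Get ''c'' (V ''v''))) FSkip
         (FSeq (FPut ''x'' (Const 0) (Get ''c'' (V ''v'')))
         (FSeq (FPut ''y'' (Const 0) (Get ''c'' (V ''u'')))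
         (FSeq (FCond (Eq (Get ''d'' (V ''u'')) (Get ''d'' (V ''v'')))
                  (FPut ''z'' (Const 0) (Const 1)) (FPut ''z'' (Const 0) (Const 0)))
               merge_prog)))))
     FSkip"

definition colour_prog :: fcom where
  "colour_prog = FSeq (FFor ''v'' eN (FPut ''c'' (V ''v'') (V ''v'')))
     (FFor ''u'' eN (FFor ''v'' eN edge_prog))"

definition count_prog :: fcom where
  "count_prog = FFor ''v'' eN
     (FCond (Eq (Get ''nz'' (V ''v'')) (Const 1))
        (FPut ''p'' (Get ''d'' (V ''v'')) (Plus (Get ''p'' (Get ''d'' (V ''v''))) (Const 1))) FSkip)"

definition class_prog :: fcom where
  "class_prog = FSeq (FFor ''v'' eN
     (FCond (Eq (Get ''nz'' (V ''v'')) (Const 1))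
       (FCond (Less (Get ''p'' (Const 0)) (Get ''p'' (Const 1)))
          (FPut ''f'' (V ''v'') (Minus (Const 1) (Get ''d'' (V ''v''))))
          (FPut ''f'' (V ''v'') (Get ''d'' (V ''v''))))
       (FPut ''f'' (V ''v'') (Const 0))))
    (FFor ''v'' eN
       (FPut ''a'' (Get ''f'' (V ''v'')) (Plus (Get ''a'' (Get ''f'' (V ''v''))) (Const 1))))"

text \<open>One more job fits if (l + 1) / s_k \<le> q / s_i; multiplying out the denominators keeps
  the test within natural numbers.\<close>

definition place_prog :: fcom where
  "place_prog = FCond (Conj (Eq (Get ''t'' (V ''v'')) eM)
            (Conj (Eq (Get ''f'' (V ''v'')) (V ''h''))
                  (Neg (Less (Times (Times (eNum (V ''k'')) (V ''q'')) (eDen (V ''i'')))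
                             (Times (Plus (V ''l'') (Const 1))
                                    (Times (eDen (V ''k'')) (eNum (V ''i''))))))))
        (FSeq (FPut ''t'' (V ''v'') (V ''k''))
        (FSeq (FPut ''l'' (Const 0) (Plus (V ''l'') (Const 1)))
              (FPut ''r'' (V ''h'') (Minus (Get ''r'' (V ''h'')) (Const 1)))))
        FSkip"

definition machine_prog :: fcom where
  "machine_prog = FFor ''v'' eN place_prog"

text \<open>The class \<open>h\<close> is fixed before a machine is filled, so no machine receives
  both classes; capacity left on the machine that finishes the first class is wasted.\<close>

definition fill_prog :: fcom where
  "fill_prog = FSeq (FFor ''v'' eN (FPut ''t'' (V ''v'') eM))
    (FSeq (FPut ''r'' (Const 0) (Get ''a'' (Const 0)))
    (FSeq (FPut ''r'' (Const 1) (Get ''a'' (Const 1)))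
      (FFor ''k'' eM
        (FSeq (FPut ''l'' (Const 0) (Const 0))
        (FSeq (FCond (Eq (Get ''r'' (Const 0)) (Const 0))
                 (FPut ''h'' (Const 0) (Const 1)) (FPut ''h'' (Const 0) (Const 0)))
              machine_prog)))))"

definition copy_prog :: fcom where
  "copy_prog = FFor ''v'' eN (FPut ''out'' (V ''v'') (Get ''t'' (V ''v'')))"

text \<open>Before the first success \<open>j\<close> and \<open>e\<close> mean nothing, so
  \<open>b\<close> guards the comparison of q / s_i with e / s_j, which is again multiplied
  out.\<close>

definition update_prog :: fcom where
  "update_prog = FCond
     (Conj (Eq (Get ''r'' (Const 0)) (Const 0))
     (Conj (Eq (Get ''r'' (Const 1)) (Const 0))
           (Neg (Conj (Eq (V ''b'') (Const 1))
                      (Neg (Less (Times (V ''q'') (Times (eDen (V ''i'')) (eNum (V ''j''))))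
                                 (Times (V ''e'') (Times (eDen (V ''j'')) (eNum (V ''i''))))))))))
     (FSeq (FPut ''b'' (Const 0) (Const 1))
     (FSeq (FPut ''j'' (Const 0) (V ''i''))
     (FSeq (FPut ''e'' (Const 0) (V ''q''))
           copy_prog)))
     FSkip"

text \<open>\<open>q\<close> runs up to 2N because the optimum has the form c / s_i, with c \<le> N
  the load of a bottleneck machine.\<close>

definition search_prog :: fcom where
  "search_prog = FFor ''i'' eM (FFor ''q'' (Plus (Times (Const 2) eN) (Const 1))
     (FSeq fill_prog update_prog))"

definition schedule_prog :: fcom where
  "schedule_prog = FSeq colour_prog (FSeq count_prog (FSeq class_prog search_prog))"

lemmas prog_defs = merge_prog_def edge_prog_def colour_prog_def count_prog_def class_prog_def
  place_prog_def machine_prog_def fill_prog_def copy_prog_def update_prog_def search_prog_def schedule_prog_def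

lemma tame_schedule_prog: "tame schedule_prog"
  by (simp add: prog_defs)

lemma tame_subprogs:
  "tame merge_prog" "tame edge_prog" "tame machine_prog" "tame fill_prog" "tame copy_prog"
  "tame update_prog" "tame place_prog"
  by (simp_all add: prog_defs)

lemma writes_subprogs:
  "writes merge_prog = {''w'', ''c'', ''d''}"
  "writes edge_prog = {''nz'', ''x'', ''y'', ''z'', ''w'', ''c'', ''d''}"
  "writes place_prog = {''t'', ''l'', ''r''}"
  "writes machine_prog = {''v'', ''t'', ''l'', ''r''}"
  "writes fill_prog = {''v'', ''t'', ''r'', ''k'', ''l'', ''h''}"
  "writes copy_prog = {''v'', ''out''}"
  "writes update_prog = {''b'', ''j'', ''e'', ''v'', ''out''}"
  by (auto simp: prog_defs)

section \<open>Correctness of the two-colouring\<close>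

lemma merge_prog_spec:
  assumes "s ''in'' 0 = N"
  shows "\<forall>w. run merge_prog s ''c'' w =
           (if w < N \<and> s ''c'' w = s ''x'' 0 then s ''y'' 0 else s ''c'' w)
       \<and> run merge_prog s ''d'' w =
           (if w < N \<and> s ''c'' w = s ''x'' 0 \<and> s ''z'' 0 = 1 then 1 - s ''d'' w else s ''d'' w)"
  unfolding merge_prog_def
proof (rule run_FFor_invariant[where I = "\<lambda>k r. \<forall>w. r ''c'' w =
           (if w < k \<and> s ''c'' w = s ''x'' 0 then s ''y'' 0 else s ''c'' w)
       \<and> r ''d'' w =
           (if w < k \<and> s ''c'' w = s ''x'' 0 \<and> s ''z'' 0 = 1 then 1 - s ''d'' w else s ''d'' w)"],
    goal_cases)
  case (4 k r)
  have "r ''x'' = s ''x''" "r ''y'' = s ''y''" "r ''z'' = s ''z''"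
    by (auto intro!: 4(4))
  then show ?case using 4(2,3) by (auto simp: less_Suc_eq)
qed (use assms in auto)


definition edge_rel :: "(nat \<Rightarrow> nat) \<Rightarrow> nat \<Rightarrow> nat \<Rightarrow> bool" where
  "edge_rel inp u v \<longleftrightarrow> inp (2 + (u * inp 0 + v)) = 1"

text \<open>\<open>c\<close> labels the components of the part \<open>F\<close> of the graph that has been read, and within each
  of them the colouring \<open>d\<close> agrees up to a swap with some proper two-colouring \<open>g\<close> of the whole
  graph.\<close>

definition colour_inv :: "(nat \<Rightarrow> nat) \<Rightarrow> (nat \<Rightarrow> bool) \<Rightarrow> (nat \<times> nat) set \<Rightarrow> state \<Rightarrow> bool" where
  "colour_inv inp g F r \<longleftrightarrow>
     (\<forall>u<inp 0. \<forall>v<inp 0. (u, v) \<in> F \<longrightarrow> edge_rel inp u v \<longrightarrow> r ''c'' u = r ''c'' v) \<and>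
     (\<forall>u<inp 0. \<forall>v<inp 0. r ''c'' u = r ''c'' v \<longrightarrow> (r ''d'' u = r ''d'' v \<longleftrightarrow> g u = g v)) \<and>
     (\<forall>u<inp 0. r ''d'' u \<le> 1) \<and>
     (\<forall>u<inp 0. r ''nz'' u = (if \<exists>v<inp 0. (u, v) \<in> F \<and> edge_rel inp u v then 1 else 0))"

lemma colour_inv_upd [simp]:
  "''c'' \<noteq> x \<Longrightarrow> ''d'' \<noteq> x \<Longrightarrow> ''nz'' \<noteq> x \<Longrightarrow> colour_inv inp g F (upd r x i v) = colour_inv inp g F r"
  by (simp add: colour_inv_def)

text \<open>A parity count: u + b and v + a agree with \<open>g\<close> modulo 2, and the flip makes
  the colours at \<open>a\<close> and \<open>b\<close> differ, as \<open>ga\<close> and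
  \<open>gb\<close> do. Adding the three relations gives the claim. Here \<open>u\<close> lies in
  the component of \<open>b\<close> and \<open>v\<close> in that of \<open>a\<close>.\<close>

lemma merge_agree:
  fixes u v a b :: nat and gu gv ga gb :: bool
  assumes "u \<le> 1" "v \<le> 1" "a \<le> 1" "b \<le> 1"
    and "(u = b) = (gu = gb)" "(v = a) = (gv = ga)" "ga \<noteq> gb"
  shows "((if a = b then 1 - u else u) = v) = (gu = gv)"
proof -
  have "u = 0 \<or> u = 1" "v = 0 \<or> v = 1" "a = 0 \<or> a = 1" "b = 0 \<or> b = 1"
    using assms(1-4) by auto
  then show ?thesis
    using assms(5-7) by (elim disjE; simp; blast)
qed

lemma colour_inv_edge:
  assumes inv: "colour_inv inp g F r" and r: "r ''in'' = inp" "r ''u'' 0 = a" "r ''v'' 0 = b"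
    and ab: "a < inp 0" "b < inp 0" and g: "edge_rel inp a b \<Longrightarrow> g a \<noteq> g b"
  shows "colour_inv inp g (insert (a, b) F) (run edge_prog r)"
proof (cases "edge_rel inp a b")
  case False
  then have "run edge_prog r = r"
    using r by (simp add: edge_prog_def edge_rel_def)
  then show ?thesis using inv False by (auto simp: colour_inv_def)
next
  case True
  note R = this
  have gab: "g a \<noteq> g b" using g R by simp
  have same: "\<And>u v. u < inp 0 \<Longrightarrow> v < inp 0 \<Longrightarrow> (u, v) \<in> F \<Longrightarrow> edge_rel inp u v \<Longrightarrow>
        r ''c'' u = r ''c'' v"
    and agree: "\<And>u v. u < inp 0 \<Longrightarrow> v < inp 0 \<Longrightarrow> r ''c'' u = r ''c'' v \<Longrightarrow>
        (r ''d'' u = r ''d'' v) = (g u = g v)"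
    and le1: "\<And>u. u < inp 0 \<Longrightarrow> r ''d'' u \<le> 1"
    and nz: "\<And>u. u < inp 0 \<Longrightarrow>
        r ''nz'' u = (if \<exists>v<inp 0. (u, v) \<in> F \<and> edge_rel inp u v then 1 else 0)"
    using inv unfolding colour_inv_def by blast+
  have nz': "u < inp 0 \<Longrightarrow> (if u = a then 1 else r ''nz'' u) = (if \<exists>v<inp 0. (u, v) \<in> insert (a, b) F \<and> edge_rel inp u v then 1 else 0)" for u
    using nz[of u] R ab by auto
  show ?thesis
  proof (cases "r ''c'' a = r ''c'' b")
    case True
    have run: "run edge_prog r = upd r ''nz'' a 1"
      using r R True by (simp add: edge_prog_def edge_rel_def)
    show ?thesis
      unfolding run colour_inv_def
    proof (intro conjI allI impI)
      fix u assume "u < inp 0"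
      then show "upd r ''nz'' a 1 ''nz'' u =
          (if \<exists>v<inp 0. (u, v) \<in> insert (a, b) F \<and> edge_rel inp u v then 1 else 0)"
        by (simp only: upd_same nz')
    qed (use same agree le1 True in auto)
  next
    case False
    define s where "s = upd (upd (upd (upd r ''nz'' a 1) ''x'' 0 (r ''c'' b)) ''y'' 0 (r ''c'' a))
       ''z'' 0 (if r ''d'' a = r ''d'' b then 1 else 0)"
    have run: "run edge_prog r = run merge_prog s"
      using r R False by (simp add: edge_prog_def edge_rel_def s_def)
    have "s ''in'' 0 = inp 0" using r by (simp add: s_def)
    note spec = merge_prog_spec[of s, OF this]
    have c: "run merge_prog s ''c'' w = (if r ''c'' w = r ''c'' b then r ''c'' a else r ''c'' w)"
      if "w < inp 0" for w
      using spec that by (simp add: s_def)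
    have d: "run merge_prog s ''d'' w =
        (if r ''c'' w = r ''c'' b \<and> r ''d'' a = r ''d'' b then 1 - r ''d'' w else r ''d'' w)"
      if "w < inp 0" for w
      using spec that by (simp add: s_def)
    have n: "run merge_prog s ''nz'' u = (if u = a then 1 else r ''nz'' u)" for u
      using run_frame[of "''nz''" merge_prog s] by (simp add: writes_subprogs s_def)
    have flip: "(1 - x = 1 - y) = (x = y)" if "x \<le> 1" "y \<le> 1" for x y :: nat
      using that by arith
    have agree': "(run merge_prog s ''d'' u = run merge_prog s ''d'' v) = (g u = g v)"
      if uv: "u < inp 0" "v < inp 0" "run merge_prog s ''c'' u = run merge_prog s ''c'' v" for u v
    proof -
      \<comment> \<open>Equal labels after the merge mean: both jobs outside the relabelled
        component, both inside it, or one on each side of the new edge. Only the mixed cases use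
        that the edge separates the colours of \<open>g\<close>.\<close>
      consider (none) "r ''c'' u \<noteq> r ''c'' b" "r ''c'' v \<noteq> r ''c'' b" "r ''c'' u = r ''c'' v"
        | (both) "r ''c'' u = r ''c'' b" "r ''c'' v = r ''c'' b"
        | (left) "r ''c'' u = r ''c'' b" "r ''c'' v = r ''c'' a"
        | (right) "r ''c'' u = r ''c'' a" "r ''c'' v = r ''c'' b"
        using uv(3) c[OF uv(1)] c[OF uv(2)] by (auto split: if_splits)
      then show ?thesis
      proof cases
        case none
        then show ?thesis using agree uv by (simp add: d)
      next
        case both
        then show ?thesis using agree[of u v] uv flip[OF le1 le1] by (simp add: d)
      next
        case left
        then show ?thesis
          using merge_agree[OF le1[OF uv(1)] le1[OF uv(2)] le1[OF ab(1)] le1[OF ab(2)]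
              agree[OF uv(1) ab(2)] agree[OF uv(2) ab(1)] gab] False uv by (simp add: d)
      next
        case right
        then show ?thesis
          using merge_agree[OF le1[OF uv(2)] le1[OF uv(1)] le1[OF ab(1)] le1[OF ab(2)]
              agree[OF uv(2) ab(2)] agree[OF uv(1) ab(1)] gab] False uv d[OF uv(1)] d[OF uv(2)]
          by metis
      qed
    qed
    show ?thesis
      unfolding run colour_inv_def
    proof (intro conjI allI impI)
      fix u v assume "u < inp 0" "v < inp 0" "(u, v) \<in> insert (a, b) F" "edge_rel inp u v"
      then show "run merge_prog s ''c'' u = run merge_prog s ''c'' v"
        using same[of u v] c by auto
    next
      fix u assume "u < inp 0"
      then show "run merge_prog s ''d'' u \<le> 1"
        using le1[of u] d[of u] by auto
    next
      fix u assume "u < inp 0"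
      then show "run merge_prog s ''nz'' u =
          (if \<exists>v<inp 0. (u, v) \<in> insert (a, b) F \<and> edge_rel inp u v then 1 else 0)"
        by (simp only: n nz')
    qed (use agree' in blast)
  qed
qed

lemma colour_prog_spec:
  assumes s: "s ''in'' = inp" "\<And>u. s ''d'' u = 0" "\<And>u. s ''nz'' u = 0"
    and g: "\<And>u v. u < inp 0 \<Longrightarrow> v < inp 0 \<Longrightarrow> edge_rel inp u v \<Longrightarrow> g u \<noteq> g v"
  shows "colour_inv inp g UNIV (run colour_prog s)"
proof -
  let ?init = "FFor ''v'' eN (FPut ''c'' (V ''v'') (V ''v''))"
  define s1 where "s1 = run ?init s"
  have c: "\<forall>u<inp 0. s1 ''c'' u = u"
    unfolding s1_def
    by (rule run_FFor_invariant[where I = "\<lambda>k r. \<forall>u<k. r ''c'' u = u"])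
      (use s in \<open>auto simp: less_Suc_eq\<close>)
  have s1: "s1 ''in'' = inp" "s1 ''d'' = s ''d''" "s1 ''nz'' = s ''nz''"
    unfolding s1_def using s run_frame[of _ ?init s] by simp_all
  have "colour_inv inp g {(x, y). x < inp 0} (run (FFor ''u'' eN (FFor ''v'' eN edge_prog)) s1)"
  proof (rule run_FFor_invariant[where I = "\<lambda>k r. colour_inv inp g {(x, y). x < k} r"], goal_cases)
    case 3
    then show ?case using c s s1 by (auto simp: colour_inv_def)
  next
    case (4 k r)
    note outer = this
    have r: "r ''in'' = inp" using 4(4)[of "''in''"] s1 by (simp add: writes_subprogs)
    have "colour_inv inp g {(x, y). x < k \<or> x = k \<and> y < inp 0} (run (FFor ''v'' eN edge_prog) r)"
    proof (rule run_FFor_invariant[where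
          I = "\<lambda>j r. colour_inv inp g {(x, y). x < k \<or> x = k \<and> y < j} r"], goal_cases)
      case 3
      then show ?case using outer by simp
    next
      case (4 j q)
      have q: "q ''in'' = inp" "q ''u'' 0 = k"
        using 4(4)[of "''in''"] 4(4)[of "''u''"] r outer(3) by (simp_all add: writes_subprogs)
      have "{(x, y). x < k \<or> x = k \<and> y < Suc j} = insert (k, j) {(x, y). x < k \<or> x = k \<and> y < j}"
        by auto
      moreover have "colour_inv inp g (insert (k, j) {(x, y). x < k \<or> x = k \<and> y < j}) (run edge_prog q)"
        using 4 q outer(1) g by (intro colour_inv_edge) auto
      ultimately show ?case by simp
    qed (use r in \<open>auto simp: tame_subprogs writes_subprogs\<close>)
    \<comment> \<open>The invariant looks only at columns below \<open>inp 0\<close>, so a row read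
      up to there counts as a full row.\<close>
    moreover have "{(x, y). x < k \<or> x = k \<and> y < inp 0} \<inter> {(x, y). y < inp 0}
       = {(x, y). x < Suc k} \<inter> {(x, y). y < inp 0}"
      by auto
    ultimately show ?case
      by (auto simp: colour_inv_def less_Suc_eq)
  qed (use s1 in \<open>auto simp: tame_subprogs writes_subprogs\<close>)
  then show ?thesis
    unfolding colour_prog_def using s1_def by (auto simp: colour_inv_def)
qed

section \<open>The two job classes and their sizes\<close>

lemma count_prog_spec:
  assumes s: "s ''in'' 0 = N" "\<And>i. s ''p'' i = 0"
  shows "\<forall>i. run count_prog s ''p'' i = card {v. v < N \<and> s ''nz'' v = 1 \<and> s ''d'' v = i}"
  unfolding count_prog_def
proof (rule run_FFor_invariant[where
      I = "\<lambda>k r. \<forall>i. r ''p'' i = card {v. v < k \<and> s ''nz'' v = 1 \<and> s ''d'' v = i}"], goal_cases)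
  case (4 k r)
  have fr: "r ''nz'' = s ''nz''" "r ''d'' = s ''d''"
    by (auto intro!: 4(4))
  have "{v. v < Suc k \<and> s ''nz'' v = 1 \<and> s ''d'' v = i} =
      (if s ''nz'' k = 1 \<and> s ''d'' k = i then insert k else id)
        {v. v < k \<and> s ''nz'' v = 1 \<and> s ''d'' v = i}" for i
    by (auto simp: less_Suc_eq)
  then show ?case using 4(2,3) fr by auto
qed (use s in auto)

text \<open>\<open>nz\<close> is set only for the row index of a matrix entry, so the symmetry of
  the matrix is what flags both ends of an edge. Swapping when \<open>p\<close> is smaller at 0
  makes the rarer colour class 1.\<close>

lemma class_prog_spec:
  assumes inv: "colour_inv inp g UNIV s" and s: "s ''in'' = inp" "\<And>i. s ''a'' i = 0"
    "\<And>i. s ''p'' i = card {v. v < inp 0 \<and> s ''nz'' v = 1 \<and> s ''d'' v = i}"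
    and g: "\<And>u v. u < inp 0 \<Longrightarrow> v < inp 0 \<Longrightarrow> edge_rel inp u v \<Longrightarrow> g u \<noteq> g v"
    and sym: "\<And>u v. u < inp 0 \<Longrightarrow> v < inp 0 \<Longrightarrow> edge_rel inp u v \<Longrightarrow> edge_rel inp v u"
  defines "f \<equiv> run class_prog s ''f''"
  shows "\<forall>i. run class_prog s ''a'' i = card {v. v < inp 0 \<and> f v = i}"
    and "\<And>v. v < inp 0 \<Longrightarrow> f v \<le> 1"
    and "\<And>u v. u < inp 0 \<Longrightarrow> v < inp 0 \<Longrightarrow> edge_rel inp u v \<Longrightarrow> f u \<noteq> f v"
    and "2 * card {v. v < inp 0 \<and> f v = 1} \<le> card {v. v < inp 0 \<and> (\<exists>u<inp 0. edge_rel inp v u)}"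
proof -
  let ?l = "FFor ''v'' eN
     (FCond (Eq (Get ''nz'' (V ''v'')) (Const 1))
       (FCond (Less (Get ''p'' (Const 0)) (Get ''p'' (Const 1)))
          (FPut ''f'' (V ''v'') (Minus (Const 1) (Get ''d'' (V ''v''))))
          (FPut ''f'' (V ''v'') (Get ''d'' (V ''v''))))
       (FPut ''f'' (V ''v'') (Const 0)))"
  let ?m = "FFor ''v'' eN
       (FPut ''a'' (Get ''f'' (V ''v'')) (Plus (Get ''a'' (Get ''f'' (V ''v''))) (Const 1)))"
  define sw where "sw \<longleftrightarrow> s ''p'' 0 < s ''p'' 1"
  define s1 where "s1 = run ?l s"
  have f1: "\<forall>v<inp 0. s1 ''f'' v = (if s ''nz'' v = 1 then if sw then 1 - s ''d'' v else s ''d'' v else 0)"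
    unfolding s1_def
  proof (rule run_FFor_invariant[where I = "\<lambda>k r. \<forall>v<k. r ''f'' v =
      (if s ''nz'' v = 1 then if sw then 1 - s ''d'' v else s ''d'' v else 0)"], goal_cases)
    case (4 k r)
    have "r ''nz'' = s ''nz''" "r ''d'' = s ''d''" "r ''p'' = s ''p''"
      by (auto intro!: 4(4))
    then show ?case using 4(2,3) by (auto simp: less_Suc_eq sw_def)
  qed (use s in auto)
  have s1: "s1 ''in'' = inp" "s1 ''a'' = s ''a''"
    unfolding s1_def using s run_frame[of _ ?l s] by simp_all
  have run: "run class_prog s = run ?m s1"
    by (simp add: class_prog_def s1_def)
  have f: "f = s1 ''f''"
    unfolding f_def run using run_frame[of "''f''" ?m s1] by simp
  show "\<forall>i. run class_prog s ''a'' i = card {v. v < inp 0 \<and> f v = i}"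
    unfolding run f
  proof (rule run_FFor_invariant[where I = "\<lambda>k r. \<forall>i. r ''a'' i = card {v. v < k \<and> s1 ''f'' v = i}"],
      goal_cases)
    case (4 k r)
    have "r ''f'' = s1 ''f''"
      by (auto intro!: 4(4))
    moreover have "{v. v < Suc k \<and> s1 ''f'' v = i} =
      (if s1 ''f'' k = i then insert k else id) {v. v < k \<and> s1 ''f'' v = i}" for i
      by (auto simp: less_Suc_eq)
    ultimately show ?case using 4(2,3) by auto
  qed (use s s1 in auto)
  note inv' = inv[unfolded colour_inv_def, simplified]
  have same: "s ''c'' u = s ''c'' v" if "u < inp 0" "v < inp 0" "edge_rel inp u v" for u v
    using inv' that by blast
  have agree: "(s ''d'' u = s ''d'' v) = (g u = g v)"
    if "u < inp 0" "v < inp 0" "s ''c'' u = s ''c'' v" for u v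
    using inv' that by blast
  have le1: "s ''d'' u \<le> 1" if "u < inp 0" for u
    using inv' that by simp
  have nz: "s ''nz'' u = (if \<exists>v<inp 0. edge_rel inp u v then 1 else 0)" if "u < inp 0" for u
    using inv' that by auto
  show "f v \<le> 1" if "v < inp 0" for v
    using f1 le1[OF that] that by (auto simp: f)
  show "f u \<noteq> f v" if uv: "u < inp 0" "v < inp 0" "edge_rel inp u v" for u v
  proof -
    have "s ''nz'' u = 1" "s ''nz'' v = 1"
      using nz uv sym by auto
    moreover have "s ''d'' u \<noteq> s ''d'' v"
      using agree same g uv by blast
    ultimately show ?thesis
      using f1 uv le1[OF uv(1)] le1[OF uv(2)] unfolding f by auto
  qed
  define P where "P = (\<lambda>i. {v. v < inp 0 \<and> s ''nz'' v = 1 \<and> s ''d'' v = i})"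
  have "{v. v < inp 0 \<and> f v = 1} = (if sw then P 0 else P 1)"
  proof -
    have "f v = 1 \<longleftrightarrow> v \<in> (if sw then P 0 else P 1)" if "v < inp 0" for v
      using f1 le1[OF that] that by (auto simp: f P_def le_Suc_eq)
    moreover have "(if sw then P 0 else P 1) \<subseteq> {..<inp 0}" by (auto simp: P_def)
    ultimately show ?thesis by blast
  qed
  then have "2 * card {v. v < inp 0 \<and> f v = 1} \<le> card (P 0) + card (P 1)"
    using s(3) by (auto simp: P_def sw_def)
  also have "\<dots> = card (P 0 \<union> P 1)"
    by (subst card_Un_disjoint) (auto simp: P_def)
  also have "P 0 \<union> P 1 = {v. v < inp 0 \<and> (\<exists>u<inp 0. edge_rel inp v u)}"
  proof -
    have "v \<in> P 0 \<union> P 1 \<longleftrightarrow> s ''nz'' v = 1" if "v < inp 0" for v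
      using le1[OF that] that by (auto simp: P_def le_Suc_eq)
    moreover have "P 0 \<union> P 1 \<subseteq> {..<inp 0}" by (auto simp: P_def)
    moreover have "s ''nz'' v = 1 \<longleftrightarrow> (\<exists>u<inp 0. edge_rel inp v u)" if "v < inp 0" for v
      using nz[OF that] by auto
    ultimately show ?thesis by blast
  qed
  finally show "2 * card {v. v < inp 0 \<and> f v = 1} \<le> card {v. v < inp 0 \<and> (\<exists>u<inp 0. edge_rel inp v u)}" .
qed

section \<open>Greedy filling of the machines\<close>

definition num :: "(nat \<Rightarrow> nat) \<Rightarrow> nat \<Rightarrow> nat" where
  "num inp k = inp (2 + (inp 0 * inp 0 + 2 * k))"

definition den :: "(nat \<Rightarrow> nat) \<Rightarrow> nat \<Rightarrow> nat" where
  "den inp k = inp (3 + (inp 0 * inp 0 + 2 * k))"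

text \<open>The number of unit jobs that machine \<open>k\<close> can process within time \<open>q / s\<^sub>i\<close>.\<close>

definition cap :: "(nat \<Rightarrow> nat) \<Rightarrow> nat \<Rightarrow> nat \<Rightarrow> nat \<Rightarrow> nat" where
  "cap inp i q k = num inp k * q * den inp i div (den inp k * num inp i)"

text \<open>The numbers of jobs of the two classes that are left when the first \<open>k\<close> machines are full.\<close>

fun left_over :: "(nat \<Rightarrow> nat) \<Rightarrow> nat \<times> nat \<Rightarrow> nat \<Rightarrow> nat \<times> nat" where
  "left_over C ab 0 = ab"
| "left_over C ab (Suc k) =
     (let (x, y) = left_over C ab k in if x = 0 then (0, y - C k) else (x - C k, y))"

text \<open>Which jobs of \<open>U\<close> are taken does not matter afterwards, only their number
  and their class; hence the existential \<open>T\<close>.\<close>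

lemma machine_prog_spec:
  fixes inp :: "nat \<Rightarrow> nat" and s :: state
  defines "N \<equiv> inp 0" and "k \<equiv> s ''k'' 0" and "h \<equiv> s ''h'' 0"
    and "U \<equiv> {w. w < inp 0 \<and> s ''t'' w = inp 1 \<and> s ''f'' w = s ''h'' 0}"
    and "C \<equiv> cap inp (s ''i'' 0) (s ''q'' 0) (s ''k'' 0)"
  assumes s: "s ''in'' = inp" "s ''l'' 0 = 0" "s ''r'' h = card U"
    and pos: "0 < den inp k" "0 < num inp (s ''i'' 0)"
    and k: "k < inp 1" "\<And>w. w < N \<Longrightarrow> s ''t'' w \<noteq> k"
  shows "\<exists>T \<subseteq> U. card T = min (card U) C
     \<and> (\<forall>w. run machine_prog s ''t'' w = (if w \<in> T then k else s ''t'' w))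
     \<and> (\<forall>j. run machine_prog s ''r'' j = (if j = h then card U - card T else s ''r'' j))"
proof -
  define U' where "U' = (\<lambda>v. {w \<in> U. w < v})"
  have finU: "finite U" unfolding U_def by simp
  have "\<exists>T \<subseteq> U' N. card T = min (card (U' N)) C \<and> run machine_prog s ''l'' 0 = card T
     \<and> (\<forall>w. run machine_prog s ''t'' w = (if w \<in> T then k else s ''t'' w))
     \<and> (\<forall>j. run machine_prog s ''r'' j = (if j = h then card U - card T else s ''r'' j))"
    unfolding machine_prog_def
  proof (rule run_FFor_invariant[where I = "\<lambda>v r. \<exists>T \<subseteq> U' v. card T = min (card (U' v)) C \<and>
      r ''l'' 0 = card T \<and> (\<forall>w. r ''t'' w = (if w \<in> T then k else s ''t'' w))
     \<and> (\<forall>j. r ''r'' j = (if j = h then card U - card T else s ''r'' j))"], goal_cases)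
    case 3
    then show ?case using s by (auto simp: U'_def)
  next
    case (4 v r)
    then obtain T where T: "T \<subseteq> U' v" "card T = min (card (U' v)) C" "r ''l'' 0 = card T"
      "\<forall>w. r ''t'' w = (if w \<in> T then k else s ''t'' w)"
      "\<forall>j. r ''r'' j = (if j = h then card U - card T else s ''r'' j)"
      by blast
    have fr: "r ''in'' = inp" "r ''k'' = s ''k''" "r ''h'' = s ''h''" "r ''i'' = s ''i''"
      "r ''q'' = s ''q''" "r ''f'' = s ''f''"
      using 4(4)[of "''in''"] s 4(4)[of "''k''"] 4(4)[of "''h''"] 4(4)[of "''i''"] 4(4)[of "''q''"]
        4(4)[of "''f''"] by (simp_all add: writes_subprogs)
    have vT: "v \<notin> T" using T(1) by (auto simp: U'_def)
    have finT: "finite T" using T(1) finU by (auto simp: U'_def intro: finite_subset)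
    have capl: "(\<not> num inp k * s ''q'' 0 * den inp (s ''i'' 0) < Suc (card T) * (den inp k * num inp (s ''i'' 0)))
        \<longleftrightarrow> card T < C"
    proof -
      have "card T < C \<longleftrightarrow> Suc (card T) \<le> C" by auto
      also have "\<dots> \<longleftrightarrow> Suc (card T) * (den inp k * num inp (s ''i'' 0))
          \<le> num inp k * s ''q'' 0 * den inp (s ''i'' 0)"
        unfolding C_def cap_def k_def[symmetric] using pos
        by (intro less_eq_div_iff_mult_less_eq) simp
      finally show ?thesis by (simp only: not_less)
    qed
    have tv: "r ''t'' v = s ''t'' v" using T(4) vT by simp
    have rh: "r ''r'' h = card U - card T" using T(5) by simp
    have run: "run place_prog r = (if v \<in> U \<and> card T < C then
        upd (upd (upd r ''t'' v k) ''l'' 0 (Suc (card T))) ''r'' h (card U - card T - 1) else r)"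
      unfolding capl[symmetric] using 4(1)
      by (simp add: place_prog_def U_def num_def den_def fr 4(3) T(3) tv k_def h_def N_def rh[unfolded h_def]
          del: mult_Suc)
    show ?case
    proof (cases "v \<in> U \<and> card T < C")
      case True
      have "U' (Suc v) = insert v (U' v)" using True by (auto simp: U'_def less_Suc_eq)
      moreover have "v \<notin> U' v" "finite (U' v)" using finU by (auto simp: U'_def)
      ultimately have "insert v T \<subseteq> U' (Suc v)" "card (insert v T) = min (card (U' (Suc v))) C"
        using T(1,2) True vT finT by auto
      moreover have cT: "card (insert v T) = Suc (card T)" using vT finT by simp
      moreover have r': "run place_prog r = upd (upd (upd r ''t'' v k) ''l'' 0 (Suc (card T)))
          ''r'' h (card U - card T - 1)"
        unfolding run using True by (rule if_P)
      have "upd (run place_prog r) ''v'' 0 (Suc v) ''l'' 0 = card (insert v T)"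
        unfolding r' cT by simp
      moreover have "\<forall>w. upd (run place_prog r) ''v'' 0 (Suc v) ''t'' w
          = (if w \<in> insert v T then k else s ''t'' w)"
        unfolding r' using T(4) by simp
      moreover have "\<forall>j. upd (run place_prog r) ''v'' 0 (Suc v) ''r'' j
          = (if j = h then card U - card (insert v T) else s ''r'' j)"
        unfolding r' cT using T(5) by simp
      ultimately show ?thesis by blast
    next
      case False
      have "U' (Suc v) = (if v \<in> U then insert v (U' v) else U' v)"
        by (auto simp: U'_def less_Suc_eq)
      moreover have "v \<notin> U' v" "finite (U' v)" using finU by (auto simp: U'_def)
      ultimately have "T \<subseteq> U' (Suc v)" "card T = min (card (U' (Suc v))) C"
        using T(1,2) False by auto
      moreover have r': "run place_prog r = r"
        unfolding run using False by (rule if_not_P)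
      moreover have "upd r ''v'' 0 (Suc v) ''l'' 0 = card T"
        "\<forall>w. upd r ''v'' 0 (Suc v) ''t'' w = (if w \<in> T then k else s ''t'' w)"
        "\<forall>j. upd r ''v'' 0 (Suc v) ''r'' j = (if j = h then card U - card T else s ''r'' j)"
        using T(3-5) by simp_all
      ultimately show ?thesis unfolding r' by blast
    qed
  qed (use s in \<open>simp_all add: N_def tame_subprogs writes_subprogs\<close>)
  moreover have "U' N = U" unfolding U'_def U_def N_def by auto
  ultimately show ?thesis by metis
qed

text \<open>This yields feasibility because jobs on one machine share a class while every edge joins
  different classes, and a makespan of at most q / s_i because of the capacities.\<close>

definition fits :: "(nat \<Rightarrow> nat) \<Rightarrow> (nat \<Rightarrow> nat) \<Rightarrow> nat \<Rightarrow> nat \<Rightarrow> (nat \<Rightarrow> nat) \<Rightarrow> bool" where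
  "fits inp f i q t \<longleftrightarrow> (\<forall>v<inp 0. t v < inp 1) \<and>
     (\<forall>v<inp 0. \<forall>w<inp 0. t v = t w \<longrightarrow> f v = f w) \<and>
     (\<forall>k<inp 1. card {v. v < inp 0 \<and> t v = k} \<le> cap inp i q k)"

lemma fill_prog_spec:
  fixes inp :: "nat \<Rightarrow> nat" and s :: state
  defines "N \<equiv> inp 0" and "M \<equiv> inp 1" and "f \<equiv> s ''f''" and "a \<equiv> s ''a''"
    and "C \<equiv> cap inp (s ''i'' 0) (s ''q'' 0)"
  assumes s: "s ''in'' = inp" and f: "\<And>v. v < N \<Longrightarrow> f v \<le> 1"
    and a: "\<And>j. a j = card {v. v < N \<and> f v = j}"
    and pos: "\<And>k. k < M \<Longrightarrow> 0 < den inp k" "0 < num inp (s ''i'' 0)"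
  shows "(run fill_prog s ''r'' 0, run fill_prog s ''r'' 1) = left_over C (a 0, a 1) M"
    and "run fill_prog s ''r'' 0 = 0 \<Longrightarrow> run fill_prog s ''r'' 1 = 0 \<Longrightarrow>
           fits inp f (s ''i'' 0) (s ''q'' 0) (run fill_prog s ''t'')"
proof -
  \<comment> \<open>Equal entries force equal classes only below \<open>M\<close>, since the
    unscheduled jobs of both classes carry the mark \<open>M\<close>.\<close>
  define Inv where "Inv = (\<lambda>k r. (r ''r'' 0, r ''r'' 1) = left_over C (a 0, a 1) k
      \<and> (\<forall>j\<le>1. r ''r'' j = card {v. v < N \<and> r ''t'' v = M \<and> f v = j})
      \<and> (\<forall>v<N. r ''t'' v = M \<or> r ''t'' v < k)
      \<and> (\<forall>v<N. \<forall>w<N. r ''t'' v = r ''t'' w \<longrightarrow> r ''t'' v < M \<longrightarrow> f v = f w)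
      \<and> (\<forall>j<k. card {v. v < N \<and> r ''t'' v = j} \<le> C j))"
  let ?init = "FFor ''v'' eN (FPut ''t'' (V ''v'') eM)"
  let ?body = "FSeq (FPut ''l'' (Const 0) (Const 0))
        (FSeq (FCond (Eq (Get ''r'' (Const 0)) (Const 0))
                 (FPut ''h'' (Const 0) (Const 1)) (FPut ''h'' (Const 0) (Const 0)))
              machine_prog)"
  define s1 where "s1 = run ?init s"
  have t1: "\<forall>v<N. s1 ''t'' v = M"
    unfolding s1_def
    by (rule run_FFor_invariant[where I = "\<lambda>k r. \<forall>v<k. r ''t'' v = M"])
      (use s in \<open>auto simp: less_Suc_eq N_def M_def\<close>)
  have fr1: "y \<notin> {''v'', ''t''} \<Longrightarrow> s1 y = s y" for y
    unfolding s1_def using run_frame[of y ?init s] by auto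
  define s2 where "s2 = upd (upd s1 ''r'' 0 (a 0)) ''r'' 1 (a 1)"
  have s2: "s2 ''t'' = s1 ''t''" "s2 ''r'' 0 = a 0" "s2 ''r'' 1 = a 1" "s2 ''in'' = inp"
    "s2 ''f'' = f" "s2 ''i'' = s ''i''" "s2 ''q'' = s ''q''"
    using s fr1 by (simp_all add: s2_def f_def)
  have run: "run fill_prog s = run (FFor ''k'' eM ?body) s2"
    unfolding s2_def s1_def a_def using fr1[of "''a''"]
    by (simp add: fill_prog_def s1_def)
  have tame: "tame (FFor ''k'' eM ?body)"
    using tame_subprogs writes_subprogs by simp
  have "Inv M (run (FFor ''k'' eM ?body) s2)"
  proof (rule run_FFor_invariant[where I = Inv, OF tame], goal_cases)
    case 1
    then show ?case using s2 by (simp add: M_def)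
  next
    case 2
    have "{v. v < N \<and> s1 ''t'' v = M \<and> f v = j} = {v. v < N \<and> f v = j}" for j
      using t1 by auto
    moreover have "j \<le> 1 \<Longrightarrow> s2 ''r'' j = a j" for j
      using s2(2,3) by (cases j) auto
    ultimately show ?case
      unfolding Inv_def using t1 s2 a f by auto
  next
    case (3 k r)
    have kM: "k < M" using 3(1) .
    note frame = 3(4)[simplified writes.simps writes_subprogs]
    have fr: "r ''in'' = inp" "r ''f'' = f" "r ''i'' = s ''i''" "r ''q'' = s ''q''"
      using frame s2 by auto
    define x where "x = r ''r'' 0"
    define y where "y = r ''r'' 1"
    have Inv: "(x, y) = left_over C (a 0, a 1) k"
      "\<And>j. j \<le> 1 \<Longrightarrow> r ''r'' j = card {v. v < N \<and> r ''t'' v = M \<and> f v = j}"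
      "\<And>v. v < N \<Longrightarrow> r ''t'' v = M \<or> r ''t'' v < k"
      "\<And>v w. v < N \<Longrightarrow> w < N \<Longrightarrow> r ''t'' v = r ''t'' w \<Longrightarrow> r ''t'' v < M \<Longrightarrow> f v = f w"
      "\<And>j. j < k \<Longrightarrow> card {v. v < N \<and> r ''t'' v = j} \<le> C j"
      using 3(2) unfolding Inv_def x_def y_def by blast+
    define h where "h = (if x = 0 then 1 else 0 :: nat)"
    have h1: "h \<le> 1" by (simp add: h_def)
    define r2 where "r2 = upd (upd r ''l'' 0 0) ''h'' 0 h"
    have run': "run ?body r = run machine_prog r2"
      by (simp add: r2_def h_def x_def)
    have r2: "r2 ''in'' = inp" "r2 ''l'' 0 = 0" "r2 ''t'' = r ''t''" "r2 ''f'' = f" "r2 ''h'' 0 = h"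
      "r2 ''i'' = s ''i''" "r2 ''q'' = s ''q''" "r2 ''k'' 0 = k" "r2 ''r'' = r ''r''"
      using fr 3(3) by (simp_all add: r2_def)
    define U where "U = {w. w < N \<and> r ''t'' w = M \<and> f w = h}"
    have rU: "r ''r'' h = card U" using Inv(2)[OF h1] by (simp add: U_def)
    have "\<exists>T \<subseteq> U. card T = min (card U) (C k)
     \<and> (\<forall>w. run machine_prog r2 ''t'' w = (if w \<in> T then k else r ''t'' w))
     \<and> (\<forall>j. run machine_prog r2 ''r'' j = (if j = h then card U - card T else r ''r'' j))"
    proof (rule machine_prog_spec[of r2 inp, unfolded r2, folded N_def M_def, folded U_def C_def])
      show "r ''t'' w \<noteq> k" if "w < N" for w
        using Inv(3)[OF that] kM by auto
    qed (use rU pos kM in simp_all)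
    then obtain T where T: "T \<subseteq> U" "card T = min (card U) (C k)"
      "\<And>w. run machine_prog r2 ''t'' w = (if w \<in> T then k else r ''t'' w)"
      "\<And>j. run machine_prog r2 ''r'' j = (if j = h then card U - card T else r ''r'' j)"
      by blast
    have finU: "finite U" by (simp add: U_def)
    then have finT: "finite T" using T(1) by (rule rev_finite_subset)
    define r' where "r' = upd (run ?body r) ''k'' 0 (Suc k)"
    have t': "r' ''t'' w = (if w \<in> T then k else r ''t'' w)" for w
      unfolding r'_def run' using T(3) by simp
    have rr': "r' ''r'' j = (if j = h then card U - C k else r ''r'' j)" for j
      unfolding r'_def run' using T(2,4) by (simp add: min_def)
    have TM: "w \<in> T \<Longrightarrow> w < N \<and> r ''t'' w = M \<and> f w = h" for w
      using T(1) by (auto simp: U_def)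
    have "Inv (Suc k) r'"
      unfolding Inv_def
    proof (intro conjI allI impI)
      show "(r' ''r'' 0, r' ''r'' 1) = left_over C (a 0, a 1) (Suc k)"
      proof (cases "x = 0")
        case True
        then have "h = 1" by (simp add: h_def)
        then show ?thesis using True Inv(1)[symmetric] rr' rU by (simp add: x_def y_def)
      next
        case False
        then have "h = 0" by (simp add: h_def)
        then show ?thesis using False Inv(1)[symmetric] rr' rU by (simp add: x_def y_def)
      qed
    next
      fix j :: nat assume j: "j \<le> 1"
      have e: "{v. v < N \<and> r' ''t'' v = M \<and> f v = j} =
        {v. v < N \<and> r ''t'' v = M \<and> f v = j} - (if j = h then T else {})"
        using t' kM TM by auto
      show "r' ''r'' j = card {v. v < N \<and> r' ''t'' v = M \<and> f v = j}"
      proof (cases "j = h")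
        case True
        have "card (U - T) = card U - card T"
          using T(1) finT by (rule card_Diff_subset[rotated])
        then show ?thesis using True e rr' T(2) by (simp add: U_def min_def)
      next
        case False
        then show ?thesis using e rr' Inv(2)[OF j] by simp
      qed
    next
      fix v assume "v < N"
      then show "r' ''t'' v = M \<or> r' ''t'' v < Suc k"
        using Inv(3)[of v] t' by auto
    next
      fix v w assume "v < N" "w < N" "r' ''t'' v = r' ''t'' w" "r' ''t'' v < M"
      then show "f v = f w"
        using Inv(3)[of v] Inv(3)[of w] Inv(4)[of v w] t'[of v] t'[of w] TM[of v] TM[of w]
        by (auto split: if_splits)
    next
      fix j assume j: "j < Suc k"
      show "card {v. v < N \<and> r' ''t'' v = j} \<le> C j"
      proof (cases "j = k")
        case True
        have "{v. v < N \<and> r' ''t'' v = k} = T"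
          using t' TM Inv(3) kM by force
        then show ?thesis using T(2) True by simp
      next
        case False
        then have "{v. v < N \<and> r' ''t'' v = j} = {v. v < N \<and> r ''t'' v = j}"
          using t' TM j kM by auto
        then show ?thesis using Inv(5)[of j] j False by simp
      qed
    qed
    then show ?case unfolding r'_def .
  qed
  then have fin: "Inv M (run fill_prog s)" unfolding run .
  then show "(run fill_prog s ''r'' 0, run fill_prog s ''r'' 1) = left_over C (a 0, a 1) M"
    unfolding Inv_def by blast
  assume r0: "run fill_prog s ''r'' 0 = 0" "run fill_prog s ''r'' 1 = 0"
  have "run fill_prog s ''t'' v < M" if v: "v < N" for v
  proof (rule ccontr)
    assume "\<not> run fill_prog s ''t'' v < M"
    then have tv: "run fill_prog s ''t'' v = M"
      using fin v unfolding Inv_def by blast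
    have "run fill_prog s ''r'' (f v) = 0"
      using r0 f[OF v] by (cases "f v") auto
    then have "card {w. w < N \<and> run fill_prog s ''t'' w = M \<and> f w = f v} = 0"
      using fin f[OF v] unfolding Inv_def by metis
    then have "{w. w < N \<and> run fill_prog s ''t'' w = M \<and> f w = f v} = {}"
      by simp
    then show False using v tv by blast
  qed
  then show "fits inp f (s ''i'' 0) (s ''q'' 0) (run fill_prog s ''t'')"
    using fin unfolding Inv_def fits_def N_def M_def C_def by blast
qed

section \<open>The search over trial makespans\<close>

definition ratio :: "(nat \<Rightarrow> nat) \<Rightarrow> nat \<Rightarrow> nat \<Rightarrow> rat" where
  "ratio inp i q = of_nat q * of_nat (den inp i) / of_nat (num inp i)"

definition completes :: "(nat \<Rightarrow> nat) \<Rightarrow> (nat \<Rightarrow> nat) \<Rightarrow> nat \<Rightarrow> nat \<Rightarrow> bool" where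
  "completes inp a i q \<longleftrightarrow> left_over (cap inp i q) (a 0, a 1) (inp 1) = (0, 0)"

text \<open>\<open>F\<close> collects the pairs \<open>(i, q)\<close> already tried; nothing is
  required of \<open>j\<close>, \<open>e\<close> and the output before the first success.\<close>

definition search_inv ::
  "(nat \<Rightarrow> nat) \<Rightarrow> (nat \<Rightarrow> nat) \<Rightarrow> (nat \<Rightarrow> nat) \<Rightarrow> (nat \<times> nat) set \<Rightarrow> state \<Rightarrow> bool" where
  "search_inv inp f a F r \<longleftrightarrow>
     r ''b'' 0 = 0 \<and> (\<forall>(i, q) \<in> F. \<not> completes inp a i q) \<or>
     r ''b'' 0 = 1 \<and> (r ''j'' 0, r ''e'' 0) \<in> F \<and>
       fits inp f (r ''j'' 0) (r ''e'' 0) (r ''out'') \<and>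
       (\<forall>(i, q) \<in> F. completes inp a i q \<longrightarrow> ratio inp (r ''j'' 0) (r ''e'' 0) \<le> ratio inp i q)"

lemma search_inv_upd [simp]:
  "''b'' \<noteq> x \<Longrightarrow> ''j'' \<noteq> x \<Longrightarrow> ''e'' \<noteq> x \<Longrightarrow> ''out'' \<noteq> x \<Longrightarrow>
     search_inv inp f a F (upd r x i v) = search_inv inp f a F r"
  by (simp add: search_inv_def)

lemma copy_prog_spec:
  assumes "s ''in'' 0 = N"
  shows "\<forall>v<N. run copy_prog s ''out'' v = s ''t'' v"
  unfolding copy_prog_def
proof (rule run_FFor_invariant[where I = "\<lambda>k r. \<forall>v<k. r ''out'' v = s ''t'' v"], goal_cases)
  case (4 k r)
  have "r ''t'' = s ''t''" by (auto intro!: 4(4))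
  then show ?case using 4(2,3) by (auto simp: less_Suc_eq)
qed (use assms in auto)

lemma fits_cong:
  assumes eq: "\<And>v. v < inp 0 \<Longrightarrow> t v = t' v" and fits: "fits inp f i q t"
  shows "fits inp f i q t'"
  unfolding fits_def
proof (intro conjI allI impI)
  note fits = fits[unfolded fits_def]
  fix v assume "v < inp 0"
  then show "t' v < inp 1" using conjunct1[OF fits] eq[of v] by metis
next
  note fits = fits[unfolded fits_def]
  fix v w assume "v < inp 0" "w < inp 0" "t' v = t' w"
  then show "f v = f w"
    using conjunct1[OF conjunct2[OF fits], rule_format, of v w] eq[of v] eq[of w] by simp
next
  note fits = fits[unfolded fits_def]
  fix k assume "k < inp 1"
  moreover have "{v. v < inp 0 \<and> t' v = k} = {v. v < inp 0 \<and> t v = k}"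
    using eq by auto
  ultimately show "card {v. v < inp 0 \<and> t' v = k} \<le> cap inp i q k"
    using conjunct2[OF conjunct2[OF fits]] by simp
qed

lemma ratio_less_iff:
  assumes "0 < num inp i" "0 < num inp j"
  shows "q * (den inp i * num inp j) < e * (den inp j * num inp i) \<longleftrightarrow> ratio inp i q < ratio inp j e"
proof -
  have "ratio inp i q < ratio inp j e \<longleftrightarrow>
      (of_nat (q * (den inp i * num inp j)) :: rat) < of_nat (e * (den inp j * num inp i))"
    unfolding ratio_def using assms by (simp add: field_simps)
  then show ?thesis by (simp only: of_nat_less_iff)
qed

lemma search_step:
  fixes inp :: "nat \<Rightarrow> nat" and s :: state
  assumes inv: "search_inv inp f a F s" and s: "s ''in'' = inp" "s ''f'' = f" "s ''a'' = a"
    "s ''i'' 0 = i" "s ''q'' 0 = q"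
    and f: "\<And>v. v < inp 0 \<Longrightarrow> f v \<le> 1" and a: "\<And>j. a j = card {v. v < inp 0 \<and> f v = j}"
    and pos: "\<And>k. k < inp 1 \<Longrightarrow> 0 < den inp k" "\<And>k. k < inp 1 \<Longrightarrow> 0 < num inp k"
    and i: "i < inp 1" and F: "\<And>j e. (j, e) \<in> F \<Longrightarrow> j < inp 1"
  shows "search_inv inp f a (insert (i, q) F) (run (FSeq fill_prog update_prog) s)"
proof -
  define r where "r = run fill_prog s"
  have fr: "r ''in'' = inp" "r ''i'' 0 = i" "r ''q'' 0 = q" "r ''b'' = s ''b''" "r ''j'' = s ''j''"
    "r ''e'' = s ''e''" "r ''out'' = s ''out''"
    unfolding r_def using run_frame[of _ fill_prog s] s by (simp_all add: writes_subprogs)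
  note spec = fill_prog_spec[of s inp, unfolded s, OF refl f a pos(1) pos(2)[OF i], folded r_def]
  have ok: "completes inp a i q \<longleftrightarrow> r ''r'' 0 = 0 \<and> r ''r'' 1 = 0"
    by (simp only: completes_def spec(1)[symmetric] prod.inject)
  have inv_r: "search_inv inp f a F r"
    using inv fr unfolding search_inv_def by simp
  define better where "better \<longleftrightarrow> completes inp a i q \<and>
     \<not> (s ''b'' 0 = 1 \<and> \<not> (q * (den inp i * num inp (s ''j'' 0)) < s ''e'' 0 * (den inp (s ''j'' 0) * num inp i)))"
  have run: "run (FSeq fill_prog update_prog) s = (if better then
      run copy_prog (upd (upd (upd r ''b'' 0 1) ''j'' 0 i) ''e'' 0 q) else r)"
    unfolding better_def ok by (simp add: update_prog_def r_def[symmetric] fr num_def den_def)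
  show ?thesis
  proof (cases better)
    case True
    let ?r = "upd (upd (upd r ''b'' 0 1) ''j'' 0 i) ''e'' 0 q"
    define r' where "r' = run copy_prog ?r"
    have run': "run (FSeq fill_prog update_prog) s = r'"
      unfolding run r'_def using True by (rule if_P)
    have c: "completes inp a i q" using True by (simp add: better_def)
    have "fits inp f i q (r ''t'')" using spec(2) c ok by simp
    moreover have "?r ''in'' 0 = inp 0" using fr by simp
    then have "\<forall>v<inp 0. r' ''out'' v = r ''t'' v"
      using copy_prog_spec[of ?r "inp 0"] unfolding r'_def by simp
    ultimately have fits: "fits inp f i q (r' ''out'')"
      using fits_cong[of inp "r ''t''" "r' ''out''"] by simp
    have r': "r' ''b'' 0 = 1" "r' ''j'' 0 = i" "r' ''e'' 0 = q"
      unfolding r'_def using run_frame[of _ copy_prog ?r] by (simp_all add: writes_subprogs)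
    have "ratio inp i q \<le> ratio inp j e" if je: "(j, e) \<in> F" "completes inp a j e" for j e
    proof (cases "s ''b'' 0 = 1")
      case b: True
      then have "(s ''j'' 0, s ''e'' 0) \<in> F" "ratio inp (s ''j'' 0) (s ''e'' 0) \<le> ratio inp j e"
        using inv je unfolding search_inv_def by auto
      moreover from this have "ratio inp i q < ratio inp (s ''j'' 0) (s ''e'' 0)"
        using True b F pos(2) i unfolding better_def by (subst ratio_less_iff[symmetric]) auto
      ultimately show ?thesis by linarith
    next
      case False
      then show ?thesis using inv je unfolding search_inv_def by auto
    qed
    then show ?thesis
      unfolding run' search_inv_def using r' fits by auto
  next
    case False
    have run': "run (FSeq fill_prog update_prog) s = r"
      unfolding run using False by (rule if_not_P)
    show ?thesis
    proof (cases "completes inp a i q")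
      case True
      then have b: "s ''b'' 0 = 1"
        and le: "\<not> q * (den inp i * num inp (s ''j'' 0)) < s ''e'' 0 * (den inp (s ''j'' 0) * num inp i)"
        using False unfolding better_def by blast+
      have jF: "(s ''j'' 0, s ''e'' 0) \<in> F"
        using inv b unfolding search_inv_def by auto
      have "ratio inp (s ''j'' 0) (s ''e'' 0) \<le> ratio inp i q"
        using le ratio_less_iff[of inp i "s ''j'' 0"] pos(2) F[OF jF] i by auto
      then show ?thesis
        unfolding run' using inv_r b fr unfolding search_inv_def by auto
    next
      case c: False
      then show ?thesis
        unfolding run' using inv_r unfolding search_inv_def by auto
    qed
  qed
qed

lemma search_prog_spec:
  fixes inp :: "nat \<Rightarrow> nat" and s :: state
  assumes s: "s ''in'' = inp" "s ''f'' = f" "s ''a'' = a" "s ''b'' 0 = 0"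
    and f: "\<And>v. v < inp 0 \<Longrightarrow> f v \<le> 1" and a: "\<And>j. a j = card {v. v < inp 0 \<and> f v = j}"
    and pos: "\<And>k. k < inp 1 \<Longrightarrow> 0 < den inp k" "\<And>k. k < inp 1 \<Longrightarrow> 0 < num inp k"
  shows "search_inv inp f a ({..<inp 1} \<times> {..2 * inp 0}) (run search_prog s)"
proof -
  let ?b = "FSeq fill_prog update_prog"
  let ?e = "Plus (Times (Const 2) eN) (Const 1)"
  have w: "writes ?b = {''v'', ''t'', ''r'', ''k'', ''l'', ''h'', ''b'', ''j'', ''e'', ''out''}"
    by (auto simp: writes_subprogs)
  have t: "tame (FFor ''q'' ?e ?b)"
    unfolding tame.simps(5) w by (simp add: tame_subprogs)
  have t': "tame (FFor ''i'' eM (FFor ''q'' ?e ?b))"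
    unfolding tame.simps(5)[of "''i''"] writes.simps(5) w using t by simp
  show ?thesis
    unfolding search_prog_def
  proof (rule run_FFor_invariant[where I = "\<lambda>k r. search_inv inp f a ({..<k} \<times> {..2 * inp 0}) r", OF t'],
      goal_cases)
    case 1
    then show ?case using s by simp
  next
    case 2
    then show ?case using s by (simp add: search_inv_def)
  next
    case (3 k r)
    note outer = this
    have r: "r ''in'' = inp" "r ''f'' = f" "r ''a'' = a"
      using outer(4) s unfolding writes.simps(5) w by auto
    have "search_inv inp f a ({..<k} \<times> {..2 * inp 0} \<union> {k} \<times> {..<Suc (2 * inp 0)}) (run (FFor ''q'' ?e ?b) r)"
    proof (rule run_FFor_invariant[where
          I = "\<lambda>j r. search_inv inp f a ({..<k} \<times> {..2 * inp 0} \<union> {k} \<times> {..<j}) r", OF t], goal_cases)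
      case 1
      then show ?case using r by simp
    next
      case 2
      then show ?case using outer(2) by simp
    next
      case (3 j r')
      have r': "r' ''in'' = inp" "r' ''f'' = f" "r' ''a'' = a" "r' ''i'' 0 = k"
        using 3(4) r outer(3) unfolding writes.simps(5) w by auto
      have "search_inv inp f a (insert (k, j) ({..<k} \<times> {..2 * inp 0} \<union> {k} \<times> {..<j})) (run ?b r')"
        using outer(1) by (intro search_step[OF 3(2) r' 3(3) f a pos]) auto
      moreover have "insert (k, j) ({..<k} \<times> {..2 * inp 0} \<union> {k} \<times> {..<j}) =
          {..<k} \<times> {..2 * inp 0} \<union> {k} \<times> {..<Suc j}"
        by auto
      ultimately show ?case by simp
    qed
    moreover have "{..<k} \<times> {..2 * inp 0} \<union> {k} \<times> {..<Suc (2 * inp 0)} = {..<Suc k} \<times> {..2 * inp 0}"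
      by auto
    ultimately show ?case by simp
  qed
qed

lemma schedule_prog_spec:
  fixes inp :: "nat \<Rightarrow> nat" and s :: state
  assumes s: "s ''in'' = inp" "\<And>x i. x \<noteq> ''in'' \<Longrightarrow> s x i = 0"
    and g: "\<And>u v. u < inp 0 \<Longrightarrow> v < inp 0 \<Longrightarrow> edge_rel inp u v \<Longrightarrow> (g u :: bool) \<noteq> g v"
    and sym: "\<And>u v. u < inp 0 \<Longrightarrow> v < inp 0 \<Longrightarrow> edge_rel inp u v \<Longrightarrow> edge_rel inp v u"
    and pos: "\<And>k. k < inp 1 \<Longrightarrow> 0 < den inp k" "\<And>k. k < inp 1 \<Longrightarrow> 0 < num inp k"
  shows "\<exists>f a. search_inv inp f a ({..<inp 1} \<times> {..2 * inp 0}) (run schedule_prog s)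
    \<and> (\<forall>v<inp 0. f v \<le> 1) \<and> (\<forall>j. a j = card {v. v < inp 0 \<and> f v = j})
    \<and> (\<forall>u<inp 0. \<forall>v<inp 0. edge_rel inp u v \<longrightarrow> f u \<noteq> f v)
    \<and> 2 * a 1 \<le> card {v. v < inp 0 \<and> (\<exists>u<inp 0. edge_rel inp v u)}"
proof -
  define s1 where "s1 = run colour_prog s"
  define s2 where "s2 = run count_prog s1"
  define s3 where "s3 = run class_prog s2"
  have run: "run schedule_prog s = run search_prog s3"
    by (simp add: schedule_prog_def s1_def s2_def s3_def)
  have w: "writes colour_prog = {''v'', ''c'', ''u'', ''nz'', ''x'', ''y'', ''z'', ''w'', ''d''}"
    "writes count_prog = {''v'', ''p''}" "writes class_prog = {''v'', ''f'', ''a''}"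
    by (auto simp: prog_defs)
  have fr1: "y \<notin> writes colour_prog \<Longrightarrow> s1 y = s y" for y
    unfolding s1_def by (rule run_frame)
  have fr2: "y \<notin> writes count_prog \<Longrightarrow> s2 y = s1 y" for y
    unfolding s2_def by (rule run_frame)
  have fr3: "y \<notin> writes class_prog \<Longrightarrow> s3 y = s2 y" for y
    unfolding s3_def by (rule run_frame)
  have "colour_inv inp g UNIV s1"
    unfolding s1_def using s g by (intro colour_prog_spec) auto
  then have inv: "colour_inv inp g UNIV s2"
    using fr2 by (simp add: colour_inv_def w)
  have in2: "s2 ''in'' = inp" using fr1 fr2 s by (simp add: w)
  have a2: "s2 ''a'' i = 0" for i using fr1 fr2 s by (simp add: w)
  have p1: "s1 ''p'' i = 0" for i using fr1 s by (simp add: w)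
  have in1: "s1 ''in'' 0 = inp 0" using fr1 s by (simp add: w)
  have p2: "s2 ''p'' i = card {v. v < inp 0 \<and> s2 ''nz'' v = 1 \<and> s2 ''d'' v = i}" for i
    using count_prog_spec[of s1, OF in1 p1] fr2[of "''nz''"] fr2[of "''d''"] by (simp add: s2_def[symmetric] w)
  note cl = class_prog_spec[of inp g s2, OF inv in2 a2 p2 g sym, folded s3_def]
  have "search_inv inp (s3 ''f'') (s3 ''a'') ({..<inp 1} \<times> {..2 * inp 0}) (run search_prog s3)"
  proof (rule search_prog_spec)
    show "s3 ''in'' = inp" using fr3[of "''in''"] in2 by (simp add: w)
    show "s3 ''b'' 0 = 0" using fr1[of "''b''"] fr2[of "''b''"] fr3[of "''b''"] s(2) by (simp add: w)
    show "s3 ''f'' v \<le> 1" if "v < inp 0" for v using cl(2) that by blast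
    show "s3 ''a'' j = card {v. v < inp 0 \<and> s3 ''f'' v = j}" for j using cl(1) by blast
  qed (rule refl pos; assumption)+
  moreover have "2 * s3 ''a'' 1 \<le> card {v. v < inp 0 \<and> (\<exists>u<inp 0. edge_rel inp v u)}"
    using cl(1,4) by simp
  ultimately show ?thesis
    unfolding run using cl(1-3) by blast
qed

section \<open>Schedules and the input encoding\<close>

lemma length_concat_map:
  assumes "\<And>x. x \<in> set xs \<Longrightarrow> length (h x) = n"
  shows "length (concat (map h xs)) = length xs * n"
  using assms by (induction xs) auto

lemma nth_concat_map:
  assumes "\<And>x. x \<in> set xs \<Longrightarrow> length (h x) = n" "i < length xs" "j < n"
  shows "concat (map h xs) ! (i * n + j) = h (xs ! i) ! j"
  using assms
proof (induction xs arbitrary: i)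
  case (Cons x xs)
  then show ?case by (cases i) (simp_all add: nth_append add.assoc)
qed simp

definition inp_of :: "inst \<Rightarrow> nat \<Rightarrow> nat" where
  "inp_of I = input_state (encode I) ''in''"

lemma length_encode: "length (encode I) = 2 + (jobs I * jobs I + length (speeds I) * 2)"
proof -
  have "length (concat (map (\<lambda>u. map (\<lambda>v. if {u, v} \<in> edges I then 1 else 0 :: nat) [0..<jobs I]) [0..<jobs I]))
      = length [0..<jobs I] * jobs I"
    by (rule length_concat_map) simp
  moreover have "length (concat (map (\<lambda>s. [nat (fst (quotient_of s)), nat (snd (quotient_of s))]) (speeds I)))
      = length (speeds I) * 2"
    by (rule length_concat_map) simp
  ultimately show ?thesis unfolding encode_def by (simp del: length_concat)
qed

lemma inp_of_jobs: "inp_of I 0 = jobs I"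
  by (simp add: inp_of_def input_state_def encode_def)

lemma inp_of_machines: "inp_of I 1 = length (speeds I)"
  by (simp add: inp_of_def input_state_def encode_def)

lemma edge_rel_inp_of:
  assumes "u < jobs I" "v < jobs I"
  shows "edge_rel (inp_of I) u v \<longleftrightarrow> {u, v} \<in> edges I"
proof -
  let ?A = "concat (map (\<lambda>u. map (\<lambda>v. if {u, v} \<in> edges I then 1 else 0 :: nat) [0..<jobs I]) [0..<jobs I])"
  have len: "length ?A = jobs I * jobs I"
    by (subst length_concat_map[where n = "jobs I"]) simp_all
  have "Suc u * jobs I \<le> jobs I * jobs I" using assms by (intro mult_right_mono) auto
  then have lt: "u * jobs I + v < jobs I * jobs I" using assms by simp
  have "?A ! (u * jobs I + v) = (if {u, v} \<in> edges I then 1 else 0)"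
    using nth_concat_map[of "[0..<jobs I]" "\<lambda>u. map (\<lambda>v. if {u, v} \<in> edges I then 1 else 0 :: nat) [0..<jobs I]"
        "jobs I" u v] assms by simp
  moreover have "inp_of I (2 + (u * jobs I + v)) = ?A ! (u * jobs I + v)"
    unfolding inp_of_def input_state_def using lt length_encode[of I]
    by (simp add: encode_def nth_append len del: length_concat)
  ultimately show ?thesis by (simp add: edge_rel_def inp_of_jobs)
qed

lemma inp_of_speed:
  assumes "k < length (speeds I)"
  shows "num (inp_of I) k = nat (fst (quotient_of (speeds I ! k)))"
    and "den (inp_of I) k = nat (snd (quotient_of (speeds I ! k)))"
proof -
  let ?A = "concat (map (\<lambda>u. map (\<lambda>v. if {u, v} \<in> edges I then 1 else 0 :: nat) [0..<jobs I]) [0..<jobs I])"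
  let ?B = "concat (map (\<lambda>s. [nat (fst (quotient_of s)), nat (snd (quotient_of s))]) (speeds I))"
  have len: "length ?A = jobs I * jobs I"
    by (subst length_concat_map[where n = "jobs I"]) simp_all
  have *: "inp_of I (2 + (jobs I * jobs I + n)) = ?B ! n" if "n < length (speeds I) * 2" for n
    unfolding inp_of_def input_state_def using that length_encode[of I]
    by (simp add: encode_def nth_append len del: length_concat)
  have "?B ! (k * 2 + 0) = nat (fst (quotient_of (speeds I ! k)))"
    "?B ! (k * 2 + 1) = nat (snd (quotient_of (speeds I ! k)))"
    by (subst nth_concat_map[where n = 2]; use assms in simp)+
  then show "num (inp_of I) k = nat (fst (quotient_of (speeds I ! k)))"
    "den (inp_of I) k = nat (snd (quotient_of (speeds I ! k)))"
    using *[of "k * 2"] *[of "k * 2 + 1"] assms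
    by (simp_all add: num_def den_def inp_of_jobs mult.commute numeral_3_eq_3)
qed

lemma speed_pos:
  assumes "valid_speeds (speeds I)" "k < length (speeds I)"
  shows "0 < num (inp_of I) k" "0 < den (inp_of I) k"
    and "speeds I ! k = of_nat (num (inp_of I) k) / of_nat (den (inp_of I) k)"
    and "1 \<le> speeds I ! k"
proof -
  let ?s = "speeds I ! k"
  show s1: "1 \<le> ?s" using assms unfolding valid_speeds_def by simp
  obtain p d where pd: "quotient_of ?s = (p, d)" by fastforce
  have d: "0 < d" using quotient_of_denom_pos[OF pd] .
  have s: "?s = of_int p / of_int d" using quotient_of_div[OF pd] .
  then have "of_int p = ?s * of_int d" using d by (simp add: field_simps)
  moreover have "0 < ?s * of_int d" using s1 d by (intro mult_pos_pos) auto
  ultimately have p: "0 < p" by simp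
  show "0 < num (inp_of I) k" "0 < den (inp_of I) k"
    using p d pd inp_of_speed[OF assms(2)] by simp_all
  show "?s = of_nat (num (inp_of I) k) / of_nat (den (inp_of I) k)"
    using s p d pd inp_of_speed[OF assms(2)] by (simp add: of_nat_nat)
qed

lemma ratio_eq:
  assumes "valid_speeds (speeds I)" "i < length (speeds I)"
  shows "ratio (inp_of I) i q = of_nat q / speeds I ! i"
  using speed_pos[OF assms] by (simp add: ratio_def)

text \<open>The adjunction between multiplication and floor division; through it all later capacity
  estimates become inequalities between processing times.\<close>

lemma le_cap_iff:
  assumes "valid_speeds (speeds I)" "i < length (speeds I)" "k < length (speeds I)"
  shows "n \<le> cap (inp_of I) i q k \<longleftrightarrow> of_nat n / speeds I ! k \<le> ratio (inp_of I) i q"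
proof -
  note pi = speed_pos[OF assms(1,2)] and pk = speed_pos[OF assms(1,3)]
  let ?n = "num (inp_of I)" and ?d = "den (inp_of I)"
  have "n \<le> cap (inp_of I) i q k \<longleftrightarrow> n * (?d k * ?n i) \<le> ?n k * q * ?d i"
    unfolding cap_def using pi(1) pk(2) by (intro less_eq_div_iff_mult_less_eq) simp
  also have "\<dots> \<longleftrightarrow> (of_nat (n * (?d k * ?n i)) :: rat) \<le> of_nat (?n k * q * ?d i)"
    by (simp only: of_nat_le_iff)
  also have "\<dots> \<longleftrightarrow> of_nat n / speeds I ! k \<le> ratio (inp_of I) i q"
    unfolding ratio_def pk(3) using pi(1,2) pk(1,2) by (simp add: field_simps)
  finally show ?thesis .
qed

text \<open>If the machine on which the first class is finished is reached with at most \<open>W\<close> units of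
  capacity spent, then at most \<open>W\<close> units are lost for the second class.\<close>

lemma left_over_eq_0:
  fixes C :: "nat \<Rightarrow> nat"
  assumes W: "\<And>k. (\<Sum>j<k. C j) < a \<Longrightarrow> (\<Sum>j<Suc k. C j) \<le> W"
    and "a \<le> (\<Sum>j<M. C j)" "b + W \<le> (\<Sum>j<M. C j)"
  shows "left_over C (a, b) M = (0, 0)"
proof -
  \<comment> \<open>Until the first class is finished, nothing of the second is placed. From then
    on, second-class jobs left plus capacity spent stay at most \<open>b + W\<close>, unless
    truncated subtraction has already reached 0.\<close>
  have inv: "fst (left_over C (a, b) k) = a - (\<Sum>j<k. C j) \<and>
      (if (\<Sum>j<k. C j) < a then snd (left_over C (a, b) k) = b
       else snd (left_over C (a, b) k) = 0 \<or> snd (left_over C (a, b) k) + (\<Sum>j<k. C j) \<le> b + W)" for k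
  proof (induction k)
    case 0
    then show ?case by auto
  next
    case (Suc k)
    obtain x y where xy: "left_over C (a, b) k = (x, y)" by fastforce
    show ?case
    proof (cases "(\<Sum>j<k. C j) < a")
      case True
      then have "x = a - (\<Sum>j<k. C j)" "x \<noteq> 0" "y = b" using Suc xy by auto
      then show ?thesis using xy W[OF True] by auto
    next
      case False
      then have "x = 0" "y = 0 \<or> y + (\<Sum>j<k. C j) \<le> b + W" using Suc xy by auto
      then show ?thesis using xy False by auto
    qed
  qed
  have "fst (left_over C (a, b) M) = 0" "snd (left_over C (a, b) M) = 0"
    using inv[of M] assms(2,3) by auto
  then show ?thesis by (simp add: prod_eq_iff)
qed

section \<open>Feasibility and the approximation guarantee\<close>

lemma makespan_attained:
  assumes "speeds I \<noteq> []"
  shows "\<exists>i<length (speeds I). makespan I S = of_nat (card (jobs_on S i)) / speeds I ! i"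
    and "\<And>i. i < length (speeds I) \<Longrightarrow> of_nat (card (jobs_on S i)) / speeds I ! i \<le> makespan I S"
proof -
  have e: "(\<Sum>j\<in>jobs_on S i. 1 / speeds I ! i) = of_nat (card (jobs_on S i)) / speeds I ! i" for i
    by simp
  have "makespan I S \<in> (\<lambda>i. \<Sum>j\<in>jobs_on S i. 1 / speeds I ! i) ` {..<length (speeds I)}"
    unfolding makespan_def using assms by (intro Max_in) auto
  then show "\<exists>i<length (speeds I). makespan I S = of_nat (card (jobs_on S i)) / speeds I ! i"
    by auto
  show "of_nat (card (jobs_on S i)) / speeds I ! i \<le> makespan I S" if "i < length (speeds I)" for i
    unfolding makespan_def using that by (intro Max_ge) auto
qed

lemma finite_feasible: "finite {S. feasible I S}"
proof (rule finite_subset)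
  show "{S. feasible I S} \<subseteq> {S. set S \<subseteq> {..<length (speeds I)} \<and> length S = jobs I}"
    unfolding feasible_def by (auto simp: in_set_conv_nth)
  show "finite {S. set S \<subseteq> {..<length (speeds I)} \<and> length S = jobs I}"
    by (rule finite_lists_length_eq) simp
qed

definition nonisolated :: "nat \<Rightarrow> nat set set \<Rightarrow> nat set" where
  "nonisolated N E = {v. v < N \<and> (\<exists>u<N. {v, u} \<in> E)}"

text \<open>Twice the optimum is one of the makespans that are tried, and it is large enough if the machines other than the fastest one together have to process at least half of
  the second class.\<close>

lemma schedule_correct:
  assumes valid: "valid_inst I" and feas: "\<exists>S. feasible I S"
  obtains S where "S = map (run schedule_prog (input_state (encode I)) ''out'') [0..<jobs I]"
    "feasible I S"
    "(\<And>W. W \<subseteq> {..<jobs I} \<Longrightarrow> independent_set (edges I) W \<Longrightarrow>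
        card (nonisolated (jobs I) (edges I)) \<le> 4 * card ({..<jobs I} - W)) \<Longrightarrow>
      makespan I S \<le> 2 * opt_makespan I"
proof -
  define inp where "inp = inp_of I"
  define N where "N = jobs I"
  define M where "M = length (speeds I)"
  define E where "E = edges I"
  have vs: "valid_speeds (speeds I)" and bip: "bipartite {..<N} E"
    using valid unfolding valid_inst_def N_def E_def by auto
  have M0: "0 < M" "speeds I \<noteq> []" using vs unfolding valid_speeds_def M_def by auto
  have inp: "inp 0 = N" "inp 1 = M" by (simp_all add: inp_def inp_of_jobs inp_of_machines N_def M_def del: One_nat_def)
  have edge: "edge_rel inp u v \<longleftrightarrow> {u, v} \<in> E" if "u < N" "v < N" for u v
    using edge_rel_inp_of that unfolding inp_def N_def E_def by blast
  have pos: "0 < num inp k" "0 < den inp k" "1 \<le> speeds I ! k" if "k < M" for k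
    using speed_pos[OF vs] that unfolding inp_def M_def by auto
  obtain X Y where XY: "X \<union> Y = {..<N}" "X \<inter> Y = {}" "\<forall>e\<in>E. \<exists>u\<in>X. \<exists>v\<in>Y. e = {u, v}"
    using bip unfolding bipartite_def by blast
  have g: "(u \<in> X) \<noteq> (v \<in> X)" if "{u, v} \<in> E" for u v
    using XY that by (metis IntI doubleton_eq_iff empty_iff)
  define s where "s = input_state (encode I)"
  have "\<exists>f a. search_inv inp f a ({..<inp 1} \<times> {..2 * inp 0}) (run schedule_prog s)
    \<and> (\<forall>v<inp 0. f v \<le> 1) \<and> (\<forall>j. a j = card {v. v < inp 0 \<and> f v = j})
    \<and> (\<forall>u<inp 0. \<forall>v<inp 0. edge_rel inp u v \<longrightarrow> f u \<noteq> f v)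
    \<and> 2 * a 1 \<le> card {v. v < inp 0 \<and> (\<exists>u<inp 0. edge_rel inp v u)}"
  proof (rule schedule_prog_spec[where g = "\<lambda>u. u \<in> X"])
    show "s ''in'' = inp" by (simp add: s_def inp_def inp_of_def)
    show "s x i = 0" if "x \<noteq> ''in''" for x i using that by (simp add: s_def input_state_def)
    show "edge_rel inp v u" if "u < inp 0" "v < inp 0" "edge_rel inp u v" for u v
      using that edge by (simp add: inp insert_commute)
  qed (use inp edge g pos in auto)
  then obtain f a where inv: "search_inv inp f a ({..<M} \<times> {..2 * N}) (run schedule_prog s)"
    and f1': "\<forall>v<N. f v \<le> 1" and a': "\<forall>j. a j = card {v. v < N \<and> f v = j}"
    and fe': "\<forall>u<N. \<forall>v<N. edge_rel inp u v \<longrightarrow> f u \<noteq> f v"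
    and a1: "2 * a 1 \<le> card {v. v < N \<and> (\<exists>u<N. edge_rel inp v u)}"
    unfolding inp by blast
  have f1: "f v \<le> 1" if "v < N" for v using f1' that by blast
  have a: "a j = card {v. v < N \<and> f v = j}" for j using a' by blast
  have fe: "f u \<noteq> f v" if "u < N" "v < N" "{u, v} \<in> E" for u v
    using fe' edge[of u v] that by blast
  have "{v. v < N \<and> (\<exists>u<N. edge_rel inp v u)} = nonisolated N E"
    using edge unfolding nonisolated_def by auto
  with a1 have a1: "2 * a 1 \<le> card (nonisolated N E)" by simp
  have "a 0 + a 1 = card ({v. v < N \<and> f v = 0} \<union> {v. v < N \<and> f v = 1})"
    unfolding a by (subst card_Un_disjoint) auto
  also have "{v. v < N \<and> f v = 0} \<union> {v. v < N \<and> f v = 1} = {..<N}"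
    using f1 by (force simp: le_Suc_eq)
  finally have aN: "a 0 + a 1 = N" by simp
  have comp: "completes inp a i q \<longleftrightarrow> left_over (cap inp i q) (a 0, a 1) M = (0, 0)" for i q
    unfolding completes_def inp ..
  have le_cap: "n \<le> cap inp i q k \<longleftrightarrow> of_nat n / speeds I ! k \<le> of_nat q / speeds I ! i"
    if "i < M" "k < M" for i k q n
    using le_cap_iff[OF vs, of i k n q] ratio_eq[OF vs, of i q] that by (simp add: inp_def M_def)
  have sorted: "speeds I ! k \<le> speeds I ! j" if "j \<le> k" "k < M" for j k
    using vs that sorted_wrt_nth_less[of "(\<ge>)" "speeds I" j k] unfolding valid_speeds_def M_def
    by (cases "j = k") auto
  have split: "(\<Sum>j<M. h j) = h 0 + (\<Sum>j\<in>{1..<M}. h j)" for h :: "nat \<Rightarrow> nat"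
  proof -
    have "{..<M} = insert 0 {1..<M}" using M0 by auto
    then show ?thesis by simp
  qed
  \<comment> \<open>At time 2N / s on the slowest machine, of speed s, every machine can hold 2N
    jobs. So at least one trial succeeds, which gives a feasible output whatever the graph
    is.\<close>
  have slow: "completes inp a (M - 1) (2 * N)"
    unfolding comp
  proof (rule left_over_eq_0[where W = "cap inp (M - 1) (2 * N) 0"])
    let ?C = "cap inp (M - 1) (2 * N)"
    have C: "2 * N \<le> ?C k" if "k < M" for k
      using that sorted[of k "M - 1"] pos(3)[of k] pos(3)[of "M - 1"] M0
      by (subst le_cap) (auto intro!: divide_left_mono mult_pos_pos)
    show "(\<Sum>j<Suc k. ?C j) \<le> ?C 0" if "(\<Sum>j<k. ?C j) < a 0" for k
    proof (cases k)
      case (Suc k')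
      have "?C 0 \<le> (\<Sum>j<k. ?C j)" using Suc by (intro member_le_sum) auto
      then have False using that C[of 0] M0 aN by simp
      then show ?thesis ..
    qed simp
    have b: "a 1 \<le> (\<Sum>j\<in>{1..<M}. ?C j)"
    proof (cases "M = 1")
      case True
      \<comment> \<open>With a single machine, feasibility leaves no edges, so the second class is
        empty.\<close>
      obtain S where S: "feasible I S" using feas by blast
      have "S ! v = 0" if "v < N" for v
        using S that True unfolding feasible_def N_def M_def by auto
      moreover have "length S = N" using S unfolding feasible_def N_def by simp
      ultimately have "jobs_on S 0 = {..<N}" unfolding jobs_on_def by auto
      then have "nonisolated N E = {}"
        using S True unfolding feasible_def independent_set_def nonisolated_def M_def E_def by auto
      then show ?thesis using a1 by simp
    next
      case False
      then have "?C 1 \<le> (\<Sum>j\<in>{1..<M}. ?C j)" using M0 by (intro member_le_sum) auto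
      then show ?thesis using C[of 1] False M0 aN by simp
    qed
    then show "a 1 + ?C 0 \<le> (\<Sum>j<M. ?C j)" unfolding split by simp
    show "a 0 \<le> (\<Sum>j<M. ?C j)" unfolding split using C[of 0] M0 aN by simp
  qed
  define t where "t = run schedule_prog s ''out''"
  have "(M - 1, 2 * N) \<in> {..<M} \<times> {..2 * N}" using M0 by auto
  then obtain j e where fits: "fits inp f j e t" and jM: "j < M"
    and best: "\<And>i q. i < M \<Longrightarrow> q \<le> 2 * N \<Longrightarrow> completes inp a i q \<Longrightarrow> ratio inp j e \<le> ratio inp i q"
    using inv slow unfolding search_inv_def t_def by fastforce
  define S where "S = map t [0..<N]"
  have on: "jobs_on S k = {v. v < N \<and> t v = k}" for k
    unfolding jobs_on_def S_def by auto
  have feasS: "feasible I S"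
    unfolding feasible_def
  proof (intro conjI allI impI)
    show "length S = jobs I" by (simp add: S_def N_def)
    show "S ! v < length (speeds I)" if "v < jobs I" for v
      using that fits unfolding fits_def inp by (simp add: S_def N_def M_def)
    have same: "f u = f v" if "u < N" "v < N" "t u = t v" for u v
      using fits that unfolding fits_def inp by blast
    show "independent_set (edges I) (jobs_on S k)" for k
      unfolding independent_set_def on E_def[symmetric] using same fe by blast
  qed
  have ms: "makespan I S \<le> ratio inp j e"
  proof -
    obtain k where k: "k < M" "makespan I S = of_nat (card (jobs_on S k)) / speeds I ! k"
      using makespan_attained(1)[OF M0(2), of S] unfolding M_def by blast
    have "card (jobs_on S k) \<le> cap inp j e k"
      using fits k(1) unfolding fits_def inp on by blast
    then show ?thesis
      using le_cap_iff[OF vs, of j k "card (jobs_on S k)" e] jM k by (simp add: inp_def M_def)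
  qed
  have "makespan I S \<le> 2 * opt_makespan I"
    if many: "\<And>W. W \<subseteq> {..<jobs I} \<Longrightarrow> independent_set (edges I) W \<Longrightarrow>
        card (nonisolated (jobs I) (edges I)) \<le> 4 * card ({..<jobs I} - W)"
  proof -
    have "opt_makespan I \<in> makespan I ` {S. feasible I S}"
      unfolding opt_makespan_def using feas finite_feasible by (intro Min_in) auto
    then obtain T where T: "feasible I T" "opt_makespan I = makespan I T" by blast
    obtain i where i: "i < M" "makespan I T = of_nat (card (jobs_on T i)) / speeds I ! i"
      using makespan_attained(1)[OF M0(2), of T] unfolding M_def by blast
    define c where "c = (\<lambda>k. card (jobs_on T k))"
    have lenT: "length T = N" using T(1) unfolding feasible_def N_def by simp
    have TM: "T ! v < M" if "v < N" for v
      using T(1) that unfolding feasible_def N_def M_def by auto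
    have fin: "finite (jobs_on T k)" for k unfolding jobs_on_def by simp
    have sum_c: "(\<Sum>k\<in>K. c k) = card (\<Union>k\<in>K. jobs_on T k)" if "finite K" for K
      unfolding c_def using that fin
      by (subst card_UN_disjoint) (auto simp: jobs_on_def)
    have "(\<Union>k<M. jobs_on T k) = {..<N}"
      unfolding jobs_on_def lenT using TM by auto
    then have cN: "(\<Sum>k<M. c k) = N" using sum_c[of "{..<M}"] by simp
    have "c i \<le> N"
      unfolding c_def using card_mono[of "{..<N}" "jobs_on T i"] by (auto simp: jobs_on_def lenT)
    \<comment> \<open>\<open>i\<close> is a bottleneck machine of the optimal schedule
      \<open>T\<close>, so the optimum is c i / s_i and this trial has exactly twice that
      makespan.\<close>
    have "completes inp a i (2 * c i)"
      unfolding comp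
    proof -
      let ?C = "cap inp i (2 * c i)"
      have C: "2 * c k \<le> ?C k" if "k < M" for k
      proof -
        have "of_nat (c k) / speeds I ! k \<le> of_nat (c i) / speeds I ! i"
          using makespan_attained(2)[OF M0(2), of k T] that i unfolding c_def M_def by simp
        then show ?thesis using le_cap[OF i(1) that, of "2 * c k" "2 * c i"] by simp
      qed
      have C0: "?C k \<le> ?C 0" if "k < M" for k
      proof -
        have "of_nat (?C k) / speeds I ! 0 \<le> of_nat (?C k) / speeds I ! k"
          using sorted[of 0 k] pos(3)[OF that] pos(3)[OF M0(1)] that
          by (intro divide_left_mono) auto
        also have "\<dots> \<le> of_nat (2 * c i) / speeds I ! i"
          using le_cap[OF i(1) that, of "?C k" "2 * c i"] by simp
        finally show ?thesis using le_cap[OF i(1) M0(1), of "?C k" "2 * c i"] by blast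
      qed
      have tot: "2 * N \<le> (\<Sum>k<M. ?C k)"
        unfolding cN[symmetric] sum_distrib_left using C by (intro sum_mono) auto
      show "left_over ?C (a 0, a 1) M = (0, 0)"
      proof (cases "a 0 \<le> ?C 0")
        case True
        have ind: "independent_set (edges I) (jobs_on T 0)"
          using T(1) M0(1) unfolding feasible_def M_def by blast
        have sub: "jobs_on T 0 \<subseteq> {..<N}" unfolding jobs_on_def lenT by auto
        \<comment> \<open>The jobs that \<open>T\<close> puts on the fastest machine are
          independent, and the rest are what the other machines process in \<open>T\<close>. Their
          doubled capacity therefore holds the whole second class.\<close>
        have "2 * a 1 \<le> 4 * card ({..<N} - jobs_on T 0)"
          using many[OF sub[unfolded N_def] ind] a1 unfolding N_def E_def by linarith
        also have "{..<N} - jobs_on T 0 = (\<Union>k\<in>{1..<M}. jobs_on T k)"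
          unfolding jobs_on_def lenT using TM by (auto simp: Suc_le_eq)
        also have "card \<dots> = (\<Sum>k\<in>{1..<M}. c k)" using sum_c[of "{1..<M}"] by simp
        finally have "a 1 \<le> 2 * (\<Sum>k\<in>{1..<M}. c k)" by simp
        also have "\<dots> \<le> (\<Sum>k\<in>{1..<M}. ?C k)"
          unfolding sum_distrib_left using C by (intro sum_mono) auto
        finally have b: "a 1 \<le> (\<Sum>k\<in>{1..<M}. ?C k)" .
        show ?thesis
        proof (rule left_over_eq_0[where W = "?C 0"])
          show "(\<Sum>j<Suc k. ?C j) \<le> ?C 0" if "(\<Sum>j<k. ?C j) < a 0" for k
          proof (cases k)
            case (Suc k')
            have "?C 0 \<le> (\<Sum>j<k. ?C j)" using Suc by (intro member_le_sum) auto
            then have False using that True by simp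
            then show ?thesis ..
          qed simp
          show "a 0 \<le> (\<Sum>j<M. ?C j)" "a 1 + ?C 0 \<le> (\<Sum>j<M. ?C j)"
            unfolding split using True b by simp_all
        qed
      next
        case False
        have tot': "a 0 \<le> (\<Sum>j<M. ?C j)" using tot aN by simp
        \<comment> \<open>The machine finishing the first class starts with fewer than
          \<open>a 0\<close> units spent and has at most the capacity of the fastest machine, which
          is below \<open>a 0\<close>; hence \<open>W = 2 * a 0\<close>, and a 1 + 2 a 0 \<le>
          2N.\<close>
        show ?thesis
        proof (rule left_over_eq_0[where W = "2 * a 0"])
          show "(\<Sum>j<Suc k. ?C j) \<le> 2 * a 0" if k: "(\<Sum>j<k. ?C j) < a 0" for k
          proof -
            have "k < M"
            proof (rule ccontr)
              assume "\<not> k < M"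
              then have "(\<Sum>j<M. ?C j) \<le> (\<Sum>j<k. ?C j)" by (intro sum_mono2) auto
              then show False using tot' k by simp
            qed
            then show ?thesis using C0[of k] False k by simp
          qed
          show "a 0 \<le> (\<Sum>j<M. ?C j)" by (rule tot')
          show "a 1 + 2 * a 0 \<le> (\<Sum>j<M. ?C j)" using tot aN by simp
        qed
      qed
    qed
    then have "ratio inp j e \<le> ratio inp i (2 * c i)"
      using best[OF i(1)] \<open>c i \<le> N\<close> by simp
    also have "\<dots> = 2 * opt_makespan I"
      using ratio_eq[OF vs, of i "2 * c i"] i T(2) by (simp add: inp_def M_def c_def)
    finally show ?thesis using ms by simp
  qed
  then show ?thesis
    using that[of S] feasS unfolding S_def t_def s_def N_def by blast
qed

section \<open>Running time and output of the compiled program\<close>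

lemma polynomial_time_schedule_prog: "polynomial_time (compile schedule_prog)"
proof -
  obtain Q :: "nat poly" where Q: "\<And>n. steps schedule_prog (2 * n + 1) = poly Q n"
    using steps_poly by metis
  let ?K = "coef schedule_prog"
  have "\<exists>t s. exec (compile schedule_prog) (input_state (encode I)) t s \<and>
      t \<le> poly (Q * ([:?K:] * ([:0, 1:] + Q))) (input_size I)" if "valid_inst I" for I
  proof -
    define n where "n = input_size I"
    define s where "s = input_state (encode I)"
    have mem: "bits x \<le> n" if "x \<in> set (encode I)" for x
      unfolding n_def input_size_def using that by (intro member_le_sum_list) auto
    have n0: "0 < n"
      using mem[of "jobs I"] bits_pos[of "jobs I"] by (simp add: encode_def)
    have vals: "s x i \<le> 2 ^ n - 1" for x i
    proof (cases "x = ''in'' \<and> i < length (encode I)")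
      case True
      then have "s x i \<in> set (encode I)" by (simp add: s_def input_state_def)
      then have "s x i < 2 ^ n"
        using less_two_power_bits[of "s x i"] mem power_increasing[of _ n "2 :: nat"]
        by (meson le_trans less_le_trans one_le_numeral)
      then show ?thesis by simp
    qed (auto simp: s_def input_state_def)
    have "length (encode I) = sum_list (map (\<lambda>_. 1) (encode I))"
      by (simp add: sum_list_triv)
    also have "\<dots> \<le> n"
      unfolding n_def input_size_def using bits_pos by (intro sum_list_mono) (simp add: Suc_le_eq)
    finally have len: "length (encode I) \<le> n" .
    have NM: "jobs I \<le> n" "length (speeds I) \<le> n"
      using len unfolding length_encode by (cases "jobs I"; simp)+
    have in01: "s ''in'' 0 = jobs I" "s ''in'' 1 = length (speeds I)"
      using inp_of_jobs[of I] inp_of_machines[of I] unfolding s_def inp_of_def by blast+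
    have lb: "aval e s \<le> 2 * n + 1" if "e \<in> loop_bounds schedule_prog" for e
      using that NM in01 by (auto simp: prog_defs)
    \<comment> \<open>Input values are below 2^n and grow by at most \<open>poly Q n\<close>, so
      words of \<open>n + poly Q n\<close> bits suffice; the time is the number of steps times a
      constant multiple of this length.\<close>
    have "bits (2 ^ n - 1 + steps schedule_prog (2 * n + 1)) \<le> n + poly Q n"
    proof (rule bits_leI)
      have "(1 :: nat) \<le> 2 ^ n" "m < 2 ^ m" for m :: nat by simp_all
      moreover have "2 ^ n - 1 + poly Q n < 2 ^ n * 2 ^ poly Q n"
      proof -
        have "Suc (poly Q n) \<le> 2 ^ poly Q n" by (simp add: Suc_le_eq)
        then have "2 ^ n * Suc (poly Q n) \<le> 2 ^ n * 2 ^ poly Q n" by (rule mult_left_mono) simp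
        moreover have "poly Q n \<le> 2 ^ n * poly Q n" by simp
        moreover have "(0 :: nat) < 2 ^ n" by simp
        ultimately show ?thesis unfolding mult_Suc_right by linarith
      qed
      ultimately show "2 ^ n - 1 + steps schedule_prog (2 * n + 1) < 2 ^ (n + poly Q n)"
        by (simp add: Q[of n, simplified] power_add)
    qed (use n0 in simp)
    then obtain t where "exec (compile schedule_prog) s t (run schedule_prog s)"
      "t \<le> poly Q n * (?K * (n + poly Q n))"
      using exec_compile[OF tame_schedule_prog vals lb order_refl, of "n + poly Q n"]
      unfolding Q by blast
    moreover have "poly (Q * ([:?K:] * ([:0, 1:] + Q))) n = poly Q n * (?K * (n + poly Q n))"
      by simp
    ultimately show ?thesis
      unfolding s_def[symmetric] n_def[symmetric] by metis
  qed
  then show ?thesis unfolding polynomial_time_def by blast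
qed

text \<open>Only halting in the state given by \<open>run\<close> is wanted, so any finite bounds
  will do: the sum of all loop bounds and the largest input number.\<close>

lemma returns_schedule_prog:
  assumes "valid_inst I"
  shows "returns (compile schedule_prog) I
    (map (run schedule_prog (input_state (encode I)) ''out'') [0..<jobs I])"
proof -
  define s where "s = input_state (encode I)"
  define L where "L = (\<Sum>e\<in>loop_bounds schedule_prog. aval e s)"
  define M where "M = Max (insert 0 (set (encode I)))"
  have "finite (loop_bounds c)" for c by (induction c) auto
  then have lb: "aval e s \<le> L" if "e \<in> loop_bounds schedule_prog" for e
    unfolding L_def using that by (intro member_le_sum) auto
  have "s x i \<le> M" for x i
    unfolding s_def input_state_def M_def by (auto intro!: Max_ge)
  from exec_compile[OF tame_schedule_prog this lb order_refl order_refl]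
  show ?thesis unfolding returns_def s_def[symmetric] by blast
qed

lemma polynomial_time_algorithm_schedule_prog: "polynomial_time_algorithm (compile schedule_prog)"
  unfolding polynomial_time_algorithm_def
  using polynomial_time_schedule_prog returns_schedule_prog by (metis schedule_correct)

section \<open>Independent indicators\<close>

text \<open>Over a finite \<open>S\<close> the distribution has finite support, so every function is
  integrable and linearity needs no side conditions on \<open>F\<close>.\<close>

definition bexpect :: "real \<Rightarrow> 'i set \<Rightarrow> (('i \<Rightarrow> bool) \<Rightarrow> real) \<Rightarrow> real" where
  "bexpect p S F = measure_pmf.expectation (Pi_pmf S False (\<lambda>_. bernoulli_pmf p)) F"

lemma integrable_Pi_bernoulli:
  fixes F :: "('i \<Rightarrow> bool) \<Rightarrow> real"
  assumes "finite S"
  shows "integrable (measure_pmf (Pi_pmf S False (\<lambda>_. bernoulli_pmf p))) F"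
proof (rule integrable_measure_pmf_finite)
  show "finite (set_pmf (Pi_pmf S False (\<lambda>_. bernoulli_pmf p)))"
    using assms by (simp add: set_Pi_pmf finite_PiE_dflt)
qed

lemma bexpect_add: "finite S \<Longrightarrow> bexpect p S (\<lambda>f. F f + G f) = bexpect p S F + bexpect p S G"
  unfolding bexpect_def by (intro Bochner_Integration.integral_add integrable_Pi_bernoulli)

lemma bexpect_diff: "finite S \<Longrightarrow> bexpect p S (\<lambda>f. F f - G f) = bexpect p S F - bexpect p S G"
  unfolding bexpect_def by (intro Bochner_Integration.integral_diff integrable_Pi_bernoulli)

lemma bexpect_cmult: "bexpect p S (\<lambda>f. c * F f) = c * bexpect p S F"
  unfolding bexpect_def by simp

lemma bexpect_const: "bexpect p S (\<lambda>f. c) = c"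
  unfolding bexpect_def by simp

lemma bexpect_sum: "finite S \<Longrightarrow> bexpect p S (\<lambda>f. \<Sum>i\<in>I. F i f) = (\<Sum>i\<in>I. bexpect p S (F i))"
  unfolding bexpect_def by (intro Bochner_Integration.integral_sum integrable_Pi_bernoulli)

lemma bexpect_mono: "finite S \<Longrightarrow> (\<And>f. F f \<le> G f) \<Longrightarrow> bexpect p S F \<le> bexpect p S G"
  unfolding bexpect_def by (intro integral_mono integrable_Pi_bernoulli) auto

lemma bexpect_empty: "bexpect p {} F = F (\<lambda>_. False)"
  unfolding bexpect_def by simp

text \<open>Conditioning on the indicator of \<open>x\<close>. It lets expectations be treated by
  induction on the index set, without further measure theory.\<close>

lemma bexpect_insert:
  assumes "finite S" "x \<notin> S" "0 \<le> p" "p \<le> 1"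
  shows "bexpect p (insert x S) F =
    p * bexpect p S (\<lambda>f. F (f(x := True))) + (1 - p) * bexpect p S (\<lambda>f. F (f(x := False)))"
proof -
  let ?M = "Pi_pmf S False (\<lambda>_. bernoulli_pmf p)"
  have "Pi_pmf (insert x S) False (\<lambda>_. bernoulli_pmf p) =
      bernoulli_pmf p \<bind> (\<lambda>b. map_pmf (\<lambda>f. f(x := b)) ?M)"
    unfolding Pi_pmf_insert[OF assms(1,2)] pair_pmf_def map_pmf_def
    by (simp add: bind_assoc_pmf bind_return_pmf)
  then have "bexpect p (insert x S) F =
      measure_pmf.expectation (bernoulli_pmf p \<bind> (\<lambda>b. map_pmf (\<lambda>f. f(x := b)) ?M)) F"
    unfolding bexpect_def by simp
  also have "\<dots> = (\<Sum>b\<in>UNIV. pmf (bernoulli_pmf p) b *\<^sub>R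
      measure_pmf.expectation (map_pmf (\<lambda>f. f(x := b)) ?M) F)"
    using assms(1) by (intro pmf_expectation_bind) (auto simp: set_Pi_pmf finite_PiE_dflt)
  finally show ?thesis
    unfolding bexpect_def using assms(3,4) by (simp add: UNIV_bool)
qed

text \<open>Indicators outside \<open>T\<close> are averaged out one at a time, each contributing
  the factor p + (1 - p) = 1.\<close>

lemma bexpect_cong_on:
  assumes "finite S" "T \<subseteq> S" "0 \<le> p" "p \<le> 1"
    and "\<And>f g. (\<And>x. x \<in> T \<Longrightarrow> f x = g x) \<Longrightarrow> F f = F g"
  shows "bexpect p S F = bexpect p T F"
proof -
  have "bexpect p (T \<union> R) F = bexpect p T F" if "finite R" "R \<inter> T = {}" for R
    using that
  proof (induction R rule: finite_induct)
    case (insert x R)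
    have upd: "F (f(x := b)) = F f" for f b
      using insert.prems by (intro assms(5)) auto
    have "bexpect p (T \<union> insert x R) F = bexpect p (insert x (T \<union> R)) F" by simp
    also have "\<dots> = bexpect p (T \<union> R) F"
      using insert assms(1-4) finite_subset[OF assms(2,1)]
      by (subst bexpect_insert) (auto simp: upd algebra_simps)
    finally show ?case using insert by auto
  qed simp
  from this[of "S - T"] show ?thesis
    using assms(1,2) by (simp add: Un_absorb1 Diff_Int_distrib2)
qed

lemma bexpect_all_False:
  assumes "finite S" "T \<subseteq> S" "0 \<le> p" "p \<le> 1"
  shows "bexpect p S (\<lambda>f. of_bool (\<forall>x\<in>T. \<not> f x)) = (1 - p) ^ card T"
proof -
  have "bexpect p S (\<lambda>f. of_bool (\<forall>x\<in>T. \<not> f x)) = bexpect p T (\<lambda>f. of_bool (\<forall>x\<in>T. \<not> f x))"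
    using assms by (intro bexpect_cong_on) auto
  also have "finite T \<Longrightarrow> \<dots> = (1 - p) ^ card T"
  proof (induction T rule: finite_induct)
    case empty
    then show ?case by (simp add: bexpect_empty)
  next
    case (insert x T)
    have "(\<lambda>f. of_bool (\<forall>y\<in>insert x T. \<not> (f(x := False)) y) :: real) = (\<lambda>f. of_bool (\<forall>y\<in>T. \<not> f y))"
      using insert(2) by (intro ext) (auto simp: of_bool_def)
    then show ?case
      using insert assms(3,4) by (subst bexpect_insert) (auto simp: bexpect_const)
  qed
  finally show ?thesis using assms(1,2) finite_subset by blast
qed

lemma bexpect_two_True:
  assumes "finite S" "x \<in> S" "y \<in> S" "x \<noteq> y" "0 \<le> p" "p \<le> 1"
  shows "bexpect p S (\<lambda>f. of_bool (f x \<and> f y)) = p\<^sup>2"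
proof -
  have "bexpect p S (\<lambda>f. of_bool (f x \<and> f y)) = bexpect p {x, y} (\<lambda>f. of_bool (f x \<and> f y))"
    using assms by (intro bexpect_cong_on) auto
  also have "\<dots> = p\<^sup>2"
    using assms by (simp add: bexpect_insert bexpect_empty bexpect_const power2_eq_square)
  finally show ?thesis .
qed

text \<open>The Efron--Stein inequality for independent indicators.\<close>

lemma bexpect_variance_le:
  fixes F :: "('i \<Rightarrow> bool) \<Rightarrow> real" and L :: real
  assumes "finite S" "0 \<le> p" "p \<le> 1"
    and "\<And>f x. x \<in> S \<Longrightarrow> \<bar>F (f(x := True)) - F (f(x := False))\<bar> \<le> L"
  shows "bexpect p S (\<lambda>f. (F f)\<^sup>2) - (bexpect p S F)\<^sup>2 \<le> card S * (p * L\<^sup>2)"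
  using assms(1,4)
proof (induction S arbitrary: F rule: finite_induct)
  case empty
  then show ?case by (simp add: bexpect_empty)
next
  case (insert x S)
  let ?G = "\<lambda>f. F (f(x := True))" and ?H = "\<lambda>f. F (f(x := False))"
  let ?g = "bexpect p S ?G" and ?h = "bexpect p S ?H"
  have lip: "\<bar>F ((f(y := True))(x := b)) - F ((f(y := False))(x := b))\<bar> \<le> L"
    if "y \<in> S" for f y b
  proof -
    have "y \<noteq> x" using that insert by auto
    then have "(f(y := c))(x := b) = (f(x := b))(y := c)" for c by (rule fun_upd_twist)
    then show ?thesis using insert.prems[of y "f(x := b)"] that by (simp del: fun_upd_apply)
  qed
  have G: "bexpect p S (\<lambda>f. (?G f)\<^sup>2) - ?g\<^sup>2 \<le> card S * (p * L\<^sup>2)"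
    and H: "bexpect p S (\<lambda>f. (?H f)\<^sup>2) - ?h\<^sup>2 \<le> card S * (p * L\<^sup>2)"
    using insert.IH[of ?G] insert.IH[of ?H] lip by blast+
  have GH: "?g - ?h = bexpect p S (\<lambda>f. ?G f - ?H f)"
    using insert by (simp add: bexpect_diff)
  have d: "?G f - ?H f \<le> L \<and> - L \<le> ?G f - ?H f" for f
  proof -
    have "\<bar>?G f - ?H f\<bar> \<le> L" by (rule insert.prems) simp
    then show ?thesis by linarith
  qed
  have "?g - ?h \<le> L"
    unfolding GH using bexpect_mono[of S "\<lambda>f. ?G f - ?H f" "\<lambda>_. L" p] insert d
    by (simp add: bexpect_const)
  moreover have "- L \<le> ?g - ?h"
    unfolding GH using bexpect_mono[of S "\<lambda>_. - L" "\<lambda>f. ?G f - ?H f" p] insert d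
    by (simp add: bexpect_const)
  ultimately have "\<bar>?g - ?h\<bar> \<le> \<bar>L\<bar>" by linarith
  then have sq: "(?g - ?h)\<^sup>2 \<le> L\<^sup>2" by (simp only: abs_le_square_iff)
  have "bexpect p (insert x S) (\<lambda>f. (F f)\<^sup>2) - (bexpect p (insert x S) F)\<^sup>2
      = p * bexpect p S (\<lambda>f. (?G f)\<^sup>2) + (1 - p) * bexpect p S (\<lambda>f. (?H f)\<^sup>2)
         - (p * ?g + (1 - p) * ?h)\<^sup>2"
    using insert assms(2,3) by (simp add: bexpect_insert)
  \<comment> \<open>The law of total variance with respect to the indicator of \<open>x\<close>; the
    variance p(1 - p) of that indicator is then bounded by p.\<close>
  also have "\<dots> = p * (bexpect p S (\<lambda>f. (?G f)\<^sup>2) - ?g\<^sup>2)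
      + (1 - p) * (bexpect p S (\<lambda>f. (?H f)\<^sup>2) - ?h\<^sup>2) + p * (1 - p) * (?g - ?h)\<^sup>2"
    by (simp add: power2_eq_square algebra_simps)
  also have "\<dots> \<le> p * (card S * (p * L\<^sup>2)) + (1 - p) * (card S * (p * L\<^sup>2)) + p * 1 * L\<^sup>2"
    using G H sq assms(2,3) by (intro add_mono mult_left_mono mult_mono) auto
  also have "\<dots> = card (insert x S) * (p * L\<^sup>2)"
    using insert by (simp add: algebra_simps)
  finally show ?case .
qed

text \<open>A negative value lies at distance at least E F from the mean E F, so its probability is
  at most the variance over (E F)^2; a lower bound \<open>m\<close> for the mean is enough.\<close>

lemma bexpect_chebyshev:
  fixes F :: "('i \<Rightarrow> bool) \<Rightarrow> real" and L :: real
  assumes "finite S" "0 \<le> p" "p \<le> 1"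
    and "\<And>f x. x \<in> S \<Longrightarrow> \<bar>F (f(x := True)) - F (f(x := False))\<bar> \<le> L"
    and "0 < m" "m \<le> bexpect p S F"
  shows "bexpect p S (\<lambda>f. of_bool (F f < 0)) \<le> card S * (p * L\<^sup>2) / m\<^sup>2"
proof -
  let ?e = "bexpect p S F"
  have "bexpect p S (\<lambda>f. ?e\<^sup>2 * of_bool (F f < 0)) \<le> bexpect p S (\<lambda>f. (F f)\<^sup>2 - (2 * ?e * F f - ?e\<^sup>2))"
  proof (rule bexpect_mono[OF assms(1)])
    fix f
    have "?e\<^sup>2 \<le> (?e - F f)\<^sup>2" if "F f < 0"
      using that assms(5,6) by (intro power_mono) auto
    moreover have "(F f)\<^sup>2 - (2 * ?e * F f - ?e\<^sup>2) = (?e - F f)\<^sup>2"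
      by (simp add: power2_diff)
    ultimately show "?e\<^sup>2 * of_bool (F f < 0) \<le> (F f)\<^sup>2 - (2 * ?e * F f - ?e\<^sup>2)"
      by (auto simp: of_bool_def)
  qed
  also have "\<dots> = bexpect p S (\<lambda>f. (F f)\<^sup>2) - ?e\<^sup>2"
    using assms(1) by (simp add: bexpect_diff bexpect_cmult bexpect_const power2_eq_square)
  also have "\<dots> \<le> card S * (p * L\<^sup>2)"
    using assms(1-4) by (rule bexpect_variance_le)
  finally have *: "?e\<^sup>2 * bexpect p S (\<lambda>f. of_bool (F f < 0)) \<le> card S * (p * L\<^sup>2)"
    by (simp add: bexpect_cmult)
  have nn: "0 \<le> bexpect p S (\<lambda>f. of_bool (F f < 0))"
    using bexpect_mono[OF assms(1), of "\<lambda>_. 0" "\<lambda>f. of_bool (F f < 0)" p] by (simp add: bexpect_const)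
  have "m\<^sup>2 * bexpect p S (\<lambda>f. of_bool (F f < 0)) \<le> ?e\<^sup>2 * bexpect p S (\<lambda>f. of_bool (F f < 0))"
    using assms(5,6) nn by (intro mult_right_mono power_mono) auto
  with * show ?thesis using assms(5) by (simp add: field_simps)
qed

text \<open>In a random subset \<open>D\<^sub>f\<close> of \<open>D\<close>, the expectation of \<open>1 / card D\<^sub>f\<close> on the event \<open>e \<in> D\<^sub>f\<close>
  is the same for all \<open>e \<in> D\<close>, and these expectations add up to the probability that \<open>D\<^sub>f\<close> is
  not empty.\<close>

fun binomial_mean :: "real \<Rightarrow> nat \<Rightarrow> (nat \<Rightarrow> real) \<Rightarrow> real" where
  "binomial_mean p 0 h = h 0"
| "binomial_mean p (Suc k) h = p * binomial_mean p k (\<lambda>m. h (Suc m)) + (1 - p) * binomial_mean p k h"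

text \<open>The right-hand side is a mean under the binomial distribution, so it depends on
  \<open>D\<close> through its cardinality alone. This is the symmetry that makes the shares of
  different elements equal.\<close>

lemma bexpect_card:
  assumes "finite D" "0 \<le> p" "p \<le> 1"
  shows "bexpect p D (\<lambda>f. h (card {d \<in> D. f d})) = binomial_mean p (card D) h"
  using assms(1)
proof (induction D arbitrary: h rule: finite_induct)
  case empty
  then show ?case by (simp add: bexpect_empty)
next
  case (insert x D)
  have T: "{d \<in> insert x D. (f(x := True)) d} = insert x {d \<in> D. f d}" for f :: "'a \<Rightarrow> bool"
    using insert(2) by auto
  have F: "{d \<in> insert x D. (f(x := False)) d} = {d \<in> D. f d}" for f :: "'a \<Rightarrow> bool"
    using insert(2) by auto
  have "bexpect p (insert x D) (\<lambda>f. h (card {d \<in> insert x D. f d})) =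
    p * bexpect p D (\<lambda>f. h (Suc (card {d \<in> D. f d}))) + (1 - p) * bexpect p D (\<lambda>f. h (card {d \<in> D. f d}))"
    unfolding bexpect_insert[OF insert(1,2) assms(2,3)] T F using insert(1,2) by simp
  then show ?case
    using insert.IH[of h] insert.IH[of "\<lambda>m. h (Suc m)"] insert(1,2) by simp
qed

lemma bexpect_inverse_card:
  assumes S: "finite S" "D \<subseteq> S" and e: "e \<in> D" and p: "0 \<le> p" "p \<le> 1"
  shows "bexpect p S (\<lambda>f. of_bool (f e) / card {d \<in> D. f d}) = (1 - (1 - p) ^ card D) / card D"
proof -
  have D: "finite D" using S finite_subset by blast
  \<comment> \<open>\<open>e\<close> is present with probability p, and then the denominator is one
    more than a binomial count over the other elements.\<close>
  define m where "m = p * binomial_mean p (card D - 1) (\<lambda>k. 1 / Suc k)"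
  have eq: "bexpect p D (\<lambda>f. of_bool (f e) / card {d \<in> D. f d}) = m" if "e \<in> D" for e
  proof -
    define R where "R = D - {e}"
    have R: "D = insert e R" "e \<notin> R" "finite R" "card R = card D - 1"
      using that D by (auto simp: R_def)
    have T: "{d \<in> insert e R. (f(e := True)) d} = insert e {d \<in> R. f d}" for f :: "'a \<Rightarrow> bool"
      using R(2) by auto
    have "bexpect p (insert e R) (\<lambda>f. of_bool (f e) / card {d \<in> insert e R. f d})
        = p * bexpect p R (\<lambda>f. (\<lambda>k. 1 / Suc k) (card {d \<in> R. f d}))"
      unfolding bexpect_insert[OF R(3,2) p] T using R(2,3) by (simp add: bexpect_const)
    then show ?thesis unfolding m_def using R p bexpect_card[of R p "\<lambda>k. 1 / Suc k"] by simp
  qed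
  have "card D * m = (\<Sum>e\<in>D. bexpect p D (\<lambda>f. of_bool (f e) / card {d \<in> D. f d}))"
    using eq by simp
  also have "\<dots> = bexpect p D (\<lambda>f. \<Sum>e\<in>D. of_bool (f e) / card {d \<in> D. f d})"
    using D by (simp add: bexpect_sum)
  also have "\<dots> = bexpect p D (\<lambda>f. 1 - of_bool (\<forall>x\<in>D. \<not> f x))"
  proof (rule arg_cong[where f = "bexpect p D"], rule ext)
    fix f :: "'a \<Rightarrow> bool"
    have "(\<Sum>e\<in>D. of_bool (f e) / card {d \<in> D. f d}) = (\<Sum>e\<in>D. of_bool (f e)) / real (card {d \<in> D. f d})"
      by (simp add: sum_divide_distrib)
    also have "(\<Sum>e\<in>D. of_bool (f e)) = real (card {d \<in> D. f d})"
      using D by (simp add: Int_def)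
    finally show "(\<Sum>e\<in>D. of_bool (f e) / card {d \<in> D. f d}) = 1 - of_bool (\<forall>x\<in>D. \<not> f x)"
      using D by (auto simp: of_bool_def)
  qed
  also have "\<dots> = 1 - (1 - p) ^ card D"
    using D p by (simp add: bexpect_diff bexpect_const bexpect_all_False)
  finally have "card D * m = 1 - (1 - p) ^ card D" .
  moreover have "card D \<noteq> 0" using e D by auto
  ultimately have "m = (1 - (1 - p) ^ card D) / card D"
    by (simp add: field_simps)
  moreover have "bexpect p S (\<lambda>f. of_bool (f e) / card {d \<in> D. f d})
      = bexpect p D (\<lambda>f. of_bool (f e) / card {d \<in> D. f d})"
  proof (rule bexpect_cong_on[OF S p])
    fix f g :: "'a \<Rightarrow> bool" assume fg: "\<And>x. x \<in> D \<Longrightarrow> f x = g x"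
    then have "{d \<in> D. f d} = {d \<in> D. g d}" by auto
    then show "of_bool (f e) / real (card {d \<in> D. f d}) = of_bool (g e) / card {d \<in> D. g d}"
      using fg[OF e] by simp
  qed
  ultimately show ?thesis using eq[OF e] by simp
qed

section \<open>Vertex covers of random bipartite graphs\<close>

locale balanced_sides =
  fixes A B :: "'a set" and n :: nat
  assumes finite_sides: "finite A" "finite B" and disjoint_sides: "A \<inter> B = {}"
    and card_sides: "card A = n" "card B = n"
begin

definition vertex_cover :: "('a \<times> 'a \<Rightarrow> bool) \<Rightarrow> 'a set \<Rightarrow> bool" where
  "vertex_cover f K \<longleftrightarrow> K \<subseteq> A \<union> B \<and> (\<forall>u\<in>A. \<forall>v\<in>B. f (u, v) \<longrightarrow> u \<in> K \<or> v \<in> K)"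

definition cover_number :: "('a \<times> 'a \<Rightarrow> bool) \<Rightarrow> nat" where
  "cover_number f = Min (card ` {K. vertex_cover f K})"

definition touched :: "('a \<times> 'a \<Rightarrow> bool) \<Rightarrow> 'a set" where
  "touched f = {u \<in> A. \<exists>v\<in>B. f (u, v)} \<union> {v \<in> B. \<exists>u\<in>A. f (u, v)}"

definition excess :: "('a \<times> 'a \<Rightarrow> bool) \<Rightarrow> real" where
  "excess f = 4 * real (cover_number f) - real (card (touched f))"

text \<open>All possible edges meeting (u, v), itself included; if (u, v) is an edge, those present
  number deg u + deg v - 1.\<close>

fun star :: "'a \<times> 'a \<Rightarrow> ('a \<times> 'a) set" where
  "star (u, v) = {u} \<times> B \<union> A \<times> {v}"

definition weight :: "('a \<times> 'a \<Rightarrow> bool) \<Rightarrow> real" where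
  "weight f = (\<Sum>e\<in>A \<times> B. of_bool (f e) / card {d \<in> star e. f d})"

lemma finite_AB: "finite (A \<times> B)"
  using finite_sides by simp

lemma finite_covers: "finite {K. vertex_cover f K}"
  by (rule finite_subset[of _ "Pow (A \<union> B)"]) (use finite_sides in \<open>auto simp: vertex_cover_def\<close>)

lemma cover_number_attained: "\<exists>K. vertex_cover f K \<and> card K = cover_number f"
proof -
  have "vertex_cover f (A \<union> B)" by (simp add: vertex_cover_def)
  then have "Min (card ` {K. vertex_cover f K}) \<in> card ` {K. vertex_cover f K}"
    using finite_covers by (intro Min_in) auto
  then show ?thesis unfolding cover_number_def by auto
qed

lemma cover_number_le: "vertex_cover f K \<Longrightarrow> cover_number f \<le> card K"
  unfolding cover_number_def using finite_covers by (intro Min_le) auto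

text \<open>Weak duality: the weights form a fractional matching.\<close>

lemma weight_le_cover:
  assumes "vertex_cover f K"
  shows "weight f \<le> card K"
proof -
  have finK: "finite K"
    using assms finite_sides finite_subset[of K "A \<union> B"] by (auto simp: vertex_cover_def)
  let ?N = "\<lambda>u. {v \<in> B. f (u, v)}" and ?M = "\<lambda>v. {u \<in> A. f (u, v)}"
  \<comment> \<open>Each edge is charged to its endpoints in \<open>K\<close>. Its weight is at most
    the inverse degree of either endpoint, so a vertex of the cover is charged at most 1 in
    total.\<close>
  have bound: "of_bool (f (u, v)) / card {d \<in> star (u, v). f d}
      \<le> of_bool (u \<in> K) * (of_bool (f (u, v)) / card (?N u))
       + of_bool (v \<in> K) * (of_bool (f (u, v)) / card (?M v))" if "u \<in> A" "v \<in> B" for u v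
  proof (cases "f (u, v)")
    case True
    have fin: "finite {d \<in> star (u, v). f d}"
      using finite_sides by simp
    have "card (?N u) = card (Pair u ` ?N u)" by (simp add: card_image inj_on_def)
    also have "\<dots> \<le> card {d \<in> star (u, v). f d}" using fin by (intro card_mono) auto
    finally have 1: "card (?N u) \<le> card {d \<in> star (u, v). f d}" .
    have "card (?M v) = card ((\<lambda>u. (u, v)) ` ?M v)" by (simp add: card_image inj_on_def)
    also have "\<dots> \<le> card {d \<in> star (u, v). f d}" using fin by (intro card_mono) auto
    finally have 2: "card (?M v) \<le> card {d \<in> star (u, v). f d}" .
    have "0 < card (?N u)" "0 < card (?M v)"
      using that True finite_sides by (auto simp: card_gt_0_iff)
    then have "1 / real (card {d \<in> star (u, v). f d}) \<le> 1 / card (?N u)"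
      "1 / real (card {d \<in> star (u, v). f d}) \<le> 1 / card (?M v)"
      "0 \<le> 1 / real (card (?N u))" "0 \<le> 1 / real (card (?M v))"
      using 1 2 by (auto simp: frac_le)
    moreover have "u \<in> K \<or> v \<in> K" using assms that True unfolding vertex_cover_def by blast
    ultimately show ?thesis
      using True by (cases "u \<in> K"; cases "v \<in> K"; simp del: star.simps; linarith)
  qed simp
  \<comment> \<open>An isolated vertex gives 0 / 0 = 0, hence an inequality only.\<close>
  have row: "(\<Sum>v\<in>B. of_bool (f (u, v)) / card (?N u)) \<le> (1 :: real)" for u
  proof -
    have "(\<Sum>v\<in>B. of_bool (f (u, v)) / real (card (?N u))) = real (card (?N u)) / card (?N u)"
      unfolding sum_divide_distrib[symmetric] using finite_sides by (simp add: Int_def)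
    then show ?thesis by simp
  qed
  have col: "(\<Sum>u\<in>A. of_bool (f (u, v)) / card (?M v)) \<le> (1 :: real)" for v
  proof -
    have "(\<Sum>u\<in>A. of_bool (f (u, v)) / real (card (?M v))) = real (card (?M v)) / card (?M v)"
      unfolding sum_divide_distrib[symmetric] using finite_sides by (simp add: Int_def)
    then show ?thesis by simp
  qed
  have "weight f = (\<Sum>u\<in>A. \<Sum>v\<in>B. of_bool (f (u, v)) / card {d \<in> star (u, v). f d})"
    unfolding weight_def by (simp add: sum.cartesian_product case_prod_beta del: star.simps)
  also have "\<dots> \<le> (\<Sum>u\<in>A. \<Sum>v\<in>B. of_bool (u \<in> K) * (of_bool (f (u, v)) / card (?N u))
       + of_bool (v \<in> K) * (of_bool (f (u, v)) / card (?M v)))"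
    by (intro sum_mono bound)
  also have "\<dots> = (\<Sum>u\<in>A. of_bool (u \<in> K) * (\<Sum>v\<in>B. of_bool (f (u, v)) / card (?N u)))
      + (\<Sum>v\<in>B. of_bool (v \<in> K) * (\<Sum>u\<in>A. of_bool (f (u, v)) / card (?M v)))"
    unfolding sum.distrib sum_distrib_left by (subst (2) sum.swap) (rule refl)
  also have "\<dots> \<le> (\<Sum>u\<in>A. of_bool (u \<in> K) * 1) + (\<Sum>v\<in>B. of_bool (v \<in> K) * 1)"
    using row col by (intro add_mono sum_mono mult_left_mono) auto
  also have "\<dots> = real (card (A \<inter> K)) + card (B \<inter> K)"
    using finite_sides by (simp add: Int_def)
  also have "\<dots> = card ((A \<inter> K) \<union> (B \<inter> K))"
    using finite_sides disjoint_sides by (subst card_Un_disjoint) auto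
  also have "\<dots> \<le> card K"
    using finK by (auto intro!: card_mono)
  finally show ?thesis .
qed

text \<open>A new edge raises the cover number by at most 1 and the number of touched vertices by at
  most 2, and lowers neither, so the excess changes by an amount between -2 and 4.\<close>

lemma excess_lipschitz:
  assumes "e \<in> A \<times> B"
  shows "\<bar>excess (f(e := True)) - excess (f(e := False))\<bar> \<le> 4"
proof -
  obtain u v where e: "e = (u, v)" "u \<in> A" "v \<in> B" using assms by auto
  let ?t = "f(e := True)" and ?f = "f(e := False)"
  obtain K where K: "vertex_cover ?t K" "card K = cover_number ?t"
    using cover_number_attained by blast
  have "vertex_cover ?f K" using K(1) unfolding vertex_cover_def by (auto split: if_splits)
  then have c1: "cover_number ?f \<le> cover_number ?t" using cover_number_le K(2) by metis
  obtain K' where K': "vertex_cover ?f K'" "card K' = cover_number ?f"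
    using cover_number_attained by blast
  have "vertex_cover ?t (insert u K')"
    using K'(1) e unfolding vertex_cover_def by (auto split: if_splits)
  then have "cover_number ?t \<le> card (insert u K')" by (rule cover_number_le)
  also have "\<dots> \<le> Suc (card K')" by (rule card_insert_le_m1) simp_all
  finally have c2: "cover_number ?t \<le> Suc (cover_number ?f)" using K'(2) by simp
  have fin: "finite (touched g)" for g unfolding touched_def using finite_sides by simp
  have "touched ?f \<subseteq> touched ?t" unfolding touched_def by (auto split: if_splits)
  then have t1: "card (touched ?f) \<le> card (touched ?t)" using fin by (intro card_mono)
  have "touched ?t \<subseteq> insert u (insert v (touched ?f))"
    unfolding touched_def e(1) by (auto split: if_splits)
  then have "card (touched ?t) \<le> card (insert u (insert v (touched ?f)))"
    using fin by (intro card_mono) auto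
  also have "\<dots> \<le> card (touched ?f) + 2"
    using fin[of ?f] by (simp add: card_insert_if)
  finally have t2: "card (touched ?t) \<le> card (touched ?f) + 2" .
  show ?thesis unfolding excess_def using c1 c2 t1 t2 by linarith
qed

section \<open>The expected excess\<close>

lemma card_touched:
  "real (card (touched f)) = (\<Sum>u\<in>A. 1 - of_bool (\<forall>x\<in>{u} \<times> B. \<not> f x))
     + (\<Sum>v\<in>B. 1 - of_bool (\<forall>x\<in>A \<times> {v}. \<not> f x))"
proof -
  have "card (touched f) = card {u \<in> A. \<exists>v\<in>B. f (u, v)} + card {v \<in> B. \<exists>u\<in>A. f (u, v)}"
    unfolding touched_def using finite_sides disjoint_sides by (subst card_Un_disjoint) auto
  moreover have "(\<Sum>u\<in>A. 1 - of_bool (\<forall>x\<in>{u} \<times> B. \<not> f x)) = (\<Sum>u\<in>A. of_bool (\<exists>v\<in>B. f (u, v)) :: real)"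
    by (intro sum.cong) (auto simp: of_bool_def)
  moreover have "(\<Sum>v\<in>B. 1 - of_bool (\<forall>x\<in>A \<times> {v}. \<not> f x)) = (\<Sum>v\<in>B. of_bool (\<exists>u\<in>A. f (u, v)) :: real)"
    by (intro sum.cong) (auto simp: of_bool_def)
  ultimately show ?thesis using finite_sides by (simp add: Int_def)
qed

lemma bexpect_touched:
  fixes p :: real
  assumes "0 \<le> p" "p \<le> 1"
  shows "bexpect p (A \<times> B) (\<lambda>f. real (card (touched f))) = 2 * n * (1 - (1 - p) ^ n)"
proof -
  have r: "bexpect p (A \<times> B) (\<lambda>f. 1 - of_bool (\<forall>x\<in>{u} \<times> B. \<not> f x)) = 1 - (1 - p) ^ n" if "u \<in> A" for u
  proof -
    have "bexpect p (A \<times> B) (\<lambda>f. of_bool (\<forall>x\<in>{u} \<times> B. \<not> f x)) = (1 - p) ^ card ({u} \<times> B)"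
      using that finite_AB assms by (intro bexpect_all_False) auto
    moreover have "card ({u} \<times> B) = n" using card_sides by (simp add: card_cartesian_product)
    ultimately show ?thesis unfolding bexpect_diff[OF finite_AB] bexpect_const by (simp only:)
  qed
  have c: "bexpect p (A \<times> B) (\<lambda>f. 1 - of_bool (\<forall>x\<in>A \<times> {v}. \<not> f x)) = 1 - (1 - p) ^ n" if "v \<in> B" for v
  proof -
    have "bexpect p (A \<times> B) (\<lambda>f. of_bool (\<forall>x\<in>A \<times> {v}. \<not> f x)) = (1 - p) ^ card (A \<times> {v})"
      using that finite_AB assms by (intro bexpect_all_False) auto
    moreover have "card (A \<times> {v}) = n" using card_sides by (simp add: card_cartesian_product)
    ultimately show ?thesis unfolding bexpect_diff[OF finite_AB] bexpect_const by (simp only:)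
  qed
  have "bexpect p (A \<times> B) (\<lambda>f. real (card (touched f)))
     = (\<Sum>u\<in>A. 1 - (1 - p) ^ n) + (\<Sum>v\<in>B. 1 - (1 - p) ^ n)"
    unfolding card_touched using finite_AB r c by (simp add: bexpect_add bexpect_sum)
  then show ?thesis using card_sides by (simp add: algebra_simps)
qed

lemma card_star:
  assumes "e \<in> A \<times> B"
  shows "card (star e) = 2 * n - 1" "star e \<subseteq> A \<times> B"
proof -
  obtain u v where e: "e = (u, v)" "u \<in> A" "v \<in> B" using assms by auto
  have "({u} \<times> B) \<inter> (A \<times> {v}) = {(u, v)}" using e by auto
  then have "card ({u} \<times> B \<union> A \<times> {v}) + 1 = card ({u} \<times> B) + card (A \<times> {v})"
    using card_Un_Int[of "{u} \<times> B" "A \<times> {v}"] finite_sides by simp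
  then show "card (star e) = 2 * n - 1" using e card_sides by (simp add: card_cartesian_product)
  show "star e \<subseteq> A \<times> B" using e by auto
qed

lemma bexpect_weight:
  fixes p :: real
  assumes "0 \<le> p" "p \<le> 1"
  shows "bexpect p (A \<times> B) weight = n\<^sup>2 * ((1 - (1 - p) ^ (2 * n - 1)) / real (2 * n - 1))"
proof -
  have e: "bexpect p (A \<times> B) (\<lambda>f. of_bool (f e) / card {d \<in> star e. f d})
      = (1 - (1 - p) ^ (2 * n - 1)) / real (2 * n - 1)" if "e \<in> A \<times> B" for e
  proof -
    have "e \<in> star e" using that by auto
    then show ?thesis
      using bexpect_inverse_card[OF finite_AB card_star(2)[OF that] _ assms] card_star(1)[OF that] by simp
  qed
  have "bexpect p (A \<times> B) weight
      = (\<Sum>e\<in>A \<times> B. bexpect p (A \<times> B) (\<lambda>f. of_bool (f e) / card {d \<in> star e. f d}))"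
    unfolding weight_def[abs_def] by (rule bexpect_sum[OF finite_AB])
  also have "\<dots> = real (card (A \<times> B)) * ((1 - (1 - p) ^ (2 * n - 1)) / real (2 * n - 1))"
    using e by simp
  finally show ?thesis using card_sides by (simp add: card_cartesian_product power2_eq_square)
qed

text \<open>With q = 1 - p, weak duality and n^2 / (2n - 1) \<ge> n/2 give at least 2n(1 - q^(2n-1))
  for four times the mean cover number, while the touched vertices have mean 2n(1 - q^n). The gap is
  the stated bound.\<close>

lemma bexpect_excess_ge:
  fixes p :: real
  assumes "0 \<le> p" "p \<le> 1" "0 < n"
  shows "2 * n * (1 - p) ^ n * (1 - (1 - p) ^ (n - 1)) \<le> bexpect p (A \<times> B) excess"
proof -
  let ?q = "1 - p"
  have "4 * weight f - card (touched f) \<le> excess f" for f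
    using cover_number_attained[of f] weight_le_cover[of f] unfolding excess_def by force
  then have 1: "bexpect p (A \<times> B) (\<lambda>f. 4 * weight f - card (touched f)) \<le> bexpect p (A \<times> B) excess"
    by (intro bexpect_mono finite_AB)
  have 2: "bexpect p (A \<times> B) (\<lambda>f. 4 * weight f - card (touched f))
      = 4 * (n\<^sup>2 * ((1 - ?q ^ (2 * n - 1)) / real (2 * n - 1))) - 2 * n * (1 - ?q ^ n)"
    using finite_AB assms
    by (simp add: bexpect_diff bexpect_cmult bexpect_touched bexpect_weight)
  have 3: "2 * n * (1 - ?q ^ (2 * n - 1)) \<le> 4 * (n\<^sup>2 * ((1 - ?q ^ (2 * n - 1)) / real (2 * n - 1)))"
  proof -
    have q: "0 \<le> 1 - ?q ^ (2 * n - 1)" using assms by (simp add: power_le_one)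
    have r: "0 < real (2 * n - 1)" "real (2 * n - 1) \<le> 2 * real n"
      using assms(3) by (simp_all add: of_nat_diff)
    have "2 * real n * real (2 * n - 1) \<le> 2 * real n * (2 * real n)"
      using r(2) by (rule mult_left_mono) simp
    then have "2 * real n \<le> 4 * (real n)\<^sup>2 / real (2 * n - 1)"
      using r(1) by (simp add: pos_le_divide_eq power2_eq_square)
    from mult_right_mono[OF this q] show ?thesis by simp
  qed
  have "2 * n * ?q ^ n * (1 - ?q ^ (n - 1)) = 2 * n * (1 - ?q ^ (2 * n - 1)) - 2 * n * (1 - ?q ^ n)"
  proof -
    have "2 * n - 1 = n + (n - 1)" using assms(3) by simp
    then have "?q ^ (2 * n - 1) = ?q ^ n * ?q ^ (n - 1)" by (simp only: power_add)
    then show ?thesis by (simp add: algebra_simps)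
  qed
  also note diff_right_mono[OF 3]
  also note 2[symmetric]
  also note 1
  finally show ?thesis .
qed

section \<open>Failure probability in the three density ranges\<close>

definition fail_prob :: "real \<Rightarrow> real" where
  "fail_prob p = bexpect p (A \<times> B) (\<lambda>f. of_bool (excess f < 0))"

text \<open>Very sparse graphs are matchings.\<close>

lemma fail_prob_sparse:
  fixes p :: real
  assumes p: "0 \<le> p" "p \<le> 1"
  shows "fail_prob p \<le> 2 * real n ^ 3 * p\<^sup>2"
proof -
  \<comment> \<open>Ordered pairs of distinct possible edges with a common endpoint: n^2 choices for
    one, fewer than 2n for the other.\<close>
  define P where "P = (SIGMA e:A \<times> B. star e - {e})"
  have finP: "finite P" unfolding P_def using finite_AB finite_sides by auto
  have cardP: "real (card P) \<le> 2 * real n ^ 3"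
  proof -
    have "card P = (\<Sum>e\<in>A \<times> B. card (star e - {e}))"
      unfolding P_def using finite_AB finite_sides by (intro card_SigmaI) auto
    also have "\<dots> \<le> (\<Sum>e\<in>A \<times> B. 2 * n)"
    proof (rule sum_mono)
      fix e assume e: "e \<in> A \<times> B"
      have "card (star e - {e}) \<le> card (star e)" by (rule card_Diff1_le)
      then show "card (star e - {e}) \<le> 2 * n" using card_star(1)[OF e] by simp
    qed
    also have "\<dots> = 2 * n ^ 3" using card_sides by (simp add: card_cartesian_product power3_eq_cube)
    finally have "real (card P) \<le> real (2 * n ^ 3)" by (simp only: of_nat_le_iff)
    then show ?thesis by simp
  qed
  have "fail_prob p \<le> bexpect p (A \<times> B) (\<lambda>f. \<Sum>x\<in>P. of_bool (f (fst x) \<and> f (snd x)))"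
    unfolding fail_prob_def
  proof (rule bexpect_mono[OF finite_AB])
    fix f :: "'a \<times> 'a \<Rightarrow> bool"
    show "of_bool (excess f < 0) \<le> (\<Sum>x\<in>P. of_bool (f (fst x) \<and> f (snd x)) :: real)"
    proof (cases "\<exists>x\<in>P. f (fst x) \<and> f (snd x)")
      case True
      then obtain x where x: "x \<in> P" "f (fst x) \<and> f (snd x)" by blast
      have "1 = (of_bool (f (fst x) \<and> f (snd x)) :: real)" using x by simp
      also have "\<dots> \<le> (\<Sum>x\<in>P. of_bool (f (fst x) \<and> f (snd x)))"
        using x(1) finP by (intro member_le_sum) auto
      finally show ?thesis by (auto simp: of_bool_def)
    next
      case False
      \<comment> \<open>In a matching every edge has weight 1, so the cover number is at least
        \<open>card Q\<close>, while at most \<open>2 * card Q\<close> vertices are touched.\<close>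
      define Q where "Q = {e \<in> A \<times> B. f e}"
      have "{d \<in> star e. f d} = {e}" if "e \<in> Q" for e
        using that False unfolding Q_def P_def by fastforce
      then have "weight f = (\<Sum>e\<in>A \<times> B. of_bool (f e))"
        unfolding weight_def by (intro sum.cong) (auto simp: Q_def of_bool_def simp del: star.simps)
      also have "\<dots> = card Q" unfolding Q_def using finite_AB by (simp add: Int_def)
      finally have "card Q \<le> cover_number f"
        using cover_number_attained[of f] weight_le_cover[of f] by force
      have finQ: "finite Q" unfolding Q_def using finite_AB by simp
      have "touched f = fst ` Q \<union> snd ` Q" unfolding touched_def Q_def by force
      then have "card (touched f) \<le> card (fst ` Q) + card (snd ` Q)" by (simp add: card_Un_le)
      also have "\<dots> \<le> card Q + card Q" using finQ by (intro add_mono card_image_le)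
      finally have "0 \<le> excess f" using \<open>card Q \<le> cover_number f\<close> unfolding excess_def by linarith
      then show ?thesis by (simp add: sum_nonneg)
    qed
  qed
  also have "\<dots> = (\<Sum>x\<in>P. bexpect p (A \<times> B) (\<lambda>f. of_bool (f (fst x) \<and> f (snd x))))"
    by (rule bexpect_sum[OF finite_AB])
  also have "\<dots> = (\<Sum>x\<in>P. p\<^sup>2)"
  proof (rule sum.cong[OF refl])
    fix x assume "x \<in> P"
    then have "fst x \<in> A \<times> B" "snd x \<in> A \<times> B" "fst x \<noteq> snd x"
      using card_star(2)[of "fst x"] unfolding P_def by auto
    then show "bexpect p (A \<times> B) (\<lambda>f. of_bool (f (fst x) \<and> f (snd x))) = p\<^sup>2"
      using finite_AB p by (intro bexpect_two_True)
  qed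
  also have "\<dots> = real (card P) * p\<^sup>2" by simp
  also have "\<dots> \<le> 2 * real n ^ 3 * p\<^sup>2"
    using cardP by (rule mult_right_mono) simp
  finally show ?thesis .
qed

text \<open>As n \<ge> 12 forces p \<le> 1/2, 1 - p \<ge> exp(-2p) gives (1 - p)^n \<ge> exp(-12).
  With y = (n - 1)p \<le> 6, 1 - (1 - p)^(n-1) \<ge> y/(1 + y) \<ge> y/7 \<ge> np/14. So the mean
  excess is at least m = n^2 p exp(-12) / 7, and 16 n^2 p / m^2 produces 784 = 16 * 49.\<close>

lemma fail_prob_medium:
  fixes p :: real
  assumes p: "0 < p" and np: "n * p \<le> 6" and n: "12 \<le> n"
  shows "fail_prob p \<le> 784 * exp 24 / (n\<^sup>2 * p)"
proof -
  have p2: "p \<le> 1 / 2"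
  proof -
    have "12 * p \<le> n * p" using n p by (intro mult_right_mono) auto
    then show ?thesis using np by simp
  qed
  have "exp (- 12) \<le> (exp (- 2 * p)) ^ n"
    using np by (simp add: exp_of_nat_mult[symmetric] algebra_simps)
  also have "exp (- 2 * p) \<le> 1 - p"
  proof -
    have "1 \<le> (1 - p) * (1 + 2 * p)" using p p2 by (simp add: algebra_simps mult_left_mono)
    also have "\<dots> \<le> (1 - p) * exp (2 * p)" using p2 by (intro mult_left_mono) auto
    finally show ?thesis by (simp add: exp_minus field_simps)
  qed
  then have "(exp (- 2 * p)) ^ n \<le> (1 - p) ^ n" by (intro power_mono) auto
  finally have qn: "exp (- 12) \<le> (1 - p) ^ n" .
  define y where "y = real (n - 1) * p"
  have y: "0 < y" "y \<le> 6" "n * p / 2 \<le> y"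
  proof -
    show "0 < y" using p n by (simp add: y_def)
    have "y \<le> n * p" unfolding y_def using p by (intro mult_right_mono) auto
    then show "y \<le> 6" using np by simp
    have "n / 2 * p \<le> y" unfolding y_def using n p by (intro mult_right_mono) (auto simp: of_nat_diff)
    then show "n * p / 2 \<le> y" by simp
  qed
  have "(1 - p) ^ (n - 1) \<le> (exp (- p)) ^ (n - 1)"
    using p2 exp_ge_add_one_self[of "- p"] by (intro power_mono) auto
  also have "\<dots> = exp (- y)" unfolding y_def by (simp add: exp_of_nat_mult[symmetric])
  also have "\<dots> \<le> 1 / (1 + y)"
    using y(1) exp_ge_add_one_self[of y] by (simp add: exp_minus field_simps)
  finally have "1 - 1 / (1 + y) \<le> 1 - (1 - p) ^ (n - 1)" by simp
  moreover have "y / 7 \<le> 1 - 1 / (1 + y)"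
  proof -
    have "1 - 1 / (1 + y) = y / (1 + y)" using y(1) by (simp add: field_simps)
    also have "y / 7 \<le> \<dots>" using y(1,2) by (intro divide_left_mono) auto
    finally show ?thesis .
  qed
  ultimately have q1: "n * p / 14 \<le> 1 - (1 - p) ^ (n - 1)" using y(3) by linarith
  define m where "m = n\<^sup>2 * p / 7 * exp (- 12)"
  have "m = 2 * n * exp (- 12) * (n * p / 14)"
    by (simp add: m_def power2_eq_square)
  also have "\<dots> \<le> 2 * n * (1 - p) ^ n * (1 - (1 - p) ^ (n - 1))"
    using qn q1 p p2 by (intro mult_mono) auto
  also have "\<dots> \<le> bexpect p (A \<times> B) excess"
    using p p2 n by (intro bexpect_excess_ge) auto
  finally have m: "m \<le> bexpect p (A \<times> B) excess" .
  have m0: "0 < m" using p n by (simp add: m_def)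
  have "fail_prob p \<le> card (A \<times> B) * (p * 4\<^sup>2) / m\<^sup>2"
    unfolding fail_prob_def using p p2 m m0 finite_AB excess_lipschitz
    by (intro bexpect_chebyshev) auto
  also have "\<dots> = n\<^sup>2 * p * 16 / m\<^sup>2"
    using card_sides by (simp add: card_cartesian_product power2_eq_square)
  also have "m\<^sup>2 = (n\<^sup>2 * p)\<^sup>2 / (49 * exp 24)"
    unfolding m_def by (simp add: power_mult_distrib power_divide exp_minus exp_of_nat_mult[symmetric] power2_eq_square field_simps exp_add[symmetric])
  also have "n\<^sup>2 * p * 16 / ((n\<^sup>2 * p)\<^sup>2 / (49 * exp 24)) = 784 * exp 24 / (n\<^sup>2 * p)"
    using p n by (simp add: power2_eq_square)
  finally show ?thesis .
qed

text \<open>A negative excess needs a cover \<open>K\<close> with fewer than n/2 vertices, and then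
  no edge joins A - K to B - K, which span at least n^2/2 pairs. The threshold 6 makes this as
  unlikely as exp(-3n) \<le> 8^(-n), which beats the at most 4^n choices of
  \<open>K\<close>.\<close>

lemma fail_prob_dense:
  fixes p :: real
  assumes p: "p \<le> 1" and np: "6 \<le> n * p"
  shows "fail_prob p \<le> (1 / 2) ^ n"
proof -
  have n0: "0 < n" using np by (cases n) auto
  have p0: "0 \<le> p" using np n0 by (smt (verit) mult_nonneg_nonpos of_nat_0_le_iff)
  define KS where "KS = {K \<in> Pow (A \<union> B). 2 * card K < n}"
  have finKS: "finite KS" unfolding KS_def using finite_sides by simp
  have "fail_prob p \<le> bexpect p (A \<times> B) (\<lambda>f. \<Sum>K\<in>KS. of_bool (\<forall>x\<in>(A - K) \<times> (B - K). \<not> f x))"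
    unfolding fail_prob_def
  proof (rule bexpect_mono[OF finite_AB])
    fix f :: "'a \<times> 'a \<Rightarrow> bool"
    show "of_bool (excess f < 0) \<le> (\<Sum>K\<in>KS. of_bool (\<forall>x\<in>(A - K) \<times> (B - K). \<not> f x) :: real)"
    proof (cases "excess f < 0")
      case True
      obtain K where K: "vertex_cover f K" "card K = cover_number f"
        using cover_number_attained by blast
      have "card (touched f) \<le> card (A \<union> B)"
        using finite_sides by (intro card_mono) (auto simp: touched_def)
      also have "\<dots> \<le> 2 * n" using card_Un_le[of A B] card_sides by simp
      finally have "K \<in> KS"
        using True K unfolding KS_def excess_def vertex_cover_def by auto
      moreover have "\<forall>x\<in>(A - K) \<times> (B - K). \<not> f x" using K(1) unfolding vertex_cover_def by auto
      ultimately have "1 = (of_bool (\<forall>x\<in>(A - K) \<times> (B - K). \<not> f x) :: real)" by simp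
      also have "\<dots> \<le> (\<Sum>K\<in>KS. of_bool (\<forall>x\<in>(A - K) \<times> (B - K). \<not> f x))"
        using \<open>K \<in> KS\<close> finKS
        by (intro member_le_sum[where f = "\<lambda>K. of_bool (\<forall>x\<in>(A - K) \<times> (B - K). \<not> f x)"]) auto
      finally show ?thesis using True by simp
    qed (simp add: sum_nonneg)
  qed
  also have "\<dots> = (\<Sum>K\<in>KS. bexpect p (A \<times> B) (\<lambda>f. of_bool (\<forall>x\<in>(A - K) \<times> (B - K). \<not> f x)))"
    by (rule bexpect_sum[OF finite_AB])
  also have "\<dots> \<le> (\<Sum>K\<in>KS. (1 / 8) ^ n)"
  proof (rule sum_mono)
    fix K assume K: "K \<in> KS"
    then have finK: "finite K" using finite_sides finite_subset[of K "A \<union> B"] by (auto simp: KS_def)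
    let ?a = "card (A \<inter> K)" and ?b = "card (B \<inter> K)"
    have "card ((A \<inter> K) \<union> (B \<inter> K)) = ?a + ?b"
      using finite_sides disjoint_sides by (intro card_Un_disjoint) auto
    moreover have "card ((A \<inter> K) \<union> (B \<inter> K)) \<le> card K"
      using finK by (intro card_mono) auto
    ultimately have ab: "2 * (real ?a + real ?b) \<le> n" using K unfolding KS_def by auto
    have cA: "card (A - K) = n - ?a" "?a \<le> n"
      using finite_sides card_sides card_mono[of A "A \<inter> K"] by (auto simp: card_Diff_subset_Int Int_commute)
    have cB: "card (B - K) = n - ?b" "?b \<le> n"
      using finite_sides card_sides card_mono[of B "B \<inter> K"] by (auto simp: card_Diff_subset_Int Int_commute)
    have "real n * n / 2 = real n * n - real n * (n / 2)" by simp
    also have "\<dots> \<le> real n * n - real n * (real ?a + real ?b)"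
      using ab by (intro diff_left_mono mult_left_mono) auto
    also have "\<dots> \<le> real n * n - real n * (real ?a + real ?b) + real ?a * real ?b" by simp
    also have "\<dots> = (real n - ?a) * (real n - ?b)" by (simp add: algebra_simps)
    also have "\<dots> = card ((A - K) \<times> (B - K))"
      using cA cB by (simp add: card_cartesian_product of_nat_diff)
    finally have c: "real n * n / 2 \<le> card ((A - K) \<times> (B - K))" .
    have "bexpect p (A \<times> B) (\<lambda>f. of_bool (\<forall>x\<in>(A - K) \<times> (B - K). \<not> f x))
       = (1 - p) ^ card ((A - K) \<times> (B - K))"
      using finite_AB p0 p by (intro bexpect_all_False) auto
    also have "\<dots> \<le> exp (- p) ^ card ((A - K) \<times> (B - K))"
      using p exp_ge_add_one_self[of "- p"] by (intro power_mono) auto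
    also have "\<dots> = exp (- (p * card ((A - K) \<times> (B - K))))"
      by (simp add: exp_of_nat_mult[symmetric] mult.commute)
    also have "\<dots> \<le> exp (- (real n * 3))"
    proof -
      have "real n * 6 \<le> real n * (n * p)" using np by (intro mult_left_mono) auto
      moreover have "p * (real n * n / 2) \<le> p * card ((A - K) \<times> (B - K))"
        using c p0 by (rule mult_left_mono)
      ultimately show ?thesis by (simp add: algebra_simps)
    qed
    also have "\<dots> = (exp (- 3)) ^ n" by (simp add: exp_of_nat_mult[symmetric])
    also have "\<dots> \<le> (1 / 8) ^ n"
    proof (intro power_mono)
      have "(2 :: real) ^ 3 \<le> exp 1 ^ 3" using exp_ge_add_one_self[of 1] by (intro power_mono) auto
      also have "exp 1 ^ 3 = exp (3 :: real)" by (simp add: exp_of_nat_mult[symmetric])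
      finally show "exp (- 3) \<le> 1 / (8 :: real)" by (simp add: exp_minus field_simps)
    qed simp
    finally show "bexpect p (A \<times> B) (\<lambda>f. of_bool (\<forall>x\<in>(A - K) \<times> (B - K). \<not> f x)) \<le> (1 / 8) ^ n" .
  qed
  also have "\<dots> = card KS * (1 / 8) ^ n" by simp
  also have "\<dots> \<le> 4 ^ n * (1 / 8) ^ n"
  proof (rule mult_right_mono)
    have "card KS \<le> card (Pow (A \<union> B))" using finite_sides by (intro card_mono) (auto simp: KS_def)
    also have "\<dots> = 2 ^ card (A \<union> B)" using finite_sides by (simp add: card_Pow)
    also have "\<dots> \<le> 2 ^ (2 * n)" using card_Un_le[of A B] card_sides by (intro power_increasing) auto
    also have "\<dots> = 4 ^ n" by (simp add: power_mult)
    finally have "real (card KS) \<le> real (4 ^ n)" by (simp only: of_nat_le_iff)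
    then show "real (card KS) \<le> 4 ^ n" by simp
  qed simp
  also have "\<dots> = (1 / 2) ^ n" by (simp add: power_mult_distrib[symmetric])
  finally show ?thesis .
qed

text \<open>In terms of t = n^2 p the sparse bound is 2t^2/n and the medium one a constant over t,
  so the ranges may be separated at any threshold that tends to infinity more slowly than the square
  root of n; the fourth root is one choice.\<close>

lemma fail_prob_le:
  fixes p :: real
  assumes p: "0 \<le> p" "p \<le> 1" and n: "12 \<le> n"
  shows "fail_prob p \<le> 2 / sqrt n + 784 * exp 24 / sqrt (sqrt n) + (1 / 2) ^ n"
proof -
  have n0: "0 < real n" using n by simp
  have nn: "0 \<le> 2 / sqrt n" "0 \<le> 784 * exp 24 / sqrt (sqrt n)" "0 \<le> (1 / 2 :: real) ^ n"
    by simp_all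
  consider "n\<^sup>2 * p \<le> sqrt (sqrt n)" | "sqrt (sqrt n) < n\<^sup>2 * p" "n * p \<le> 6" | "6 \<le> n * p"
    by linarith
  then show ?thesis
  proof cases
    case 1
    have "real n * (2 * real n ^ 3 * p\<^sup>2) = 2 * (n\<^sup>2 * p)\<^sup>2" by (simp add: power2_eq_square power3_eq_cube)
    also have "\<dots> \<le> 2 * (sqrt (sqrt n))\<^sup>2" using 1 p by (intro mult_left_mono power_mono) auto
    also have "\<dots> = 2 * sqrt n" by simp
    finally have "2 * real n ^ 3 * p\<^sup>2 \<le> 2 * sqrt n / n" using n0 by (simp add: field_simps)
    also have "\<dots> = 2 / sqrt n" using n0 by (simp add: field_simps)
    finally show ?thesis using fail_prob_sparse[OF p] nn by linarith
  next
    case 2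
    have "0 \<le> sqrt (sqrt n)" by simp
    then have "0 < real (n\<^sup>2) * p" using 2(1) by (rule le_less_trans)
    then have p0: "0 < p" using n0 by (simp add: zero_less_mult_iff)
    then have "fail_prob p \<le> 784 * exp 24 / (n\<^sup>2 * p)" using 2 n by (intro fail_prob_medium) auto
    also have "\<dots> \<le> 784 * exp 24 / sqrt (sqrt n)" using 2 n0 p0 by (intro divide_left_mono mult_pos_pos) auto
    finally show ?thesis using nn by linarith
  next
    case 3
    then show ?thesis using fail_prob_dense[OF p(2)] nn by linarith
  qed
qed

end

section \<open>From failure probabilities to the asymptotic statement\<close>

lemma (in balanced_sides) prob_excess_nonneg:
  assumes "0 \<le> p" "p \<le> 1"
  shows "measure_pmf.prob (Pi_pmf (A \<times> B) False (\<lambda>_. bernoulli_pmf p)) {f. 0 \<le> excess f}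
    = 1 - fail_prob p"
proof -
  let ?M = "Pi_pmf (A \<times> B) False (\<lambda>_. bernoulli_pmf p)"
  have "measure_pmf.prob ?M {f. excess f < 0} = measure_pmf.expectation ?M (indicator {f. excess f < 0})"
    by simp
  also have "(indicator {f. excess f < 0} :: _ \<Rightarrow> real) = (\<lambda>f. of_bool (excess f < 0))"
    by (auto simp: indicator_def)
  finally have "measure_pmf.prob ?M {f. excess f < 0} = fail_prob p"
    unfolding fail_prob_def bexpect_def .
  moreover have "{f. 0 \<le> excess f} = space ?M - {f. excess f < 0}" by auto
  ultimately show ?thesis using measure_pmf.prob_compl[of "{f. excess f < 0}" ?M] by simp
qed

lemma fail_bound_tendsto_0:
  "(\<lambda>n. 2 / sqrt (real n) + 784 * exp 24 / sqrt (sqrt (real n)) + (1 / 2) ^ n) \<longlonglongrightarrow> 0"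
proof -
  have s: "filterlim (\<lambda>n. sqrt (real n)) at_top sequentially"
    by (rule filterlim_compose[OF sqrt_at_top filterlim_real_sequentially])
  have "(\<lambda>n. 2 / sqrt (real n)) \<longlonglongrightarrow> 0"
    by (rule tendsto_divide_0[OF tendsto_const filterlim_at_top_imp_at_infinity[OF s]])
  moreover have "(\<lambda>n. 784 * exp 24 / sqrt (sqrt (real n))) \<longlonglongrightarrow> (0 :: real)"
    by (rule tendsto_divide_0[OF tendsto_const
          filterlim_at_top_imp_at_infinity[OF filterlim_compose[OF sqrt_at_top s]]])
  moreover have "(\<lambda>n. (1 / 2 :: real) ^ n) \<longlonglongrightarrow> 0"
    by (rule LIMSEQ_realpow_zero) auto
  ultimately have "(\<lambda>n. 2 / sqrt (real n) + 784 * exp 24 / sqrt (sqrt (real n)) + (1 / 2) ^ n)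
      \<longlonglongrightarrow> 0 + 0 + 0"
    by (intro tendsto_add)
  then show ?thesis by simp
qed

text \<open>The complement of an independent set is a vertex cover. This turns a nonnegative excess
  into the combinatorial condition of the scheduling guarantee.\<close>

lemma nonisolated_random_bipartite:
  fixes V\<^sub>1 V\<^sub>2 :: "nat set"
  assumes sides: "balanced_sides V\<^sub>1 V\<^sub>2 n" and V: "V\<^sub>1 \<union> V\<^sub>2 = {..<2 * n}"
    and f: "0 \<le> balanced_sides.excess V\<^sub>1 V\<^sub>2 f"
    and E: "E = {{u, v} |u v. u \<in> V\<^sub>1 \<and> v \<in> V\<^sub>2 \<and> f (u, v)}"
    and W: "W \<subseteq> {..<2 * n}" "independent_set E W"
  shows "card (nonisolated (2 * n) E) \<le> 4 * card ({..<2 * n} - W)"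
proof -
  interpret balanced_sides V\<^sub>1 V\<^sub>2 n by (rule sides)
  have "vertex_cover f ({..<2 * n} - W)"
    unfolding vertex_cover_def
  proof (intro conjI ballI impI)
    show "{..<2 * n} - W \<subseteq> V\<^sub>1 \<union> V\<^sub>2" using V by auto
    fix u v assume uv: "u \<in> V\<^sub>1" "v \<in> V\<^sub>2" "f (u, v)"
    then have "{u, v} \<in> E" unfolding E by blast
    then have "\<not> (u \<in> W \<and> v \<in> W)" using W(2) unfolding independent_set_def by blast
    moreover have "u \<in> {..<2 * n}" "v \<in> {..<2 * n}" using uv V by blast+
    ultimately show "u \<in> {..<2 * n} - W \<or> v \<in> {..<2 * n} - W" by blast
  qed
  then have "cover_number f \<le> card ({..<2 * n} - W)" by (rule cover_number_le)
  moreover have "card (touched f) \<le> 4 * cover_number f" using f unfolding excess_def by linarith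
  moreover have "nonisolated (2 * n) E \<subseteq> touched f"
  proof
    fix x assume "x \<in> nonisolated (2 * n) E"
    then obtain y where "{x, y} \<in> E" unfolding nonisolated_def by blast
    then obtain u v where "{x, y} = {u, v}" "u \<in> V\<^sub>1" "v \<in> V\<^sub>2" "f (u, v)"
      unfolding E by blast
    then show "x \<in> touched f" unfolding touched_def by (auto simp: doubleton_eq_iff)
  qed
  then have "card (nonisolated (2 * n) E) \<le> card (touched f)"
    using finite_sides by (intro card_mono) (auto simp: touched_def)
  ultimately show ?thesis by linarith
qed

text \<open>The program enters only through the deterministic guarantee \<open>det\<close>. The
  success probability is squeezed between 1 and a bound that involves neither the edge probability
  nor the machines.\<close>

lemma asymptotically_almost_surely:
  fixes p :: "nat \<Rightarrow> real" and ss :: "nat \<Rightarrow> rat list" and V\<^sub>1 V\<^sub>2 :: "nat \<Rightarrow> nat set"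
  assumes det: "\<And>I. valid_inst I \<Longrightarrow> \<exists>S. feasible I S \<Longrightarrow>
      (\<And>W. W \<subseteq> {..<jobs I} \<Longrightarrow> independent_set (edges I) W \<Longrightarrow>
        card (nonisolated (jobs I) (edges I)) \<le> 4 * card ({..<jobs I} - W)) \<Longrightarrow>
      \<exists>S. returns A I S \<and> feasible I S \<and> makespan I S \<le> 2 * opt_makespan I"
    and p: "\<And>n. 0 \<le> p n \<and> p n \<le> 1"
    and ss: "\<And>n. valid_speeds (ss n) \<and> 2 \<le> length (ss n)"
    and V: "\<And>n. V\<^sub>1 n \<inter> V\<^sub>2 n = {} \<and> V\<^sub>1 n \<union> V\<^sub>2 n = {..<2 * n} \<and> card (V\<^sub>1 n) = n \<and> card (V\<^sub>2 n) = n"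
  shows "(\<lambda>n. measure_pmf.prob (random_bipartite (V\<^sub>1 n) (V\<^sub>2 n) (p n))
              {E. let I = \<lparr>jobs = 2 * n, edges = E, speeds = ss n\<rparr> in
                  \<exists>S. returns A I S \<and> feasible I S \<and> makespan I S \<le> 2 * opt_makespan I})
         \<longlonglongrightarrow> 1"
proof -
  define good where "good = (\<lambda>n. {E. let I = \<lparr>jobs = 2 * n, edges = E, speeds = ss n\<rparr> in
                  \<exists>S. returns A I S \<and> feasible I S \<and> makespan I S \<le> 2 * opt_makespan I})"
  have sides: "balanced_sides (V\<^sub>1 n) (V\<^sub>2 n) n" for n
  proof
    show "finite (V\<^sub>1 n)" "finite (V\<^sub>2 n)"
      using V[of n] finite_subset[of "V\<^sub>1 n" "{..<2 * n}"] finite_subset[of "V\<^sub>2 n" "{..<2 * n}"]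
      by blast+
    show "V\<^sub>1 n \<inter> V\<^sub>2 n = {}" "card (V\<^sub>1 n) = n" "card (V\<^sub>2 n) = n"
      using V[of n] by blast+
  qed
  have lower: "1 - balanced_sides.fail_prob (V\<^sub>1 n) (V\<^sub>2 n) (p n)
      \<le> measure_pmf.prob (random_bipartite (V\<^sub>1 n) (V\<^sub>2 n) (p n)) (good n)" for n
  proof -
    let ?E = "\<lambda>f. {{u, v} |u v. u \<in> V\<^sub>1 n \<and> v \<in> V\<^sub>2 n \<and> f (u, v)}"
    have "?E f \<in> good n" if f: "0 \<le> balanced_sides.excess (V\<^sub>1 n) (V\<^sub>2 n) f" for f
    proof -
      let ?I = "\<lparr>jobs = 2 * n, edges = ?E f, speeds = ss n\<rparr>"
      have "valid_inst ?I"
      proof -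
        have "bipartite {..<2 * n} (?E f)"
          unfolding bipartite_def using V[of n] by blast
        then show ?thesis using ss[of n] by (simp add: valid_inst_def)
      qed
      \<comment> \<open>Each side of the graph on a machine of its own is feasible, since there are
        at least two machines.\<close>
      moreover have "feasible ?I (map (\<lambda>v. if v \<in> V\<^sub>1 n then 0 else 1) [0..<2 * n])"
      proof -
        let ?S = "map (\<lambda>v. if v \<in> V\<^sub>1 n then 0 else 1 :: nat) [0..<2 * n]"
        have "{u, v} \<notin> ?E f" if "u \<in> jobs_on ?S i" "v \<in> jobs_on ?S i" for i u v
        proof
          assume "{u, v} \<in> ?E f"
          then have "(u \<in> V\<^sub>1 n) \<noteq> (v \<in> V\<^sub>1 n)"
            using V[of n] by (auto simp: doubleton_eq_iff)
          moreover have "(if u \<in> V\<^sub>1 n then 0 else 1 :: nat) = (if v \<in> V\<^sub>1 n then 0 else 1)"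
            using that unfolding jobs_on_def by (auto split: if_splits)
          ultimately show False by (simp split: if_splits)
        qed
        moreover have "ss n \<noteq> []" "1 < length (ss n)" using ss[of n] by auto
        ultimately show ?thesis unfolding feasible_def independent_set_def by simp
      qed
      then have "\<exists>S. feasible ?I S" by blast
      moreover have "card (nonisolated (jobs ?I) (edges ?I)) \<le> 4 * card ({..<jobs ?I} - W)"
        if "W \<subseteq> {..<jobs ?I}" "independent_set (edges ?I) W" for W
        using nonisolated_random_bipartite[OF sides _ f refl, of W] V[of n] that by simp
      ultimately have "\<exists>S. returns A ?I S \<and> feasible ?I S \<and> makespan ?I S \<le> 2 * opt_makespan ?I"
        by (rule det)
      then show ?thesis unfolding good_def Let_def by blast
    qed
    then have "{f. 0 \<le> balanced_sides.excess (V\<^sub>1 n) (V\<^sub>2 n) f} \<subseteq> ?E -` good n" by blast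
    then have "measure_pmf.prob (Pi_pmf (V\<^sub>1 n \<times> V\<^sub>2 n) False (\<lambda>_. bernoulli_pmf (p n)))
          {f. 0 \<le> balanced_sides.excess (V\<^sub>1 n) (V\<^sub>2 n) f}
        \<le> measure_pmf.prob (random_bipartite (V\<^sub>1 n) (V\<^sub>2 n) (p n)) (good n)"
      unfolding random_bipartite_def measure_map_pmf
      by (intro measure_pmf.finite_measure_mono) auto
    then show ?thesis using balanced_sides.prob_excess_nonneg[OF sides] p[of n] by simp
  qed
  let ?b = "\<lambda>n. 2 / sqrt (real n) + 784 * exp 24 / sqrt (sqrt (real n)) + (1 / 2) ^ n"
  have "(\<lambda>n. measure_pmf.prob (random_bipartite (V\<^sub>1 n) (V\<^sub>2 n) (p n)) (good n)) \<longlonglongrightarrow> 1"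
  proof (rule tendsto_sandwich)
    show "\<forall>\<^sub>F n in sequentially. 1 - ?b n
        \<le> measure_pmf.prob (random_bipartite (V\<^sub>1 n) (V\<^sub>2 n) (p n)) (good n)"
      using eventually_ge_at_top[of 12]
    proof eventually_elim
      case (elim n)
      show ?case
        using lower[of n] balanced_sides.fail_prob_le[OF sides _ _ elim, of "p n"] p[of n] by linarith
    qed
    show "(\<lambda>n. 1 - ?b n) \<longlonglongrightarrow> 1"
      using tendsto_diff[OF tendsto_const fail_bound_tendsto_0, of "1 :: real"] by simp
  qed auto
  then show ?thesis unfolding good_def .
qed

theorem theorem19:
  shows "\<exists>A. polynomial_time_algorithm A \<and>
    (\<forall>(p :: nat \<Rightarrow> real) (ss :: nat \<Rightarrow> rat list) (V\<^sub>1 :: nat \<Rightarrow> nat set) (V\<^sub>2 :: nat \<Rightarrow> nat set).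
       (\<forall>n. 0 \<le> p n \<and> p n \<le> 1) \<longrightarrow>
       (mono p \<or> antimono p) \<longrightarrow>
       (\<forall>n. valid_speeds (ss n) \<and> 2 \<le> length (ss n)) \<longrightarrow>
       (\<forall>n. V\<^sub>1 n \<inter> V\<^sub>2 n = {} \<and> V\<^sub>1 n \<union> V\<^sub>2 n = {..<2 * n} \<and> card (V\<^sub>1 n) = n \<and> card (V\<^sub>2 n) = n) \<longrightarrow>
       (\<lambda>n. measure_pmf.prob (random_bipartite (V\<^sub>1 n) (V\<^sub>2 n) (p n))
              {E. let I = \<lparr>jobs = 2 * n, edges = E, speeds = ss n\<rparr> in
                  \<exists>S. returns A I S \<and> feasible I S \<and> makespan I S \<le> 2 * opt_makespan I})
         \<longlonglongrightarrow> 1)"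
proof (intro exI[of _ "compile schedule_prog"] conjI allI impI)
  show "polynomial_time_algorithm (compile schedule_prog)"
    by (rule polynomial_time_algorithm_schedule_prog)
next
  fix p :: "nat \<Rightarrow> real" and ss :: "nat \<Rightarrow> rat list" and V\<^sub>1 V\<^sub>2 :: "nat \<Rightarrow> nat set"
  assume p: "\<forall>n. 0 \<le> p n \<and> p n \<le> 1"
    and ss: "\<forall>n. valid_speeds (ss n) \<and> 2 \<le> length (ss n)"
    and V: "\<forall>n. V\<^sub>1 n \<inter> V\<^sub>2 n = {} \<and> V\<^sub>1 n \<union> V\<^sub>2 n = {..<2 * n} \<and> card (V\<^sub>1 n) = n \<and> card (V\<^sub>2 n) = n"
  show "(\<lambda>n. measure_pmf.prob (random_bipartite (V\<^sub>1 n) (V\<^sub>2 n) (p n))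
          {E. let I = \<lparr>jobs = 2 * n, edges = E, speeds = ss n\<rparr> in
              \<exists>S. returns (compile schedule_prog) I S \<and> feasible I S \<and>
                makespan I S \<le> 2 * opt_makespan I}) \<longlonglongrightarrow> 1"
  proof (rule asymptotically_almost_surely)
    fix I
    assume I: "valid_inst I" "\<exists>S. feasible I S"
      and many: "\<And>W. W \<subseteq> {..<jobs I} \<Longrightarrow> independent_set (edges I) W \<Longrightarrow>
        card (nonisolated (jobs I) (edges I)) \<le> 4 * card ({..<jobs I} - W)"
    from schedule_correct[OF I] obtain S
      where "S = map (run schedule_prog (input_state (encode I)) ''out'') [0..<jobs I]"
        "feasible I S" "makespan I S \<le> 2 * opt_makespan I"
      using many by metis
    then show "\<exists>S. returns (compile schedule_prog) I S \<and> feasible I S \<and> makespan I S \<le> 2 * opt_makespan I"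
      using returns_schedule_prog[OF I(1)] by blast
  qed (use p ss V in blast)+
qed

end
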